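(* There exists at most one global weak solution $u$ (in the sense defined in the context) of the incompressible Navier-Stokes equations on $\mathbb{R}^+\times(\mathbb{R}^2\setminus\Gamma)$ with initial velocity $u_0=K[\omega_0]+\alpha H$.
   Context: Identify $\mathbb{R}^2$ with $\mathbb{C}$; $D=B(0,1)$, $x^\perp=(-x_2,x_1)$; $y^*=y/|y|^2$; $M^t$ is the transpose of $M$. Curve. $\Gamma$ is a $C^2$ Jordan arc (image of an injective $C^2$ map $\Gamma:[0,1]\to\mathbb{R}^2$ with nonvanishing derivative) with endpoints normalized to $\Gamma(0)=-1$, $\Gamma(1)=1$, whose intersection with the segment $[-1,1]$ is a finite union of segments and points. $\Pi=\mathbb{R}^2\setminus\Gamma$. $T:\Pi\to\mathrm{int}\,D^c$ is a fixed biholomorphism such that: $T^{-1}$ and $DT^{-1}$ extend continuously up to the boundary, $T^{-1}$ maps $\partial D$ to $\Gamma$; $DT^{-1}$ is bounded; $T$ and $DT$ extend continuously to $\Gamma$ with different values on each side, except at the endpoints, where $DT$ behaves like the inverse of the square root of the distance; $DT$ is bounded outside any disk $B(0,R)\supset\Gamma$; $DT\in L^p(\Pi\cap B(0,R))$ for all $p<4$, $R>0$. At infinity $T(z)=\beta z+h(z)$ with $\beta$ a nonzero real number, $h$ bounded holomorphic, $h'(z)=O(|z|^{-2})$. Data. $\nu>0$, $\gamma\in\mathbb{R}$ and $\omega_0\in C_c^\infty(\mathbb{R}^2\setminus\Gamma)$ are fixed and $\alpha=\gamma+\int_{\mathbb{R}^2}\omega_0\,dx$. $K(x,y)=\frac1{2\pi}DT^t(x)\Big(\frac{(T(x)-T(y))^\perp}{|T(x)-T(y)|^2}-\frac{(T(x)-T(y)^*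 )^\perp}{|T(x)-T(y)^*|^2}\Big)$, $K[\omega_0](x)=\int_{\Pi}K(x,y)\omega_0(y)\,dy$, and $H(x)=\frac1{2\pi}DT^t(x)\frac{T(x)^\perp}{|T(x)|^2}$. Cutoff and spaces. $\Phi\in C^\infty(\mathbb{R})$ is nondecreasing, $0\le\Phi\le1$, $\Phi(s)=1$ for $s\ge2$, $\Phi(s)=0$ for $s\le1$. For a fixed, sufficiently large $\lambda\ge2$ (so that $\Phi^{0,\lambda}$ vanishes on a large ball containing $\Gamma$), $\Phi^{0,\lambda}(x)=\Phi\big(\frac{|T(x)|-1}{\lambda}\big)$ and $v=\alpha H\Phi^{0,\lambda}$. For $\Omega\subset\mathbb{R}^2$ open, $V(\Omega)$ is the space of divergence-free vector fields with components in $C_c^\infty(\Omega)$; $\mathcal{V}(\Omega)$, $\mathcal{H}(\Omega)$ are its closures in $H^1(\Omega)$ and $L^2(\Omega)$; $\mathcal{V}_\Gamma=\mathcal{V}(\mathbb{R}^2\setminus\Gamma)$, $\mathcal{H}_\Gamma=\mathcal{H}(\mathbb{R}^2\setminus\Gamma)$. Weak solution. Let $u_0$ be such that $u_0-v\in\mathcal{H}_\Gamma$. $u$ is a weak solution of the incompressible Navier-Stokes equations on $\mathbb{R}^+\times(\mathbb{R}^2\setminus\Gamma)$ with initial velocity $u_0$ if and only if $u-v\in C([0,\infty);\mathcal{H}_\Gamma)\cap L^2_{\mathrm{loc}}([0,\infty);\mathcal{V}_\Gamma)$; for every divergence-free vector field $\psi\in C_c^\infty((0,\infty)\times(\mathbb{R}^2\setminus\Gamma))$,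 $\int_0^\infty\int_{\mathbb{R}^2\setminus\Gamma}\big(u\cdot\psi_t+[(u\cdot\nabla)\psi]\cdot u+\nu u\cdot\Delta\psi\big)\,dx\,dt=0$; $\mathrm{div}\,u=0$ in the sense of distributions; and $u(\cdot,t)\rightharpoonup u_0$ in the sense of distributions as $t\to0^+$. *)

theory Defs
  imports "HOL-Complex_Analysis.Complex_Analysis" "HOL-Library.Landau_Symbols"
begin

(* The plane R^2 is the type complex with its Euclidean structure (Basis = {1, \<i>});
   vector fields are functions complex \<Rightarrow> complex.  Fields defined on the complement Omega of
   the arc are total functions whose values outside Omega are irrelevant, and elements of
   L^2, H^1, ... are represented by Lebesgue measurable functions modulo null sets. *)

section \<open>Smooth functions and differential operators\<close>

definition pd :: "'a::euclidean_space \<Rightarrow> ('a \<Rightarrow> 'b::real_normed_vector) \<Rightarrow> 'a \<Rightarrow> 'b" where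
  "pd e f x = frechet_derivative f (at x) e"

primrec class_C :: "nat \<Rightarrow> ('a::euclidean_space \<Rightarrow> 'b::real_normed_vector) \<Rightarrow> bool" where
  "class_C 0 f \<longleftrightarrow> continuous_on UNIV f"
| "class_C (Suc k) f \<longleftrightarrow> (\<forall>x. f differentiable (at x)) \<and> (\<forall>e\<in>Basis. class_C k (pd e f))"

definition smooth :: "('a::euclidean_space \<Rightarrow> 'b::real_normed_vector) \<Rightarrow> bool" where
  "smooth f \<longleftrightarrow> (\<forall>k. class_C k f)"

(* C_c^\<infinity>(\<Omega>), the functions being extended by zero to the whole space. *)
definition test_functions ::
    "'a::euclidean_space set \<Rightarrow> ('a \<Rightarrow> 'b::real_normed_vector) set" where
  "test_functions \<Omega> =
     {f. smooth f \<and> compact (closure {x. f x \<noteq> 0}) \<and> closure {x. f x \<noteq> 0} \<subseteq> \<Omega>}"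

definition divergence :: "('a::euclidean_space \<Rightarrow> 'a) \<Rightarrow> 'a \<Rightarrow> real" where
  "divergence w x = (\<Sum>e\<in>Basis. pd e w x \<bullet> e)"

definition gradient :: "('a::euclidean_space \<Rightarrow> real) \<Rightarrow> 'a \<Rightarrow> 'a" where
  "gradient f x = (\<Sum>e\<in>Basis. pd e f x *\<^sub>R e)"

definition laplacian :: "('a::euclidean_space \<Rightarrow> 'b::real_normed_vector) \<Rightarrow> 'a \<Rightarrow> 'b" where
  "laplacian f x = (\<Sum>e\<in>Basis. pd e (pd e f) x)"

(* (w . \<nabla>) f *)
definition advect ::
    "('a::euclidean_space \<Rightarrow> 'a) \<Rightarrow> ('a \<Rightarrow> 'b::real_normed_vector) \<Rightarrow> 'a \<Rightarrow> 'b" where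
  "advect w f x = (\<Sum>e\<in>Basis. (w x \<bullet> e) *\<^sub>R pd e f x)"


section \<open>Function spaces\<close>

definition L2 :: "complex set \<Rightarrow> (complex \<Rightarrow> complex) set" where
  "L2 \<Omega> = {w. set_borel_measurable lebesgue \<Omega> w \<and>
              set_integrable lebesgue \<Omega> (\<lambda>x. (norm (w x))\<^sup>2)}"

definition L2_norm :: "complex set \<Rightarrow> (complex \<Rightarrow> complex) \<Rightarrow> real" where
  "L2_norm \<Omega> w = sqrt (LINT x:\<Omega>|lebesgue. (norm (w x))\<^sup>2)"

definition has_weak_partial ::
    "complex set \<Rightarrow> complex \<Rightarrow> (complex \<Rightarrow> complex) \<Rightarrow> (complex \<Rightarrow> complex) \<Rightarrow> bool" where
  "has_weak_partial \<Omega> e w g \<longleftrightarrow>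
     (\<forall>\<phi>::complex \<Rightarrow> real. \<phi> \<in> test_functions \<Omega> \<longrightarrow>
        (LINT x:\<Omega>|lebesgue. pd e \<phi> x *\<^sub>R w x) = - (LINT x:\<Omega>|lebesgue. \<phi> x *\<^sub>R g x))"

definition H1 :: "complex set \<Rightarrow> (complex \<Rightarrow> complex) set" where
  "H1 \<Omega> = {w \<in> L2 \<Omega>. \<forall>e\<in>Basis. \<exists>g\<in>L2 \<Omega>. has_weak_partial \<Omega> e w g}"

(* Determined up to a null set for w in H1 \<Omega>, \<Omega> open. *)
definition weak_partial ::
    "complex set \<Rightarrow> complex \<Rightarrow> (complex \<Rightarrow> complex) \<Rightarrow> complex \<Rightarrow> complex" where
  "weak_partial \<Omega> e w = (SOME g. g \<in> L2 \<Omega> \<and> has_weak_partial \<Omega> e w g)"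

definition H1_norm :: "complex set \<Rightarrow> (complex \<Rightarrow> complex) \<Rightarrow> real" where
  "H1_norm \<Omega> w =
     sqrt ((L2_norm \<Omega> w)\<^sup>2 + (\<Sum>e\<in>Basis. (L2_norm \<Omega> (weak_partial \<Omega> e w))\<^sup>2))"

definition solenoidal_tests :: "complex set \<Rightarrow> (complex \<Rightarrow> complex) set" where
  "solenoidal_tests \<Omega> = {\<phi> \<in> test_functions \<Omega>. \<forall>x. divergence \<phi> x = 0}"

definition H_space :: "complex set \<Rightarrow> (complex \<Rightarrow> complex) set" where
  "H_space \<Omega> =
     {w \<in> L2 \<Omega>. \<forall>\<epsilon>>0. \<exists>\<phi>\<in>solenoidal_tests \<Omega>. L2_norm \<Omega> (\<lambda>x. w x - \<phi> x) < \<epsilon>}"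

definition V_space :: "complex set \<Rightarrow> (complex \<Rightarrow> complex) set" where
  "V_space \<Omega> =
     {w \<in> H1 \<Omega>. \<forall>\<epsilon>>0. \<exists>\<phi>\<in>solenoidal_tests \<Omega>. H1_norm \<Omega> (\<lambda>x. w x - \<phi> x) < \<epsilon>}"

(* C([0,\<infinity>); H_space \<Omega>) *)
definition C_H :: "complex set \<Rightarrow> (real \<Rightarrow> complex \<Rightarrow> complex) set" where
  "C_H \<Omega> =
     {w. (\<forall>t\<ge>0. w t \<in> H_space \<Omega>) \<and>
         (\<forall>t\<ge>0. ((\<lambda>s. L2_norm \<Omega> (\<lambda>x. w s x - w t x)) \<longlongrightarrow> 0) (at t within {0..}))}"

(* L^2_loc([0,\<infinity>); V_space \<Omega>) in the sense of Bochner: strong measurability means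
   almost everywhere approximation by measurable functions with finitely many values. *)
definition L2loc_V :: "complex set \<Rightarrow> (real \<Rightarrow> complex \<Rightarrow> complex) set" where
  "L2loc_V \<Omega> =
     {w. (AE t in lebesgue. 0 \<le> t \<longrightarrow> w t \<in> V_space \<Omega>) \<and>
         (\<exists>s :: nat \<Rightarrow> real \<Rightarrow> complex \<Rightarrow> complex.
            (\<forall>n. finite (range (s n)) \<and> range (s n) \<subseteq> V_space \<Omega> \<and>
                 (\<forall>f. {t. s n t = f} \<in> sets lebesgue)) \<and>
            (AE t in lebesgue. 0 \<le> t \<longrightarrow>
               (\<lambda>n. H1_norm \<Omega> (\<lambda>x. s n t x - w t x)) \<longlonglongrightarrow> 0)) \<and>
         (\<forall>\<tau>>0. set_integrable lebesgue {0..\<tau>} (\<lambda>t. (H1_norm \<Omega> (w t))\<^sup>2))}"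


section \<open>The arc and its exterior conformal map\<close>

definition C2_arc :: "(real \<Rightarrow> complex) \<Rightarrow> bool" where
  "C2_arc g \<longleftrightarrow> arc g \<and>
     (\<exists>g' g''. (\<forall>t\<in>{0..1}. (g has_vector_derivative g' t) (at t within {0..1}) \<and>
                           (g' has_vector_derivative g'' t) (at t within {0..1}) \<and>
                           g' t \<noteq> 0) \<and>
               continuous_on {0..1} g'')"

(* Points count as degenerate segments. *)
definition finite_union_of_segments :: "complex set \<Rightarrow> bool" where
  "finite_union_of_segments A \<longleftrightarrow>
     (\<exists>F. finite F \<and> A = (\<Union>(a, b)\<in>F. closed_segment a b))"

abbreviation unit_exterior :: "complex set" where
  "unit_exterior \<equiv> interior (- ball 0 1)"

(* T and its derivative extend continuously to \<Gamma> near p from each of the two sides W1, W2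
   into which \<Gamma> cuts a small disk around p.  Only the two boundary values of T are required to
   differ: those of T' may agree at isolated points, as for T z = z + sqrt (z^2 - 1) at
   the midpoint of \<Gamma> = [-1,1]. *)
definition two_sided_extension :: "complex set \<Rightarrow> (complex \<Rightarrow> complex) \<Rightarrow> complex \<Rightarrow> bool" where
  "two_sided_extension \<Gamma> T p \<longleftrightarrow>
     (\<exists>r>0. \<exists>W1 W2 T1 T2 D1 D2.
        W1 \<noteq> {} \<and> W2 \<noteq> {} \<and> open W1 \<and> open W2 \<and> connected W1 \<and> connected W2 \<and>
        W1 \<inter> W2 = {} \<and> W1 \<union> W2 = ball p r - \<Gamma> \<and>
        continuous_on (W1 \<union> (\<Gamma> \<inter> ball p r)) T1 \<and> (\<forall>z\<in>W1. T1 z = T z) \<and>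
        continuous_on (W2 \<union> (\<Gamma> \<inter> ball p r)) T2 \<and> (\<forall>z\<in>W2. T2 z = T z) \<and>
        (\<forall>q\<in>\<Gamma> \<inter> ball p r. T1 q \<noteq> T2 q) \<and>
        continuous_on (W1 \<union> (\<Gamma> \<inter> ball p r)) D1 \<and> (\<forall>z\<in>W1. D1 z = deriv T z) \<and>
        continuous_on (W2 \<union> (\<Gamma> \<inter> ball p r)) D2 \<and> (\<forall>z\<in>W2. D2 z = deriv T z))"

definition exterior_map :: "(real \<Rightarrow> complex) \<Rightarrow> (complex \<Rightarrow> complex) \<Rightarrow> bool" where
  "exterior_map g T \<longleftrightarrow>
     (let \<Gamma> = path_image g; \<Omega> = - \<Gamma>; S = the_inv_into \<Omega> T in
        T holomorphic_on \<Omega> \<and> bij_betw T \<Omega> unit_exterior \<and> S holomorphic_on unit_exterior \<and>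
        (\<exists>S0. continuous_on (- ball 0 1) S0 \<and> (\<forall>z\<in>unit_exterior. S0 z = S z) \<and>
              S0 ` sphere 0 1 \<subseteq> \<Gamma>) \<and>
        (\<exists>S1. continuous_on (- ball 0 1) S1 \<and> (\<forall>z\<in>unit_exterior. S1 z = deriv S z)) \<and>
        bounded (deriv S ` unit_exterior) \<and>
        (\<forall>t\<in>{0<..<1}. two_sided_extension \<Gamma> T (g t)) \<and>
        (\<forall>e\<in>{pathstart g, pathfinish g}.
           (\<exists>l. (T \<longlongrightarrow> l) (at e within \<Omega>)) \<and>
           (\<exists>c>0. \<exists>C>0. \<exists>r>0. \<forall>z\<in>\<Omega> \<inter> ball e r.
              c / sqrt (dist z e) \<le> norm (deriv T z) \<and>
              norm (deriv T z) \<le> C / sqrt (dist z e))) \<and>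
        (\<forall>R. \<Gamma> \<subseteq> ball 0 R \<longrightarrow> bounded (deriv T ` (- ball 0 R))) \<and>
        (\<forall>p R. 1 \<le> p \<longrightarrow> p < 4 \<longrightarrow> 0 < R \<longrightarrow>
           set_integrable lebesgue (\<Omega> \<inter> ball 0 R) (\<lambda>x. norm (deriv T x) powr p)) \<and>
        (\<exists>(\<beta>::real) h. \<beta> \<noteq> 0 \<and> h holomorphic_on \<Omega> \<and> bounded (h ` \<Omega>) \<and>
           (\<forall>z\<in>\<Omega>. T z = of_real \<beta> * z + h z) \<and>
           deriv h \<in> O[at_infinity](\<lambda>z. 1 / z\<^sup>2)))"


section \<open>The Biot-Savart kernel and the harmonic field\<close>

definition perp :: "complex \<Rightarrow> complex" where
  "perp z = Complex (- Im z) (Re z)"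

definition inversion :: "complex \<Rightarrow> complex" where
  "inversion y = y /\<^sub>R (norm y)\<^sup>2"

(* DT^t(x), the transpose of the real Jacobian matrix of T. *)
definition DT_transpose :: "(complex \<Rightarrow> complex) \<Rightarrow> complex \<Rightarrow> complex \<Rightarrow> complex" where
  "DT_transpose T x = adjoint (frechet_derivative T (at x))"

definition K_kernel :: "(complex \<Rightarrow> complex) \<Rightarrow> complex \<Rightarrow> complex \<Rightarrow> complex" where
  "K_kernel T x y =
     (1 / (2 * pi)) *\<^sub>R DT_transpose T x
       (perp (T x - T y) /\<^sub>R (norm (T x - T y))\<^sup>2
        - perp (T x - inversion (T y)) /\<^sub>R (norm (T x - inversion (T y)))\<^sup>2)"

definition K_op ::
    "complex set \<Rightarrow> (complex \<Rightarrow> complex) \<Rightarrow> (complex \<Rightarrow> real) \<Rightarrow> complex \<Rightarrow> complex" where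
  "K_op \<Omega> T \<omega> x = (LINT y:\<Omega>|lebesgue. \<omega> y *\<^sub>R K_kernel T x y)"

definition H_field :: "(complex \<Rightarrow> complex) \<Rightarrow> complex \<Rightarrow> complex" where
  "H_field T x = (1 / (2 * pi)) *\<^sub>R DT_transpose T x (perp (T x) /\<^sub>R (norm (T x))\<^sup>2)"

definition cutoff :: "(real \<Rightarrow> real) \<Rightarrow> real \<Rightarrow> (complex \<Rightarrow> complex) \<Rightarrow> complex \<Rightarrow> real" where
  "cutoff \<Phi> lam T x = \<Phi> ((norm (T x) - 1) / lam)"

definition v_field ::
    "real \<Rightarrow> (real \<Rightarrow> real) \<Rightarrow> real \<Rightarrow> (complex \<Rightarrow> complex) \<Rightarrow> complex \<Rightarrow> complex" where
  "v_field \<alpha> \<Phi> lam T x = (\<alpha> * cutoff \<Phi> lam T x) *\<^sub>R H_field T x"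


section \<open>Weak solutions\<close>

(* Integrals over space-time are iterated, so that they depend only on the almost everywhere
   class of each u t. *)
definition weak_solution ::
    "real \<Rightarrow> complex set \<Rightarrow> (complex \<Rightarrow> complex) \<Rightarrow> (complex \<Rightarrow> complex)
      \<Rightarrow> (real \<Rightarrow> complex \<Rightarrow> complex) \<Rightarrow> bool" where
  "weak_solution \<nu> \<Omega> v u0 u \<longleftrightarrow>
     (\<lambda>x. u0 x - v x) \<in> H_space \<Omega> \<and>
     (\<lambda>t x. u t x - v x) \<in> C_H \<Omega> \<inter> L2loc_V \<Omega> \<and>
     (\<forall>\<psi> :: real \<times> complex \<Rightarrow> complex.
        \<psi> \<in> test_functions ({0<..} \<times> \<Omega>) \<and>
        (\<forall>t x. divergence (\<lambda>y. \<psi> (t, y)) x = 0) \<longrightarrow>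
        (LINT t:{0<..}|lebesgue. (LINT x:\<Omega>|lebesgue.
            u t x \<bullet> pd (1, 0) \<psi> (t, x)
          + advect (u t) (\<lambda>y. \<psi> (t, y)) x \<bullet> u t x
          + \<nu> * (u t x \<bullet> laplacian (\<lambda>y. \<psi> (t, y)) x))) = 0) \<and>
     (\<forall>\<phi> :: real \<times> complex \<Rightarrow> real.
        \<phi> \<in> test_functions ({0<..} \<times> \<Omega>) \<longrightarrow>
        (LINT t:{0<..}|lebesgue. (LINT x:\<Omega>|lebesgue.
            u t x \<bullet> gradient (\<lambda>y. \<phi> (t, y)) x)) = 0) \<and>
     (\<forall>\<phi> :: complex \<Rightarrow> complex.
        \<phi> \<in> test_functions \<Omega> \<longrightarrow>
        ((\<lambda>t. LINT x:\<Omega>|lebesgue. u t x \<bullet> \<phi> x) \<longlongrightarrow>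
           (LINT x:\<Omega>|lebesgue. u0 x \<bullet> \<phi> x)) (at_right 0))"

end

(* The difference w of the velocities lies in C([0,oo); H) and in L^2_loc([0,oo); V).  Subtracting
   the two weak formulations, testing with products of a smooth step in time (supplied by Phi) and a
   solenoidal field p, and using du Bois-Reymond in time shows that <w(t) - w(s), p> is the integral
   over [s,t] of a continuous function A(r, p).  For solenoidal test functions, integration by parts
   and the Ladyzhenskaya inequality |f|_4^4 <= 2 |f|^2 |grad f|^2 bound A(r, p) by the H^1 norm
   of p, and A(r, w(r)) by C (1 + |u1-v|_{H^1}^2 + |u2-v|_{H^1}^2) |w(r)|^2; both bounds pass to V by
   density for almost every r.  Averaging the increments of |w|^2 over short time steps, with w
   approximated by simple functions with values in test functions, gives the energy inequality
   without any duality theory for the time derivative, and Gronwall's inequality gives w = 0.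
   The geometry of the arc enters only through the boundedness and continuity of v. *)
theory Submission
  imports Defs
begin

section \<open>Calculus for smoothness defined through iterated partial derivatives\<close>

section \<open>Smooth functions\<close>

text \<open>The obstacle is that \<open>w(r)\<close> is not an admissible test function: it need be
  neither smooth nor compactly supported, and the equation controls its increments in time only
  through pairings with elements of V. The form A is therefore written with all derivatives on the
  test field. It then makes sense for fields that are merely square integrable up to the background
  \<open>v\<close>, and its continuity in time needs only C([0,oo); H); the H^1 information,
  available for almost every time only, enters solely through bounds. Two bounds share the work. The
  rough one, with a constant depending on a bound R of the L^2 norms, pays for approximation errors;
  the sharp one, in which viscosity absorbs the gradient of \<open>w\<close>, is applied only in the
  direction of \<open>w\<close>. Young's inequality with a free weight \<open>l\<close> splits the
  rough bound into \<open>l\<close> times a squared H^1 error and an integrable function of time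
  divided by \<open>l\<close>. Squared errors of order \<open>1/l^2\<close> make both parts of order
  \<open>1/l\<close>, and \<open>l\<close> tends to infinity.\<close>

lemma pd_eq: "(f has_derivative f') (at x) \<Longrightarrow> pd e f x = f' e"
  unfolding pd_def using frechet_derivative_at by metis

lemma pd_const [simp]: "pd e (\<lambda>x. c) = (\<lambda>x. 0)"
  by (rule ext) (rule pd_eq, auto intro!: derivative_eq_intros)

lemma class_C_Suc_imp: "class_C (Suc k) f \<Longrightarrow> class_C k f"
proof (induction k arbitrary: f)
  case 0
  then show ?case by (auto simp: differentiable_imp_continuous_on differentiable_on_def
        intro: differentiable_at_withinI)
next
  case (Suc k)
  then show ?case by (metis class_C.simps(2))
qed

lemma class_C_zero: "class_C k (\<lambda>x. 0)"
  by (induction k) auto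

lemma class_C_const: "class_C k (\<lambda>x. c)"
  by (cases k) (auto simp: class_C_zero)

lemma differentiable_has_derivative:
  "f differentiable (at x) \<Longrightarrow> (f has_derivative frechet_derivative f (at x)) (at x)"
  by (simp add: frechet_derivative_works)

lemma class_C_differentiable: "class_C (Suc k) f \<Longrightarrow> f differentiable (at x)"
  by simp

lemma pd_add: "f differentiable at x \<Longrightarrow> g differentiable at x \<Longrightarrow>
    pd e (\<lambda>x. f x + g x) x = pd e f x + pd e g x"
  unfolding pd_def[of e f] pd_def[of e g]
  by (rule pd_eq[OF has_derivative_add]) (auto simp: frechet_derivative_works)

lemma class_C_add: "class_C k f \<Longrightarrow> class_C k g \<Longrightarrow> class_C k (\<lambda>x. f x + g x)"
proof (induction k arbitrary: f g)
  case 0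
  then show ?case by (auto intro: continuous_intros)
next
  case (Suc k)
  then have "pd e (\<lambda>x. f x + g x) = (\<lambda>x. pd e f x + pd e g x)" for e
    by (intro ext pd_add) auto
  with Suc show ?case by auto
qed

lemma class_C_sum: "(\<And>i. i \<in> I \<Longrightarrow> class_C k (f i)) \<Longrightarrow> class_C k (\<lambda>x. \<Sum>i\<in>I. f i x)"
  by (induction I rule: infinite_finite_induct) (auto intro: class_C_add class_C_zero)

lemma pd_bilinear:
  assumes "bounded_bilinear p" "f differentiable at x" "g differentiable at x"
  shows "pd e (\<lambda>x. p (f x) (g x)) x = p (f x) (pd e g x) + p (pd e f x) (g x)"
  unfolding pd_def[of e f] pd_def[of e g]
  by (rule pd_eq[OF bounded_bilinear.FDERIV[OF assms(1)]])
     (use assms in \<open>auto simp: frechet_derivative_works\<close>)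

text \<open>Leibniz's rule differentiates the factors one at a time, so the induction on the order
  must keep both factors arbitrary. One bilinear version covers products, scalar multiples and inner
  products.\<close>

lemma class_C_bilinear:
  assumes "bounded_bilinear p"
  shows "class_C k f \<Longrightarrow> class_C k g \<Longrightarrow> class_C k (\<lambda>x. p (f x) (g x))"
proof (induction k arbitrary: f g)
  case 0
  then show ?case using bounded_bilinear.continuous_on[OF assms] by auto
next
  case (Suc k)
  have d: "f differentiable at x" "g differentiable at x" for x using Suc.prems by auto
  have "(\<lambda>x. p (f x) (g x)) differentiable at x" for x
    using bounded_bilinear.FDERIV[OF assms d(1)[THEN differentiable_has_derivative]
        d(2)[THEN differentiable_has_derivative]] by (auto simp: differentiable_def)
  moreover have "class_C k (pd e (\<lambda>x. p (f x) (g x)))" if "e \<in> Basis" for e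
  proof -
    have "pd e (\<lambda>x. p (f x) (g x)) = (\<lambda>x. p (f x) (pd e g x) + p (pd e f x) (g x))"
      by (intro ext pd_bilinear[OF assms] d)
    moreover have "class_C k f" "class_C k g" using Suc.prems[THEN class_C_Suc_imp] by auto
    moreover have "class_C k (pd e f)" "class_C k (pd e g)" using Suc.prems that by auto
    ultimately show ?thesis by (simp add: class_C_add Suc.IH)
  qed
  ultimately show ?case by simp
qed

lemma pd_linear_comp:
  assumes "bounded_linear L" "f differentiable at x"
  shows "pd e (\<lambda>x. L (f x)) x = L (pd e f x)"
  unfolding pd_def[of e f]
  by (rule pd_eq) (use bounded_linear.has_derivative[OF assms(1)] assms(2)
      in \<open>auto simp: frechet_derivative_works\<close>)

lemma class_C_linear:
  assumes "bounded_linear L"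
  shows "class_C k f \<Longrightarrow> class_C k (\<lambda>x. L (f x))"
proof (induction k arbitrary: f)
  case 0
  then show ?case using bounded_linear.continuous_on[OF assms] by auto
next
  case (Suc k)
  have d: "f differentiable at x" for x using Suc.prems by auto
  have "pd e (\<lambda>x. L (f x)) = (\<lambda>x. L (pd e f x))" for e
    by (intro ext pd_linear_comp assms d)
  moreover have "(\<lambda>x. L (f x)) differentiable at x" for x
    using bounded_linear.has_derivative[OF assms d[THEN differentiable_has_derivative]]
    by (auto simp: differentiable_def)
  ultimately show ?case using Suc by auto
qed

lemma frechet_derivative_eq_sum_pd:
  fixes f :: "'a::euclidean_space \<Rightarrow> 'b::real_normed_vector"
  assumes "f differentiable at x"
  shows "frechet_derivative f (at x) h = (\<Sum>b\<in>Basis. (h \<bullet> b) *\<^sub>R pd b f x)"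
proof -
  have l: "linear (frechet_derivative f (at x))" using assms by (rule linear_frechet_derivative)
  have "frechet_derivative f (at x) h = frechet_derivative f (at x) (\<Sum>b\<in>Basis. (h \<bullet> b) *\<^sub>R b)"
    by (simp add: euclidean_representation)
  also have "\<dots> = (\<Sum>b\<in>Basis. (h \<bullet> b) *\<^sub>R pd b f x)"
    by (simp only: linear_sum[OF l] linear_cmul[OF l] pd_def)
  finally show ?thesis .
qed

lemma pd_affine:
  fixes f :: "'a::euclidean_space \<Rightarrow> 'b::real_normed_vector" and L :: "'c::euclidean_space \<Rightarrow> 'a"
  assumes "bounded_linear L" "f differentiable at (L x + c)"
  shows "pd e (\<lambda>x. f (L x + c)) x = (\<Sum>b\<in>Basis. (L e \<bullet> b) *\<^sub>R pd b f (L x + c))"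
proof -
  have "((\<lambda>x. f (L x + c)) has_derivative (\<lambda>h. frechet_derivative f (at (L x + c)) (L h))) (at x)"
  proof -
    have "((\<lambda>x. L x + c) has_derivative L) (at x)"
      using has_derivative_add[OF bounded_linear_imp_has_derivative[OF assms(1)] has_derivative_const] by simp
    moreover have "(f has_derivative frechet_derivative f (at (L x + c))) (at (L x + c))"
      using assms(2) by (simp add: frechet_derivative_works)
    ultimately show ?thesis by (rule has_derivative_compose)
  qed
  from pd_eq[OF this] show ?thesis by (simp only: frechet_derivative_eq_sum_pd[OF assms(2)])
qed

text \<open>Each partial derivative is a linear combination of partial derivatives of
  \<open>f\<close> composed with the same affine map, so the induction closes. Affine substitutions
  cover what is needed later: scaling and shifting the cutoff, \<open>Re\<close> and
  \<open>Im\<close>, and the two projections of space-time.\<close>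

lemma class_C_affine:
  fixes L :: "'c::euclidean_space \<Rightarrow> 'a::euclidean_space"
  assumes "bounded_linear L"
  shows "class_C k f \<Longrightarrow> class_C k (\<lambda>x. f (L x + c))"
proof (induction k arbitrary: f)
  case 0
  then show ?case
    using continuous_on_compose2[of UNIV f UNIV "\<lambda>x. L x + c"]
      bounded_linear.continuous_on[OF assms continuous_on_id]
      continuous_on_add[of UNIV L "\<lambda>x. c"] by auto
next
  case (Suc k)
  have "(\<lambda>x. f (L x + c)) differentiable at x" for x
    by (rule differentiable_compose[OF class_C_differentiable[OF Suc.prems]])
       (rule differentiable_add[OF bounded_linear_imp_differentiable[OF assms] differentiable_const])
  moreover have "class_C k (pd e (\<lambda>x. f (L x + c)))" if "e \<in> Basis" for e
  proof -
    have eq: "pd e (\<lambda>x. f (L x + c)) = (\<lambda>x. \<Sum>b\<in>Basis. (L e \<bullet> b) *\<^sub>R pd b f (L x + c))"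
      by (rule ext, rule pd_affine[OF assms], rule class_C_differentiable[OF Suc.prems])
    have "class_C k (\<lambda>x. pd b f (L x + c))" if "b \<in> Basis" for b
      using Suc.IH[of "pd b f"] Suc.prems that by auto
    then show ?thesis unfolding eq
      by (intro class_C_sum class_C_linear[OF bounded_linear_scaleR_right])
  qed
  ultimately show ?case by simp
qed

lemma smooth_add: "smooth f \<Longrightarrow> smooth g \<Longrightarrow> smooth (\<lambda>x. f x + g x)"
  by (simp add: smooth_def class_C_add)
lemma smooth_linear: "bounded_linear L \<Longrightarrow> smooth f \<Longrightarrow> smooth (\<lambda>x. L (f x))"
  by (simp add: smooth_def class_C_linear)
lemma smooth_bilinear: "bounded_bilinear p \<Longrightarrow> smooth f \<Longrightarrow> smooth g \<Longrightarrow> smooth (\<lambda>x. p (f x) (g x))"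
  by (simp add: smooth_def class_C_bilinear)
lemma smooth_affine: "bounded_linear L \<Longrightarrow> smooth f \<Longrightarrow> smooth (\<lambda>x. f (L x + c))"
  by (simp add: smooth_def class_C_affine)
lemma smooth_diff: "smooth f \<Longrightarrow> smooth g \<Longrightarrow> smooth (\<lambda>x. f x - g x)"
  using smooth_add[of f "\<lambda>x. - g x"] smooth_linear[OF bounded_linear_minus[OF bounded_linear_ident], of g] by simp
lemma smooth_pd: "smooth f \<Longrightarrow> e \<in> Basis \<Longrightarrow> smooth (pd e f)"
  unfolding smooth_def by (metis class_C.simps(2))
lemma smooth_differentiable: "smooth f \<Longrightarrow> f differentiable at x"
  unfolding smooth_def by (metis class_C.simps(2))
lemma smooth_continuous: "smooth f \<Longrightarrow> continuous_on S f"
  unfolding smooth_def by (metis class_C.simps(1) continuous_on_subset subset_UNIV)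
lemma smooth_const: "smooth (\<lambda>x. c)"
  by (simp add: smooth_def class_C_const)

section \<open>Closure of test functions under differentiation, sums and products\<close>

subsection \<open>Test functions\<close>

abbreviation supp :: "('a::topological_space \<Rightarrow> 'b::zero) \<Rightarrow> 'a set" where
  "supp f \<equiv> closure {x. f x \<noteq> 0}"

lemma not_in_supp: "x \<notin> supp f \<Longrightarrow> f x = 0"
  using closure_subset[of "{x. f x \<noteq> 0}"] by auto

lemma test_functionsI:
  assumes "smooth f" "compact K" "K \<subseteq> \<Omega>" "\<And>x. x \<notin> K \<Longrightarrow> f x = 0"
  shows "f \<in> test_functions \<Omega>"
proof -
  have "supp f \<subseteq> K"
    using assms(2,4) by (intro closure_minimal compact_imp_closed) auto
  then show ?thesis unfolding test_functions_def
    using assms by (auto simp: compact_eq_bounded_closed intro: bounded_subset[of K "supp f"])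
qed

lemma test_functionsD:
  assumes "f \<in> test_functions \<Omega>"
  shows "smooth f" "compact (supp f)" "supp f \<subseteq> \<Omega>" "f differentiable at x" "continuous_on S f"
  using assms smooth_differentiable[of f] smooth_continuous[of f] unfolding test_functions_def by auto

lemma test_zero_outside: "f \<in> test_functions \<Omega> \<Longrightarrow> x \<notin> \<Omega> \<Longrightarrow> f x = 0"
  using test_functionsD(3)[of f \<Omega>] not_in_supp[of x f] by auto

lemma pd_zero_outside_supp:
  assumes "x \<notin> supp f" shows "pd e f x = 0"
proof -
  have "((\<lambda>x. 0) has_derivative (\<lambda>x. 0)) (at x)" by (rule has_derivative_const)
  moreover have "open (- supp f)" "x \<in> - supp f" using assms by auto
  moreover have "0 = f y" if "y \<in> - supp f" for y
    using not_in_supp[of y f] that by simp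
  ultimately have "(f has_derivative (\<lambda>x. 0)) (at x)"
    by (rule has_derivative_transform_within_open)
  then show ?thesis by (rule pd_eq)
qed

lemma test_functions_supp_I:
  assumes "f \<in> test_functions \<Omega>" "smooth h" "\<And>x. x \<notin> supp f \<Longrightarrow> h x = 0"
  shows "h \<in> test_functions \<Omega>"
  using test_functionsI[OF assms(2) test_functionsD(2,3)[OF assms(1)] assms(3)] .

lemma test_pd: "f \<in> test_functions \<Omega> \<Longrightarrow> e \<in> Basis \<Longrightarrow> pd e f \<in> test_functions \<Omega>"
  by (rule test_functions_supp_I) (auto intro: smooth_pd test_functionsD(1) pd_zero_outside_supp)

lemma test_zero: "(\<lambda>x. 0) \<in> test_functions \<Omega>"
  by (rule test_functionsI[of _ "{}"]) (simp_all add: smooth_const)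

lemma test_linear:
  assumes "bounded_linear L" "f \<in> test_functions \<Omega>"
  shows "(\<lambda>x. L (f x)) \<in> test_functions \<Omega>"
  by (rule test_functions_supp_I[OF assms(2) smooth_linear[OF assms(1) test_functionsD(1)[OF assms(2)]]])
     (drule not_in_supp, simp add: linear_0[OF bounded_linear.linear[OF assms(1)]])

lemma test_add:
  assumes "f \<in> test_functions \<Omega>" "g \<in> test_functions \<Omega>"
  shows "(\<lambda>x. f x + g x) \<in> test_functions \<Omega>"
proof (rule test_functionsI[of _ "supp f \<union> supp g"])
  show "smooth (\<lambda>x. f x + g x)" "compact (supp f \<union> supp g)" "supp f \<union> supp g \<subseteq> \<Omega>"
    using assms by (auto intro!: smooth_add compact_Un dest: test_functionsD)
  show "f x + g x = 0" if "x \<notin> supp f \<union> supp g" for x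
    using not_in_supp[of x f] not_in_supp[of x g] that by (metis UnCI add_0)
qed

lemma test_sum: "(\<And>i. i \<in> I \<Longrightarrow> f i \<in> test_functions \<Omega>) \<Longrightarrow> (\<lambda>x. \<Sum>i\<in>I. f i x) \<in> test_functions \<Omega>"
  by (induction I rule: infinite_finite_induct) (simp_all add: test_add test_zero)

lemma test_diff:
  assumes "f \<in> test_functions \<Omega>" "g \<in> test_functions \<Omega>"
  shows "(\<lambda>x. f x - g x) \<in> test_functions \<Omega>"
  using test_add[OF assms(1) test_linear[OF bounded_linear_minus[OF bounded_linear_ident] assms(2)]] by simp

lemma test_bilinear1:
  assumes "bounded_bilinear p" "f \<in> test_functions \<Omega>" "smooth g"
  shows "(\<lambda>x. p (f x) (g x)) \<in> test_functions \<Omega>"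
  by (rule test_functions_supp_I[OF assms(2) smooth_bilinear[OF assms(1) test_functionsD(1)[OF assms(2)] assms(3)]])
     (drule not_in_supp, simp add: bounded_bilinear.zero_left[OF assms(1)])

lemma test_bounded:
  fixes f :: "'a::euclidean_space \<Rightarrow> 'b::real_normed_vector"
  assumes "f \<in> test_functions \<Omega>"
  obtains B where "B \<ge> 0" "\<And>x. norm (f x) \<le> B"
proof -
  have "compact (f ` supp f)"
    by (intro compact_continuous_image test_functionsD[OF assms])
  then obtain B where B: "\<And>x. x \<in> supp f \<Longrightarrow> norm (f x) \<le> B"
    by (meson bounded_iff compact_imp_bounded imageI)
  show ?thesis
  proof (rule that[of "max B 0"])
    show "norm (f x) \<le> max B 0" for x
      using B[of x] not_in_supp[of x f] by (cases "x \<in> supp f") (metis max.coboundedI1, metis max.cobounded2 norm_zero)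
  qed auto
qed

lemma test_laplacian: "f \<in> test_functions \<Omega> \<Longrightarrow> laplacian f \<in> test_functions \<Omega>"
  unfolding laplacian_def[abs_def] by (intro test_sum test_pd)

lemma test_integrable_lborel:
  fixes f :: "'a::euclidean_space \<Rightarrow> 'b::euclidean_space"
  assumes "f \<in> test_functions \<Omega>"
  shows "integrable lborel f"
proof -
  have "set_integrable lborel (supp f) f" unfolding set_integrable_def
    by (rule borel_integrable_compact) (rule test_functionsD(2,5)[OF assms])+
  moreover have "(\<lambda>x. indicator (supp f) x *\<^sub>R f x) = f"
  proof
    show "indicator (supp f) x *\<^sub>R f x = f x" for x
      using not_in_supp[of x f] by (metis indicator_simps scaleR_one scaleR_zero_left scaleR_zero_right)
  qed
  ultimately show ?thesis by (simp add: set_integrable_def)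
qed

lemma test_borel:
  fixes f :: "'a::euclidean_space \<Rightarrow> 'b::euclidean_space"
  shows "f \<in> test_functions \<Omega> \<Longrightarrow> f \<in> borel_measurable borel"
  by (rule borel_measurable_continuous_onI) (rule test_functionsD(5))

section \<open>Hilbert space inequalities for functions, without passing to classes modulo null
  sets\<close>

section \<open>Square integrable functions\<close>

text \<open>The target is an arbitrary Euclidean space: the same lemmas serve vector fields, scalar
  products of norms, pairs of partial derivatives and the triples of \<open>jet\<close>.\<close>

definition sqi :: "'a measure \<Rightarrow> ('a \<Rightarrow> 'b::euclidean_space) \<Rightarrow> bool" where
  "sqi M f \<longleftrightarrow> f \<in> borel_measurable M \<and> integrable M (\<lambda>x. (norm (f x))\<^sup>2)"

definition ip :: "'a measure \<Rightarrow> ('a \<Rightarrow> 'b::euclidean_space) \<Rightarrow> ('a \<Rightarrow> 'b) \<Rightarrow> real" where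
  "ip M f g = (LINT x|M. f x \<bullet> g x)"

definition nrm :: "'a measure \<Rightarrow> ('a \<Rightarrow> 'b::euclidean_space) \<Rightarrow> real" where
  "nrm M f = sqrt (LINT x|M. (norm (f x))\<^sup>2)"

lemma sqi_measurable[measurable_dest]: "sqi M f \<Longrightarrow> f \<in> borel_measurable M"
  by (simp add: sqi_def)

lemma sqi_integrable: "sqi M f \<Longrightarrow> integrable M (\<lambda>x. (norm (f x))\<^sup>2)"
  by (simp add: sqi_def)

lemma sqi_norm_mult_integrable:
  assumes "sqi M f" "sqi M g" shows "integrable M (\<lambda>x. norm (f x) * norm (g x))"
proof (rule Bochner_Integration.integrable_bound)
  show "integrable M (\<lambda>x. (norm (f x))\<^sup>2 + (norm (g x))\<^sup>2)" using assms by (auto simp: sqi_def)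
  show "(\<lambda>x. norm (f x) * norm (g x)) \<in> borel_measurable M" using assms[THEN sqi_measurable] by measurable
  have "norm (f x) * norm (g x) \<le> (norm (f x))\<^sup>2 + (norm (g x))\<^sup>2" for x
    using sum_squares_bound[of "norm (f x)" "norm (g x)"] mult_nonneg_nonneg[OF norm_ge_zero norm_ge_zero, of "f x" "g x"] by linarith
  then show "AE x in M. norm (norm (f x) * norm (g x)) \<le> norm ((norm (f x))\<^sup>2 + (norm (g x))\<^sup>2)" by auto
qed

lemma sqi_ip_integrable:
  assumes "sqi M f" "sqi M g" shows "integrable M (\<lambda>x. f x \<bullet> g x)"
proof (rule Bochner_Integration.integrable_bound[OF sqi_norm_mult_integrable[OF assms]])
  show "(\<lambda>x. f x \<bullet> g x) \<in> borel_measurable M" using assms[THEN sqi_measurable] by measurable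
qed (auto simp: Cauchy_Schwarz_ineq2)

lemma sqi_add:
  assumes "sqi M f" "sqi M g" shows "sqi M (\<lambda>x. f x + g x)"
proof -
  have "integrable M (\<lambda>x. (norm (f x + g x))\<^sup>2)"
  proof (rule Bochner_Integration.integrable_bound)
    show "integrable M (\<lambda>x. 2 * (norm (f x))\<^sup>2 + 2 * (norm (g x))\<^sup>2)" using assms by (auto simp: sqi_def)
    show "(\<lambda>x. (norm (f x + g x))\<^sup>2) \<in> borel_measurable M" using assms[THEN sqi_measurable] by measurable
    have "(norm (f x + g x))\<^sup>2 \<le> 2 * (norm (f x))\<^sup>2 + 2 * (norm (g x))\<^sup>2" for x
    proof -
      have "(norm (f x + g x))\<^sup>2 \<le> (norm (f x) + norm (g x))\<^sup>2" by (simp add: norm_triangle_ineq power_mono)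
      also have "\<dots> \<le> 2 * (norm (f x))\<^sup>2 + 2 * (norm (g x))\<^sup>2"
        using sum_squares_bound[of "norm (f x)" "norm (g x)"] by (simp add: power2_sum)
      finally show ?thesis .
    qed
    then show "AE x in M. norm ((norm (f x + g x))\<^sup>2) \<le> norm (2 * (norm (f x))\<^sup>2 + 2 * (norm (g x))\<^sup>2)" by auto
  qed
  then show ?thesis using assms[THEN sqi_measurable] unfolding sqi_def by auto
qed

lemma sqi_scaleR: "sqi M f \<Longrightarrow> sqi M (\<lambda>x. c *\<^sub>R f x)"
  by (auto simp: sqi_def power_mult_distrib)

lemma sqi_diff: "sqi M f \<Longrightarrow> sqi M g \<Longrightarrow> sqi M (\<lambda>x. f x - g x)"
  using sqi_add[of M f "\<lambda>x. (-1) *\<^sub>R g x"] sqi_scaleR[of M g "-1"] by simp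

lemma sqi_zero: "sqi M (\<lambda>x. 0)" by (auto simp: sqi_def)

lemma sqi_bounded_by:
  assumes "sqi M f" "g \<in> borel_measurable M" "\<And>x. x \<in> space M \<Longrightarrow> norm (g x) \<le> B * norm (f x)"
  shows "sqi M g"
  unfolding sqi_def
proof
  show "integrable M (\<lambda>x. (norm (g x))\<^sup>2)"
  proof (rule Bochner_Integration.integrable_bound)
    show "integrable M (\<lambda>x. B\<^sup>2 * (norm (f x))\<^sup>2)" using assms by (auto simp: sqi_def)
    show "(\<lambda>x. (norm (g x))\<^sup>2) \<in> borel_measurable M" using assms(2) by measurable
    have "(norm (g x))\<^sup>2 \<le> B\<^sup>2 * (norm (f x))\<^sup>2" if "x \<in> space M" for x
      using power_mono[OF assms(3)[OF that], of 2] by (simp add: power_mult_distrib)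
    then show "AE x in M. norm ((norm (g x))\<^sup>2) \<le> norm (B\<^sup>2 * (norm (f x))\<^sup>2)"
      by (auto simp: abs_mult)
  qed
qed (use assms in auto)

lemma nrm_nonneg[simp]: "0 \<le> nrm M f" by (simp add: nrm_def)

lemma nrm_sq: "(nrm M f)\<^sup>2 = (LINT x|M. (norm (f x))\<^sup>2)"
  by (simp add: nrm_def integral_nonneg_AE)

lemma nrm_sq_ip: "(nrm M f)\<^sup>2 = ip M f f"
  by (simp add: nrm_sq ip_def dot_square_norm)

lemma nrm_eq_0:
  assumes "sqi M f" "nrm M f = 0" shows "AE x in M. f x = 0"
proof -
  have "(LINT x|M. (norm (f x))\<^sup>2) = 0" using assms(2) by (simp flip: nrm_sq)
  then have "AE x in M. (norm (f x))\<^sup>2 = 0"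
    using integral_nonneg_eq_0_iff_AE[OF sqi_integrable[OF assms(1)]] by simp
  then show ?thesis by auto
qed

lemma nrm_cong_AE:
  assumes "sqi M f" "sqi M g" "AE x in M. f x = g x" shows "nrm M f = nrm M g"
  unfolding nrm_def
  using assms(3) by (intro arg_cong[of _ _ sqrt] integral_cong_AE)
    (use assms(1,2)[THEN sqi_measurable] in auto)

lemma nrm_scaleR: "nrm M (\<lambda>x. c *\<^sub>R f x) = \<bar>c\<bar> * nrm M f"
  by (simp add: nrm_def power_mult_distrib real_sqrt_mult)

lemma nrm_minus_commute: "nrm M (\<lambda>x. f x - g x) = nrm M (\<lambda>x. g x - f x)"
  by (simp add: nrm_def norm_minus_commute)

lemma nrm_norm_mult_le:
  assumes "sqi M f" "sqi M g" shows "(LINT x|M. norm (f x) * norm (g x)) \<le> nrm M f * nrm M g"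
proof -
  let ?I = "LINT x|M. norm (f x) * norm (g x)"
  consider "nrm M f = 0" | "nrm M g = 0" | "nrm M f > 0" "nrm M g > 0"
    using nrm_nonneg[of M f] nrm_nonneg[of M g] by linarith
  then show ?thesis
  proof cases
    case 1
    then have "AE x in M. norm (f x) * norm (g x) = 0" using nrm_eq_0[OF assms(1)] by auto
    then show ?thesis using 1 by (simp add: integral_eq_zero_AE)
  next
    case 2
    then have "AE x in M. norm (f x) * norm (g x) = 0" using nrm_eq_0[OF assms(2)] by auto
    then show ?thesis using 2 by (simp add: integral_eq_zero_AE)
  next
    case 3
    \<comment> \<open>The weight for which the two terms of Young's inequality have equal integrals,
      which turns it into Cauchy-Schwarz.\<close>
    define t where "t = nrm M g / nrm M f"
    have t: "t > 0" using 3 by (simp add: t_def)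
    have "2 * ?I = (LINT x|M. 2 * (norm (f x) * norm (g x)))" by simp
    also have "\<dots> \<le> (LINT x|M. t * (norm (f x))\<^sup>2 + (1/t) * (norm (g x))\<^sup>2)"
    proof (rule integral_mono)
      show "integrable M (\<lambda>x. 2 * (norm (f x) * norm (g x)))"
        using sqi_norm_mult_integrable[OF assms] by simp
      show "integrable M (\<lambda>x. t * (norm (f x))\<^sup>2 + 1 / t * (norm (g x))\<^sup>2)"
        using assms by (auto simp: sqi_def)
      fix x
      have "0 \<le> (sqrt t * norm (f x) - norm (g x) / sqrt t)\<^sup>2" by simp
      also have "\<dots> = t * (norm (f x))\<^sup>2 + 1 / t * (norm (g x))\<^sup>2 - 2 * (norm (f x) * norm (g x))"
        using t by (simp add: power2_diff power_mult_distrib power_divide)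
      finally show "2 * (norm (f x) * norm (g x)) \<le> t * (norm (f x))\<^sup>2 + 1 / t * (norm (g x))\<^sup>2" by simp
    qed
    also have "\<dots> = t * (nrm M f)\<^sup>2 + (1/t) * (nrm M g)\<^sup>2"
      using assms unfolding nrm_sq by (subst Bochner_Integration.integral_add) (auto simp: sqi_def)
    also have "\<dots> = 2 * (nrm M f * nrm M g)" using 3 by (simp add: t_def power2_eq_square)
    finally show ?thesis by simp
  qed
qed

lemma ip_le:
  assumes "sqi M f" "sqi M g" shows "\<bar>ip M f g\<bar> \<le> nrm M f * nrm M g"
proof -
  have "\<bar>ip M f g\<bar> \<le> (LINT x|M. \<bar>f x \<bullet> g x\<bar>)" unfolding ip_def by simp
  also have "\<dots> \<le> (LINT x|M. norm (f x) * norm (g x))"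
    by (intro integral_mono sqi_norm_mult_integrable assms integrable_abs sqi_ip_integrable Cauchy_Schwarz_ineq2)
  finally show ?thesis using nrm_norm_mult_le[OF assms] by simp
qed

lemma ip_add_left: "sqi M f \<Longrightarrow> sqi M g \<Longrightarrow> sqi M h \<Longrightarrow> ip M (\<lambda>x. f x + g x) h = ip M f h + ip M g h"
  unfolding ip_def by (simp add: inner_add_left sqi_ip_integrable)
lemma ip_diff_left: "sqi M f \<Longrightarrow> sqi M g \<Longrightarrow> sqi M h \<Longrightarrow> ip M (\<lambda>x. f x - g x) h = ip M f h - ip M g h"
  unfolding ip_def by (simp add: inner_diff_left sqi_ip_integrable)
lemma ip_commute: "ip M f g = ip M g f"
  unfolding ip_def by (simp add: inner_commute)
lemma ip_diff_right: "sqi M f \<Longrightarrow> sqi M g \<Longrightarrow> sqi M h \<Longrightarrow> ip M h (\<lambda>x. f x - g x) = ip M h f - ip M h g"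
  using ip_diff_left[of M f g h] by (simp add: ip_commute)
lemma ip_add_right: "sqi M f \<Longrightarrow> sqi M g \<Longrightarrow> sqi M h \<Longrightarrow> ip M h (\<lambda>x. f x + g x) = ip M h f + ip M h g"
  using ip_add_left[of M f g h] by (simp add: ip_commute)

lemma nrm_triangle:
  assumes "sqi M f" "sqi M g" shows "nrm M (\<lambda>x. f x + g x) \<le> nrm M f + nrm M g"
proof (rule power2_le_imp_le)
  have "(nrm M (\<lambda>x. f x + g x))\<^sup>2 = ip M f f + 2 * ip M f g + ip M g g"
    using assms by (simp add: nrm_sq_ip ip_add_left ip_add_right sqi_add ip_commute[of M g f])
  also have "\<dots> \<le> (nrm M f + nrm M g)\<^sup>2"
    using ip_le[OF assms] by (simp add: power2_sum nrm_sq_ip)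
  finally show "(nrm M (\<lambda>x. f x + g x))\<^sup>2 \<le> (nrm M f + nrm M g)\<^sup>2" .
qed simp

lemma nrm_triangle_diff:
  assumes "sqi M f" "sqi M g" shows "nrm M (\<lambda>x. f x - g x) \<le> nrm M f + nrm M g"
  using nrm_triangle[OF assms(1) sqi_scaleR[OF assms(2), of "-1"]] nrm_scaleR[of M "-1" g] by simp

lemma nrm_triangle3:
  assumes "sqi M f" "sqi M g" "sqi M h"
  shows "nrm M (\<lambda>x. f x - h x) \<le> nrm M (\<lambda>x. f x - g x) + nrm M (\<lambda>x. g x - h x)"
  using nrm_triangle[OF sqi_diff[OF assms(1,2)] sqi_diff[OF assms(2,3)]] by simp

lemma nrm_diff_abs:
  assumes "sqi M f" "sqi M g" shows "\<bar>nrm M f - nrm M g\<bar> \<le> nrm M (\<lambda>x. f x - g x)"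
  using nrm_triangle3[OF assms sqi_zero] nrm_triangle3[OF assms(2,1) sqi_zero] nrm_minus_commute[of M f g] by simp

text \<open>Expand \<open>0 \<le> |f - g|^2\<close>. The increment is paired with the final value
  \<open>f\<close>; this one-sided form is all that the energy argument needs for a backward step in
  time.\<close>

lemma nrm_diff_lower:
  assumes "sqi M f" "sqi M g"
  shows "(nrm M f)\<^sup>2 - (nrm M g)\<^sup>2 \<le> 2 * ip M (\<lambda>x. f x - g x) f"
proof -
  have "0 \<le> (nrm M (\<lambda>x. f x - g x))\<^sup>2" by simp
  then show ?thesis using assms
    by (simp add: nrm_sq_ip ip_diff_left ip_diff_right sqi_diff ip_commute[of M g f])
qed

lemma nrm_le_bounded_by:
  assumes "sqi M f" "g \<in> borel_measurable M" "\<And>x. x \<in> space M \<Longrightarrow> norm (g x) \<le> B * norm (f x)" "B \<ge> 0"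
  shows "nrm M g \<le> B * nrm M f"
proof (rule power2_le_imp_le)
  have "(nrm M g)\<^sup>2 \<le> (LINT x|M. B\<^sup>2 * (norm (f x))\<^sup>2)" unfolding nrm_sq
  proof (rule integral_mono)
    show "integrable M (\<lambda>x. (norm (g x))\<^sup>2)" by (rule sqi_integrable[OF sqi_bounded_by[OF assms(1-3)]])
    show "integrable M (\<lambda>x. B\<^sup>2 * (norm (f x))\<^sup>2)" using assms by (auto simp: sqi_def)
    show "(norm (g x))\<^sup>2 \<le> B\<^sup>2 * (norm (f x))\<^sup>2" if "x \<in> space M" for x
      using power_mono[OF assms(3)[OF that], of 2] by (simp add: power_mult_distrib)
  qed
  then show "(nrm M g)\<^sup>2 \<le> (B * nrm M f)\<^sup>2" by (simp add: power_mult_distrib nrm_sq)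
qed (use assms in simp)

section \<open>Translation of set integrals over the domain into integrals for the restricted
  measure\<close>

subsection \<open>The spaces of the statement\<close>

lemma LINT_restrict:
  fixes f :: "'a::euclidean_space \<Rightarrow> 'b::{banach, second_countable_topology}"
  assumes "\<Omega> \<in> sets lebesgue"
  shows "(LINT x:\<Omega>|lebesgue. f x) = integral\<^sup>L (lebesgue_on \<Omega>) f"
  using assms by (simp add: integral_restrict_space set_lebesgue_integral_def)

lemma L2_iff_sqi:
  assumes "\<Omega> \<in> sets lebesgue" shows "w \<in> L2 \<Omega> \<longleftrightarrow> sqi (lebesgue_on \<Omega>) w"
  using assms unfolding L2_def sqi_def set_borel_measurable_def set_integrable_def
  by (simp add: integrable_restrict_space borel_measurable_restrict_space_iff)

lemma L2_norm_eq_nrm: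
  assumes "\<Omega> \<in> sets lebesgue" shows "L2_norm \<Omega> = nrm (lebesgue_on \<Omega>)"
  by (rule ext) (simp add: L2_norm_def nrm_def LINT_restrict[OF assms])

lemma lebesgue_measurable_borel:
  "f \<in> borel_measurable borel \<Longrightarrow> f \<in> borel_measurable (lebesgue_on \<Omega>)"
  by (intro measurable_restrict_space1) (simp add: measurable_completion)

lemma integral_lebesgue_on_eq_lborel:
  fixes f :: "'a::euclidean_space \<Rightarrow> 'b::{banach, second_countable_topology}"
  assumes "\<Omega> \<in> sets lebesgue" "f \<in> borel_measurable borel" "\<And>x. x \<notin> \<Omega> \<Longrightarrow> f x = 0"
  shows "integral\<^sup>L (lebesgue_on \<Omega>) f = integral\<^sup>L lborel f"
proof -
  have "(\<lambda>x. indicator \<Omega> x *\<^sub>R f x) = f" using assms(3) by (auto simp: indicator_def fun_eq_iff)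
  then show ?thesis using assms(1,2)
    by (simp add: integral_restrict_space integral_completion)
qed

lemma integrable_lebesgue_on_if_lborel:
  fixes f :: "'a::euclidean_space \<Rightarrow> 'b::{banach, second_countable_topology}"
  assumes "\<Omega> \<in> sets lebesgue" "integrable lborel f"
  shows "integrable (lebesgue_on \<Omega>) f"
proof -
  have "integrable lebesgue f"
    using assms(2) integrable_completion[of f lborel] borel_measurable_integrable[OF assms(2)] by simp
  then show ?thesis using assms(1)
    by (simp add: integrable_restrict_space integrable_mult_indicator)
qed

lemma test_integrable:
  fixes f :: "'a::euclidean_space \<Rightarrow> 'b::euclidean_space"
  assumes "\<Omega> \<in> sets lebesgue" "f \<in> test_functions \<Omega>"
  shows "integrable (lebesgue_on \<Omega>) f"
  by (intro integrable_lebesgue_on_if_lborel test_integrable_lborel[OF assms(2)] assms)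

lemma test_inner:
  fixes f :: "'a::euclidean_space \<Rightarrow> 'b::euclidean_space"
  shows "f \<in> test_functions \<Omega> \<Longrightarrow> smooth g \<Longrightarrow> (\<lambda>x. f x \<bullet> g x) \<in> test_functions \<Omega>"
  by (rule test_bilinear1[OF bounded_bilinear_inner])

lemma test_norm_sq:
  fixes f :: "'a::euclidean_space \<Rightarrow> 'b::euclidean_space"
  shows "f \<in> test_functions \<Omega> \<Longrightarrow> (\<lambda>x. (norm (f x))\<^sup>2) \<in> test_functions \<Omega>"
  using test_inner[of f \<Omega> f] test_functionsD(1)[of f \<Omega>] by (simp add: dot_square_norm)

lemma test_sqi:
  fixes f :: "'a::euclidean_space \<Rightarrow> 'b::euclidean_space"
  assumes "\<Omega> \<in> sets lebesgue" "f \<in> test_functions \<Omega>"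
  shows "sqi (lebesgue_on \<Omega>) f"
  unfolding sqi_def using assms
  by (auto intro!: lebesgue_measurable_borel test_borel test_integrable test_norm_sq)

section \<open>Vanishing integrals of derivatives and the resulting bilinear product rule\<close>

subsection \<open>Integration by parts\<close>

text \<open>Translation invariance of Lebesgue measure makes the integral of every difference
  quotient zero, and the quotients converge to the derivative under a common majorant. No coordinate
  has to be split off, so the argument works in every dimension.\<close>

lemma integral_pd_eq_0_lborel:
  fixes f :: "'a::euclidean_space \<Rightarrow> 'b::euclidean_space"
  assumes f: "f \<in> test_functions \<Omega>" and e: "e \<in> Basis"
  shows "integral\<^sup>L lborel (pd e f) = 0"
proof -
  obtain B where B: "B \<ge> 0" "\<And>x. norm (pd e f x) \<le> B" using test_bounded[OF test_pd[OF f e]] by blast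
  obtain R where R: "supp f \<subseteq> ball 0 R" "R > 0"
    using bounded_subset_ballD[OF compact_imp_bounded[OF test_functionsD(2)[OF f]]] by blast
  \<comment> \<open>Steps of length at most 1 keep all difference quotients supported in the ball of
    radius \<open>R + 1\<close>, on which the bound \<open>B\<close> of the derivative dominates
    them.\<close>
  define h where "h n = inverse (real (Suc n))" for n
  have h: "h n > 0" "h n \<le> 1" for n by (auto simp: h_def field_simps)
  have h0: "h \<longlonglongrightarrow> 0" unfolding h_def by (rule LIMSEQ_inverse_real_of_nat)
  define q where "q n x = (1 / h n) *\<^sub>R (f (x + h n *\<^sub>R e) - f x)" for n x
  have ad: "((\<lambda>s. f (x + s *\<^sub>R e)) has_vector_derivative pd e f (x + s *\<^sub>R e)) (at s)" for x s
  proof -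
    have "((\<lambda>s. x + s *\<^sub>R e) has_derivative (\<lambda>s. s *\<^sub>R e)) (at s)"
      by (auto intro!: derivative_eq_intros)
    moreover have "(f has_derivative frechet_derivative f (at (x + s *\<^sub>R e))) (at (x + s *\<^sub>R e))"
      using test_functionsD(4)[OF f] by (simp add: frechet_derivative_works)
    ultimately have "((\<lambda>s. f (x + s *\<^sub>R e)) has_derivative (\<lambda>r. frechet_derivative f (at (x + s *\<^sub>R e)) (r *\<^sub>R e))) (at s)"
      by (rule has_derivative_compose)
    then show ?thesis unfolding has_vector_derivative_def pd_def
      using linear_cmul[OF linear_frechet_derivative[OF test_functionsD(4)[OF f]]] by simp
  qed
  have lim: "(\<lambda>n. q n x) \<longlonglongrightarrow> pd e f x" for x
  proof -
    have "((\<lambda>s. f (x + s *\<^sub>R e)) has_derivative (\<lambda>r. r *\<^sub>R pd e f x)) (at 0)"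
      using ad[of x 0] by (simp add: has_vector_derivative_def)
    then have "(\<lambda>r. norm (f (x + r *\<^sub>R e) - f x - r *\<^sub>R pd e f x) / norm r) \<midarrow>0\<rightarrow> 0"
      unfolding has_derivative_at by simp
    moreover have "filterlim h (at 0) sequentially"
      using h0 h(1) by (intro filterlim_atI) (auto intro!: always_eventually simp: less_imp_neq[symmetric] simp del: h_def)
    ultimately have "(\<lambda>n. norm (f (x + h n *\<^sub>R e) - f x - h n *\<^sub>R pd e f x) / norm (h n)) \<longlonglongrightarrow> 0"
      by (rule filterlim_compose)
    moreover have "norm (f (x + h n *\<^sub>R e) - f x - h n *\<^sub>R pd e f x) / norm (h n) = norm (q n x - pd e f x)" for n
    proof -
      have "q n x - pd e f x = (1 / h n) *\<^sub>R (f (x + h n *\<^sub>R e) - f x - h n *\<^sub>R pd e f x)"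
        using h(1)[of n] by (simp add: q_def scaleR_diff_right)
      then show ?thesis by simp
    qed
    ultimately show ?thesis by (simp add: tendsto_norm_zero_iff LIM_zero_cancel)
  qed
  have bound: "norm (q n x) \<le> B * indicator (ball 0 (R + 1)) x" for n x
  proof (cases "x \<in> ball 0 (R + 1)")
    case True
    have "norm (f (x + h n *\<^sub>R e) - f (x + 0 *\<^sub>R e)) \<le> B * norm (h n - 0)"
    proof (rule differentiable_bound[where S = UNIV and f = "\<lambda>s. f (x + s *\<^sub>R e)" and f' = "\<lambda>s r. r *\<^sub>R pd e f (x + s *\<^sub>R e)"])
      show "onorm (\<lambda>r. r *\<^sub>R pd e f (x + s *\<^sub>R e)) \<le> B" for s
      proof (rule onorm_le)
        fix r
        have "norm (r *\<^sub>R pd e f (x + s *\<^sub>R e)) = norm (pd e f (x + s *\<^sub>R e)) * norm r" by simp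
        also have "\<dots> \<le> B * norm r" by (intro mult_right_mono B) simp
        finally show "norm (r *\<^sub>R pd e f (x + s *\<^sub>R e)) \<le> B * norm r" .
      qed
    qed (use ad in \<open>auto simp: has_vector_derivative_def\<close>)
    then show ?thesis using True h[of n] by (simp add: q_def divide_simps)
  next
    case False
    have "x \<notin> supp f" using False R by (auto simp: subset_eq)
    moreover have "x + h n *\<^sub>R e \<notin> supp f"
    proof
      assume "x + h n *\<^sub>R e \<in> supp f"
      then have "norm (x + h n *\<^sub>R e) < R" using R by (auto simp: subset_eq)
      moreover have "norm x \<le> norm (x + h n *\<^sub>R e) + norm (h n *\<^sub>R e)" by (metis norm_triangle_ineq4 add_diff_cancel_right')
      ultimately show False using False h[of n] e by simp
    qed
    ultimately show ?thesis using not_in_supp[of x f] not_in_supp[of "x + h n *\<^sub>R e" f] False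
      by (simp add: q_def)
  qed
  have "(\<lambda>n. integral\<^sup>L lborel (q n)) \<longlonglongrightarrow> integral\<^sup>L lborel (pd e f)"
  proof (rule integral_dominated_convergence)
    show "pd e f \<in> borel_measurable lborel" using test_borel[OF test_pd[OF f e]] by simp
    show "q n \<in> borel_measurable lborel" for n
      unfolding q_def using test_borel[OF f] by measurable
    show "integrable lborel (\<lambda>x. B * indicator (ball 0 (R + 1)) x)"
      by (intro integrable_mult_right integrable_real_indicator) (simp_all add: emeasure_bounded_finite[OF bounded_ball, unfolded infinity_ennreal_def])
  qed (use lim bound in auto)
  moreover have "integral\<^sup>L lborel (q n) = 0" for n
  proof -
    have i: "integrable lborel f" by (rule test_integrable_lborel[OF f])
    have "integrable (distr lborel borel (\<lambda>x. h n *\<^sub>R e + x)) f" using i by (simp add: lborel_distr_plus)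
    then have i2: "integrable lborel (\<lambda>x. f (h n *\<^sub>R e + x))"
      using test_borel[OF f] by (subst (asm) integrable_distr_eq) auto
    have "integral\<^sup>L lborel f = integral\<^sup>L (distr lborel borel (\<lambda>x. h n *\<^sub>R e + x)) f" by (simp add: lborel_distr_plus)
    also have "\<dots> = (LINT x|lborel. f (h n *\<^sub>R e + x))" using test_borel[OF f] by (subst integral_distr) auto
    finally have "integral\<^sup>L lborel f = (LINT x|lborel. f (x + h n *\<^sub>R e))" by (simp add: add.commute)
    moreover have "integral\<^sup>L lborel (q n) = (1 / h n) *\<^sub>R ((LINT x|lborel. f (x + h n *\<^sub>R e)) - integral\<^sup>L lborel f)"
      using i i2 unfolding q_def by (simp add: add.commute)
    ultimately show ?thesis by simp
  qed
  ultimately show ?thesis by (simp add: LIMSEQ_const_iff)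
qed

lemma integral_pd_eq_0:
  fixes f :: "'a::euclidean_space \<Rightarrow> 'b::euclidean_space"
  assumes "\<Omega> \<in> sets lebesgue" "f \<in> test_functions \<Omega>" "e \<in> Basis"
  shows "(LINT x|lebesgue_on \<Omega>. pd e f x) = 0"
  using integral_pd_eq_0_lborel[OF assms(2,3)] integral_lebesgue_on_eq_lborel[OF assms(1) test_borel[OF test_pd[OF assms(2,3)]]]
    test_zero_outside[OF test_pd[OF assms(2,3)]] by simp

lemma integral_by_parts:
  fixes f :: "'a::euclidean_space \<Rightarrow> 'b::euclidean_space" and g :: "'a \<Rightarrow> 'c::euclidean_space"
    and p :: "'b \<Rightarrow> 'c \<Rightarrow> 'd::euclidean_space"
  assumes p: "bounded_bilinear p" and \<Omega>: "\<Omega> \<in> sets lebesgue" and f: "f \<in> test_functions \<Omega>"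
    and g: "g \<in> test_functions \<Omega>" and e: "e \<in> Basis"
  shows "(LINT x|lebesgue_on \<Omega>. p (f x) (pd e g x)) = - (LINT x|lebesgue_on \<Omega>. p (pd e f x) (g x))"
proof -
  note d = test_functionsD(1)
  have "pd e (\<lambda>x. p (f x) (g x)) = (\<lambda>x. p (f x) (pd e g x) + p (pd e f x) (g x))"
    by (intro ext pd_bilinear[OF p]) (rule test_functionsD(4)[OF f] test_functionsD(4)[OF g])+
  with integral_pd_eq_0[OF \<Omega> test_bilinear1[OF p f d[OF g]] e]
  have "(LINT x|lebesgue_on \<Omega>. p (f x) (pd e g x) + p (pd e f x) (g x)) = 0" by simp
  moreover have "integrable (lebesgue_on \<Omega>) (\<lambda>x. p (f x) (pd e g x))"
    by (intro test_integrable \<Omega> test_bilinear1[OF p] f d[OF test_pd[OF g e]])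
  moreover have "integrable (lebesgue_on \<Omega>) (\<lambda>x. p (pd e f x) (g x))"
    by (intro test_integrable \<Omega> test_bilinear1[OF p] d[OF g] test_pd f e)
  ultimately show ?thesis by (simp add: eq_neg_iff_add_eq_0)
qed

section \<open>Iterated integration over the plane and the interpolation inequality for fourth
  powers\<close>

section \<open>The Ladyzhenskaya inequality\<close>

lemma measurable_Complex [measurable]: "(\<lambda>(x, y). Complex x y) \<in> borel \<rightarrow>\<^sub>M borel"
proof -
  have "(\<lambda>(x, y). Complex x y) = (\<lambda>z. complex_of_real (fst z) + \<i> * complex_of_real (snd z))"
    by (auto simp: complex_eq_iff)
  then show ?thesis by (simp add: borel_measurable_continuous_onI continuous_intros)
qed

text \<open>The plane carries Lebesgue measure as a Euclidean space in its own right; identifying it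
  with the image of a product measure is what makes iterated integrals available. Agreement on boxes
  suffices.\<close>

lemma lborel_complex_eq: "distr (lborel \<Otimes>\<^sub>M lborel) borel (\<lambda>(x, y). Complex x y) = lborel"
proof (rule lborel_eqI[symmetric])
  fix l u :: complex
  assume lu: "\<And>b. b \<in> Basis \<Longrightarrow> l \<bullet> b \<le> u \<bullet> b"
  have le: "Re l \<le> Re u" "Im l \<le> Im u" using lu[of 1] lu[of \<i>] by (auto simp: Basis_complex_def)
  have m: "(\<lambda>(x, y). Complex x y) \<in> (lborel \<Otimes>\<^sub>M lborel) \<rightarrow>\<^sub>M borel"
    using measurable_Complex by (simp add: lborel_prod)
  have "emeasure (distr (lborel \<Otimes>\<^sub>M lborel) borel (\<lambda>(x, y). Complex x y)) (box l u) =
      emeasure (lborel \<Otimes>\<^sub>M lborel) ((\<lambda>(x, y). Complex x y) -` box l u \<inter> space (lborel \<Otimes>\<^sub>M lborel))"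
    by (rule emeasure_distr[OF m]) simp
  also have "(\<lambda>(x, y). Complex x y) -` box l u \<inter> space (lborel \<Otimes>\<^sub>M lborel) = {Re l<..<Re u} \<times> {Im l<..<Im u}"
    by (auto simp: box_def Basis_complex_def space_pair_measure)
  also have "emeasure (lborel \<Otimes>\<^sub>M lborel) \<dots> = ennreal ((Re u - Re l) * (Im u - Im l))"
    using le by (simp add: lborel.emeasure_pair_measure_Times ennreal_mult)
  also have "\<dots> = ennreal (\<Prod>b\<in>Basis. (u - l) \<bullet> b)"
    by (simp add: Basis_complex_def)
  finally show "emeasure (distr (lborel \<Otimes>\<^sub>M lborel) borel (\<lambda>(x, y). Complex x y)) (box l u) = ennreal (\<Prod>b\<in>Basis. (u - l) \<bullet> b)" .
qed simp

lemma nn_integral_complex: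
  assumes [measurable]: "f \<in> borel_measurable borel"
  shows "(\<integral>\<^sup>+z. f z \<partial>lborel) = (\<integral>\<^sup>+x. \<integral>\<^sup>+y. f (Complex x y) \<partial>lborel \<partial>lborel)"
    and "(\<integral>\<^sup>+z. f z \<partial>lborel) = (\<integral>\<^sup>+y. \<integral>\<^sup>+x. f (Complex x y) \<partial>lborel \<partial>lborel)"
proof -
  have m: "(\<lambda>(x, y). Complex x y) \<in> (lborel \<Otimes>\<^sub>M lborel) \<rightarrow>\<^sub>M borel"
    using measurable_Complex by (simp add: lborel_prod)
  have m2: "(\<lambda>(x, y). f (Complex x y)) \<in> borel_measurable (lborel \<Otimes>\<^sub>M lborel)"
    using measurable_compose[OF m assms] by (simp add: case_prod_unfold)
  have "(\<integral>\<^sup>+z. f z \<partial>lborel) = (\<integral>\<^sup>+z. f z \<partial>distr (lborel \<Otimes>\<^sub>M lborel) borel (\<lambda>(x, y). Complex x y))"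
    by (simp only: lborel_complex_eq)
  also have "\<dots> = (\<integral>\<^sup>+z. (case z of (x, y) \<Rightarrow> f (Complex x y)) \<partial>(lborel \<Otimes>\<^sub>M lborel))"
    by (subst nn_integral_distr[OF m]) (simp_all add: case_prod_unfold)
  also have "\<dots> = (\<integral>\<^sup>+x. \<integral>\<^sup>+y. f (Complex x y) \<partial>lborel \<partial>lborel)"
    using lborel.nn_integral_fst[OF m2] by simp
  finally show 1: "(\<integral>\<^sup>+z. f z \<partial>lborel) = (\<integral>\<^sup>+x. \<integral>\<^sup>+y. f (Complex x y) \<partial>lborel \<partial>lborel)" .
  show "(\<integral>\<^sup>+z. f z \<partial>lborel) = (\<integral>\<^sup>+y. \<integral>\<^sup>+x. f (Complex x y) \<partial>lborel \<partial>lborel)"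
    unfolding 1 using lborel_pair.Fubini'[OF m2] by simp
qed

lemma le_nn_integral_deriv:
  fixes p p' :: "real \<Rightarrow> real"
  assumes d: "\<And>s. (p has_real_derivative p' s) (at s)" and c: "continuous_on UNIV p'"
    and z: "\<And>s. s \<le> R \<Longrightarrow> p s = 0"
  shows "ennreal (p x) \<le> (\<integral>\<^sup>+s. ennreal \<bar>p' s\<bar> \<partial>lborel)"
proof (cases "x \<le> R")
  case True then show ?thesis using z by simp
next
  case False
  have F: "has_bochner_integral lborel (\<lambda>s. indicator {R..x} s *\<^sub>R p' s) (p x - p R)"
    by (rule has_bochner_integral_FTC_Icc)
       (use False d c in \<open>auto simp: has_real_derivative_iff_has_vector_derivative[symmetric] intro: has_field_derivative_at_within continuous_on_subset\<close>)
  have "ennreal (p x) \<le> ennreal (norm (integral\<^sup>L lborel (\<lambda>s. indicator {R..x} s *\<^sub>R p' s)))"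
    using has_bochner_integral_integral_eq[OF F] z[of R] by (auto intro: ennreal_leI)
  also have "\<dots> \<le> (\<integral>\<^sup>+s. norm (indicator {R..x} s *\<^sub>R p' s) \<partial>lborel)"
    using F by (intro integral_norm_bound_ennreal) (auto simp: has_bochner_integral_iff)
  also have "\<dots> \<le> (\<integral>\<^sup>+s. ennreal \<bar>p' s\<bar> \<partial>lborel)"
    by (intro nn_integral_mono ennreal_leI) (auto simp: indicator_def)
  finally show ?thesis .
qed

text \<open>On a line parallel to either axis \<open>P\<close> is at most the integral of the
  absolute value of its derivative along that line. Multiplying the bound \<open>\<beta>\<close> of
  the vertical line by the bound \<open>\<alpha>\<close> of the horizontal one separates the
  variables. This is the Gagliardo-Nirenberg argument in the plane.\<close>

lemma nn_integral_square_le: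
  fixes P :: "complex \<Rightarrow> real"
  assumes P: "P \<in> test_functions \<Omega>" and pos: "\<And>z. 0 \<le> P z"
  shows "(\<integral>\<^sup>+z. ennreal ((P z)\<^sup>2) \<partial>lborel)
    \<le> (\<integral>\<^sup>+z. ennreal \<bar>pd 1 P z\<bar> \<partial>lborel) * (\<integral>\<^sup>+z. ennreal \<bar>pd \<i> P z\<bar> \<partial>lborel)"
proof -
  have B: "1 \<in> (Basis :: complex set)" "\<i> \<in> (Basis :: complex set)" by (auto simp: Basis_complex_def)
  obtain R where R: "supp P \<subseteq> ball 0 R"
    using bounded_subset_ballD[OF compact_imp_bounded[OF test_functionsD(2)[OF P]]] by blast
  have zero: "P z = 0" if "norm z \<ge> R" for z
    using R that not_in_supp[of z P] by (metis linorder_not_less mem_ball_0 subsetD)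
  have [measurable]: "P \<in> borel_measurable borel" "pd 1 P \<in> borel_measurable borel" "pd \<i> P \<in> borel_measurable borel"
    using P B by (auto intro!: test_borel test_pd)
  have dP: "(P has_derivative frechet_derivative P (at z)) (at z)" for z
    using test_functionsD(4)[OF P] by (simp add: frechet_derivative_works)
  note lin = linear_cmul[OF linear_frechet_derivative[OF test_functionsD(4)[OF P]]]
  have d1: "((\<lambda>s. P (Complex s y)) has_real_derivative pd 1 P (Complex x y)) (at x)" for x y
  proof -
    have "((\<lambda>s. Complex s y) has_derivative (\<lambda>s. s *\<^sub>R 1)) (at x)"
      unfolding Complex_eq by (auto intro!: derivative_eq_intros simp: scaleR_conv_of_real)
    from has_derivative_compose[OF this dP] show ?thesis
      unfolding has_field_derivative_def pd_def lin by (simp add: mult_commute_abs)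
  qed
  have d2: "((\<lambda>s. P (Complex x s)) has_real_derivative pd \<i> P (Complex x y)) (at y)" for x y
  proof -
    have "((\<lambda>s. Complex x s) has_derivative (\<lambda>s. s *\<^sub>R \<i>)) (at y)"
      unfolding Complex_eq by (auto intro!: derivative_eq_intros simp: scaleR_conv_of_real)
    from has_derivative_compose[OF this dP] show ?thesis
      unfolding has_field_derivative_def pd_def lin by (simp add: mult_commute_abs)
  qed
  define \<alpha> where "\<alpha> y = (\<integral>\<^sup>+s. ennreal \<bar>pd 1 P (Complex s y)\<bar> \<partial>lborel)" for y
  define \<beta> where "\<beta> x = (\<integral>\<^sup>+s. ennreal \<bar>pd \<i> P (Complex x s)\<bar> \<partial>lborel)" for x
  have cC: "continuous_on UNIV (\<lambda>s. f (Complex s y))" "continuous_on UNIV (\<lambda>s. f (Complex y s))"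
    if "continuous_on UNIV f" for f :: "complex \<Rightarrow> real" and y
    using that by (auto intro!: continuous_on_compose2[of UNIV f] simp: Complex_eq intro!: continuous_intros)
  have a: "ennreal (P (Complex x y)) \<le> \<alpha> y" for x y
    unfolding \<alpha>_def
  proof (rule le_nn_integral_deriv[where R = "-R" and p = "\<lambda>s. P (Complex s y)" and x = x])
    show "P (Complex s y) = 0" if "s \<le> - R" for s
      using abs_Re_le_cmod[of "Complex s y"] that by (intro zero) simp
    show "continuous_on UNIV (\<lambda>s. pd 1 P (Complex s y))"
      by (intro cC test_functionsD(5)[OF test_pd[OF P B(1)]])
  qed (rule d1)
  have b: "ennreal (P (Complex x y)) \<le> \<beta> x" for x y
    unfolding \<beta>_def
  proof (rule le_nn_integral_deriv[where R = "-R" and p = "\<lambda>s. P (Complex x s)" and x = y])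
    show "P (Complex x s) = 0" if "s \<le> - R" for s
      using abs_Im_le_cmod[of "Complex x s"] that by (intro zero) simp
    show "continuous_on UNIV (\<lambda>s. pd \<i> P (Complex x s))"
      by (intro cC test_functionsD(5)[OF test_pd[OF P B(2)]])
  qed (rule d2)
  have mC: "(\<lambda>z. f (Complex (fst z) (snd z))) \<in> borel_measurable (lborel \<Otimes>\<^sub>M lborel)"
     "(\<lambda>z. f (Complex (snd z) (fst z))) \<in> borel_measurable (lborel \<Otimes>\<^sub>M lborel)"
     if [measurable]: "f \<in> borel_measurable borel" for f :: "complex \<Rightarrow> real"
  proof -
    have "(\<lambda>z. f (Complex (fst z) (snd z))) \<in> borel_measurable borel"
      using measurable_compose[OF measurable_Complex that] by (simp add: case_prod_unfold)
    then show "(\<lambda>z. f (Complex (fst z) (snd z))) \<in> borel_measurable (lborel \<Otimes>\<^sub>M lborel)" by (simp add: lborel_prod)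
    then show "(\<lambda>z. f (Complex (snd z) (fst z))) \<in> borel_measurable (lborel \<Otimes>\<^sub>M lborel)"
      using measurable_compose[OF measurable_pair_swap'[of lborel lborel], of "\<lambda>z. f (Complex (fst z) (snd z))"]
      by (simp add: case_prod_unfold)
  qed
  have [measurable]: "\<alpha> \<in> borel_measurable lborel" "\<beta> \<in> borel_measurable lborel"
    unfolding \<alpha>_def \<beta>_def
    by (rule lborel.borel_measurable_nn_integral; use mC[of "pd 1 P"] mC[of "pd \<i> P"] in \<open>simp add: case_prod_unfold\<close>)+
  have "(\<integral>\<^sup>+z. ennreal ((P z)\<^sup>2) \<partial>lborel) = (\<integral>\<^sup>+x. \<integral>\<^sup>+y. ennreal ((P (Complex x y))\<^sup>2) \<partial>lborel \<partial>lborel)"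
    by (rule nn_integral_complex) measurable
  also have "\<dots> \<le> (\<integral>\<^sup>+x. \<integral>\<^sup>+y. \<beta> x * \<alpha> y \<partial>lborel \<partial>lborel)"
  proof (intro nn_integral_mono)
    fix x y
    have "ennreal ((P (Complex x y))\<^sup>2) = ennreal (P (Complex x y)) * ennreal (P (Complex x y))"
      using pos by (simp add: power2_eq_square ennreal_mult)
    then show "ennreal ((P (Complex x y))\<^sup>2) \<le> \<beta> x * \<alpha> y" using a b by (simp add: mult_mono)
  qed
  also have "\<dots> = (\<integral>\<^sup>+x. \<beta> x \<partial>lborel) * (\<integral>\<^sup>+y. \<alpha> y \<partial>lborel)"
    by (simp add: nn_integral_cmult nn_integral_multc)
  also have "(\<integral>\<^sup>+x. \<beta> x \<partial>lborel) = (\<integral>\<^sup>+z. ennreal \<bar>pd \<i> P z\<bar> \<partial>lborel)"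
    unfolding \<beta>_def by (rule nn_integral_complex(1)[symmetric]) measurable
  also have "(\<integral>\<^sup>+y. \<alpha> y \<partial>lborel) = (\<integral>\<^sup>+z. ennreal \<bar>pd 1 P z\<bar> \<partial>lborel)"
    unfolding \<alpha>_def by (rule nn_integral_complex(2)[symmetric]) measurable
  finally show ?thesis by (simp add: mult.commute)
qed

lemma pd_norm_sq:
  fixes f :: "complex \<Rightarrow> complex"
  assumes "f differentiable at x"
  shows "pd e (\<lambda>x. (norm (f x))\<^sup>2) x = 2 * (f x \<bullet> pd e f x)"
proof -
  have "pd e (\<lambda>x. f x \<bullet> f x) x = f x \<bullet> pd e f x + pd e f x \<bullet> f x"
    by (rule pd_bilinear[OF bounded_bilinear_inner assms assms])
  then show ?thesis by (simp add: dot_square_norm inner_commute)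
qed

definition grad_sq :: "complex set \<Rightarrow> (complex \<Rightarrow> complex) \<Rightarrow> real" where
  "grad_sq \<Omega> f = (\<Sum>e\<in>Basis. (nrm (lebesgue_on \<Omega>) (pd e f))\<^sup>2)"

text \<open>Apply \<open>nn_integral_square_le\<close> to \<open>P = |f|^2\<close>, whose partial
  derivatives are at most \<open>2 |f| |pd e f|\<close>. Cauchy-Schwarz produces the factor 4, and
  \<open>2 x y \<le> x^2 + y^2\<close> for the norms of the two partial derivatives lowers it to
  2.\<close>

lemma ladyzhenskaya:
  fixes f :: "complex \<Rightarrow> complex"
  assumes \<Omega>: "\<Omega> \<in> sets lebesgue" and f: "f \<in> test_functions \<Omega>"
  shows "(LINT x|lebesgue_on \<Omega>. (norm (f x))^4) \<le> 2 * (nrm (lebesgue_on \<Omega>) f)\<^sup>2 * grad_sq \<Omega> f"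
proof -
  let ?M = "lebesgue_on \<Omega>"
  define P where "P x = (norm (f x))\<^sup>2" for x
  have B: "1 \<in> (Basis :: complex set)" "\<i> \<in> (Basis :: complex set)" by (auto simp: Basis_complex_def)
  have P: "P \<in> test_functions \<Omega>" unfolding P_def[abs_def] by (rule test_norm_sq[OF f])
  have P2: "(\<lambda>x. (norm (P x))\<^sup>2) \<in> test_functions \<Omega>" by (rule test_norm_sq[OF P])
  have pdi: "(\<integral>\<^sup>+z. ennreal \<bar>pd e P z\<bar> \<partial>lborel) = ennreal (LINT x|lborel. \<bar>pd e P x\<bar>)" if "e \<in> Basis" for e
    by (rule nn_integral_eq_integral) (use test_integrable_lborel[OF test_pd[OF P that]] in auto)
  have pdb: "(LINT x|lborel. \<bar>pd e P x\<bar>) \<le> 2 * (nrm ?M f * nrm ?M (pd e f))" if e: "e \<in> Basis" for e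
  proof -
    have eq: "pd e P x = 2 * (f x \<bullet> pd e f x)" for x
      unfolding P_def[abs_def] by (rule pd_norm_sq[OF test_functionsD(4)[OF f]])
    have s: "sqi ?M f" "sqi ?M (pd e f)" using test_sqi[OF \<Omega>] f test_pd[OF f e] by auto
    have "(LINT x|lborel. \<bar>pd e P x\<bar>) = (LINT x|?M. \<bar>pd e P x\<bar>)"
      by (rule integral_lebesgue_on_eq_lborel[OF \<Omega>, symmetric])
        (use test_borel[OF test_pd[OF P e]] test_zero_outside[OF test_pd[OF P e]] in auto)
    also have "\<dots> \<le> (LINT x|?M. 2 * (norm (f x) * norm (pd e f x)))"
    proof (rule integral_mono)
      show "integrable ?M (\<lambda>x. \<bar>pd e P x\<bar>)" using test_integrable[OF \<Omega> test_pd[OF P e]] by simp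
      show "integrable ?M (\<lambda>x. 2 * (norm (f x) * norm (pd e f x)))" using sqi_norm_mult_integrable[OF s] by simp
      show "\<bar>pd e P x\<bar> \<le> 2 * (norm (f x) * norm (pd e f x))" for x
        unfolding eq using Cauchy_Schwarz_ineq2[of "f x" "pd e f x"] by (simp add: abs_mult)
    qed
    also have "\<dots> \<le> 2 * (nrm ?M f * nrm ?M (pd e f))" using nrm_norm_mult_le[OF s] by simp
    finally show ?thesis .
  qed
  have "ennreal (LINT x|lborel. (norm (P x))\<^sup>2) = (\<integral>\<^sup>+z. ennreal ((P z)\<^sup>2) \<partial>lborel)"
    using nn_integral_eq_integral[OF test_integrable_lborel[OF P2]] by simp
  also have "\<dots> \<le> ennreal (LINT x|lborel. \<bar>pd 1 P x\<bar>) * ennreal (LINT x|lborel. \<bar>pd \<i> P x\<bar>)"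
    using nn_integral_square_le[OF P] pdi[OF B(1)] pdi[OF B(2)] by (simp add: P_def)
  also have "\<dots> = ennreal ((LINT x|lborel. \<bar>pd 1 P x\<bar>) * (LINT x|lborel. \<bar>pd \<i> P x\<bar>))"
    by (simp add: ennreal_mult)
  finally have "(LINT x|lborel. (norm (P x))\<^sup>2) \<le> (LINT x|lborel. \<bar>pd 1 P x\<bar>) * (LINT x|lborel. \<bar>pd \<i> P x\<bar>)"
    by (subst (asm) ennreal_le_iff) simp_all
  also have "\<dots> \<le> (2 * (nrm ?M f * nrm ?M (pd 1 f))) * (2 * (nrm ?M f * nrm ?M (pd \<i> f)))"
    by (intro mult_mono pdb B) auto
  also have "\<dots> = 2 * (nrm ?M f)\<^sup>2 * (2 * nrm ?M (pd 1 f) * nrm ?M (pd \<i> f))" by (simp add: power2_eq_square)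
  also have "\<dots> \<le> 2 * (nrm ?M f)\<^sup>2 * grad_sq \<Omega> f"
    using sum_squares_bound[of "nrm ?M (pd 1 f)" "nrm ?M (pd \<i> f)"]
    by (intro mult_left_mono) (auto simp: grad_sq_def Basis_complex_def)
  finally have "(LINT x|lborel. (norm (P x))\<^sup>2) \<le> 2 * (nrm ?M f)\<^sup>2 * grad_sq \<Omega> f" .
  moreover have "(LINT x|?M. (norm (P x))\<^sup>2) = (LINT x|lborel. (norm (P x))\<^sup>2)"
    by (rule integral_lebesgue_on_eq_lborel[OF \<Omega> test_borel[OF P2]]) (rule test_zero_outside[OF P2])
  ultimately show ?thesis by (simp add: P_def flip: power_mult)
qed

section \<open>Bumps from a smooth step, the fundamental lemma, and Sobolev norms\<close>

section \<open>The fundamental lemma and weak derivatives\<close>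

text \<open>A normalized form of the cutoff in the statement. The spatial bumps behind the
  fundamental lemma and the mollifiers in time behind the du Bois-Reymond argument are all built
  from this one function.\<close>

locale smooth_step =
  fixes S :: "real \<Rightarrow> real"
  assumes smooth_S: "smooth S" and S_ge: "0 \<le> S s" and S_le: "S s \<le> 1"
    and S_0: "s \<le> 0 \<Longrightarrow> S s = 0" and S_1: "s \<ge> 1 \<Longrightarrow> S s = 1"
begin

text \<open>For \<open>n > 0\<close> the first factor rises from 0 to 1 on
  \<open>[c + 1/n, c + 2/n]\<close> and the second falls symmetrically before \<open>d\<close>.
  Subtracting 1 in the arguments keeps the support at distance \<open>1/n\<close> from the
  endpoints, hence compact in the open interval.\<close>

definition bump1 :: "nat \<Rightarrow> real \<Rightarrow> real \<Rightarrow> real \<Rightarrow> real" where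
  "bump1 n c d s = S (real n * (s - c) - 1) * S (real n * (d - s) - 1)"

lemma smooth_bump1: "smooth (bump1 n c d)"
proof -
  have "smooth (\<lambda>s. S (real n * s + (- real n * c - 1)))"
    by (rule smooth_affine[OF bounded_linear_mult_right smooth_S])
  moreover have "smooth (\<lambda>s. S ((- real n) * s + (real n * d - 1)))"
    by (rule smooth_affine[OF bounded_linear_mult_right smooth_S])
  ultimately have "smooth (\<lambda>s. S (real n * s + (- real n * c - 1)) * S ((- real n) * s + (real n * d - 1)))"
    by (rule smooth_bilinear[OF bounded_bilinear_mult])
  then show ?thesis unfolding bump1_def[abs_def] by (simp add: algebra_simps)
qed

lemma bump1_bounds: "0 \<le> bump1 n c d s" "bump1 n c d s \<le> 1"
  unfolding bump1_def using S_ge S_le by (auto intro: mult_le_one)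

lemma bump1_zero: "n > 0 \<Longrightarrow> s \<notin> {c + 1/n..d - 1/n} \<Longrightarrow> bump1 n c d s = 0"
  unfolding bump1_def by (auto simp: S_0 field_simps not_le)

lemma bump1_tendsto: "(\<lambda>n. bump1 n c d s) \<longlonglongrightarrow> indicator {c<..<d} s"
proof (cases "s \<in> {c<..<d}")
  case True
  obtain N where N: "real N * (s - c) > 2" "real N * (d - s) > 2"
  proof -
    obtain N1 where "real N1 * (s - c) > 2" using True reals_Archimedean3[of "s - c"] by auto
    moreover obtain N2 where "real N2 * (d - s) > 2" using True reals_Archimedean3[of "d - s"] by auto
    ultimately show ?thesis using True
      by (intro that[of "max N1 N2"]) (smt (verit) mult_right_mono of_nat_mono max.cobounded1 max.cobounded2 greaterThanLessThan_iff)+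
  qed
  have "bump1 n c d s = 1" if "n \<ge> N" for n
  proof -
    have "real N * (s - c) \<le> real n * (s - c)" "real N * (d - s) \<le> real n * (d - s)"
      using True that by (auto intro!: mult_right_mono)
    then show ?thesis using N unfolding bump1_def by (simp add: S_1)
  qed
  then have "\<forall>\<^sub>F n in sequentially. bump1 n c d s = 1" by (auto simp: eventually_sequentially)
  then show ?thesis using True by (simp add: tendsto_eventually)
next
  case False
  have "bump1 n c d s = 0" for n
  proof -
    have "real n * (s - c) \<le> 0 \<or> real n * (d - s) \<le> 0"
      using False by (auto simp: mult_le_0_iff)
    then show ?thesis unfolding bump1_def by (auto simp: S_0)
  qed
  then show ?thesis using False by simp
qed

definition bump2 :: "nat \<Rightarrow> complex \<Rightarrow> complex \<Rightarrow> complex \<Rightarrow> real" where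
  "bump2 n c d z = bump1 n (Re c) (Re d) (Re z) * bump1 n (Im c) (Im d) (Im z)"

lemma smooth_bump2: "smooth (bump2 n c d)"
  unfolding bump2_def[abs_def]
  using smooth_bilinear[OF bounded_bilinear_mult smooth_affine[OF bounded_linear_Re smooth_bump1, where c = 0]
      smooth_affine[OF bounded_linear_Im smooth_bump1, where c = 0]] by simp

lemma bump2_bounds: "\<bar>bump2 n c d z\<bar> \<le> indicator (box c d) z" if "n > 0"
proof (cases "z \<in> box c d")
  case True
  then show ?thesis unfolding bump2_def using bump1_bounds by (auto simp: abs_mult intro!: mult_le_one)
next
  case False
  define r where "r = 1 / real n"
  have e: "r > 0" using that by (simp add: r_def)
  have "Re z \<notin> {Re c + 1/n..Re d - 1/n} \<or> Im z \<notin> {Im c + 1/n..Im d - 1/n}"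
    using False e unfolding r_def[symmetric] by (auto simp: box_def Basis_complex_def)
  then show ?thesis using bump1_zero[OF that] unfolding bump2_def by auto
qed

lemma bump2_test:
  assumes "n > 0" "box c d \<subseteq> \<Omega>"
  shows "bump2 n c d \<in> test_functions \<Omega>"
proof (rule test_functionsI[OF smooth_bump2])
  let ?K = "cbox (Complex (Re c + 1/n) (Im c + 1/n)) (Complex (Re d - 1/n) (Im d - 1/n))"
  show "compact ?K" by simp
  define r where "r = 1 / real n"
  have e: "r > 0" using assms by (simp add: r_def)
  show "?K \<subseteq> \<Omega>"
  proof
    fix z assume "z \<in> ?K"
    then have "z \<in> box c d" using e unfolding r_def[symmetric] by (auto simp: box_def cbox_def Basis_complex_def)
    then show "z \<in> \<Omega>" using assms by auto
  qed
  show "bump2 n c d z = 0" if "z \<notin> ?K" for z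
  proof -
    have "Re z \<notin> {Re c + 1/n..Re d - 1/n} \<or> Im z \<notin> {Im c + 1/n..Im d - 1/n}"
      using that by (auto simp: cbox_def Basis_complex_def)
    then show ?thesis using bump1_zero[OF assms(1)] unfolding bump2_def by auto
  qed
qed

lemma bump2_tendsto: "(\<lambda>n. bump2 n c d z) \<longlonglongrightarrow> indicator (box c d) z"
proof -
  have "(\<lambda>n. bump2 n c d z) \<longlonglongrightarrow> indicator {Re c<..<Re d} (Re z) * indicator {Im c<..<Im d} (Im z)"
    unfolding bump2_def by (intro tendsto_mult bump1_tendsto)
  moreover have "indicator {Re c<..<Re d} (Re z) * indicator {Im c<..<Im d} (Im z) = (indicator (box c d) z :: real)"
    by (auto simp: box_def Basis_complex_def indicator_def)
  ultimately show ?thesis by simp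
qed

lemma sigma_finite_lebesgue: "sigma_finite_measure (lebesgue :: 'a::euclidean_space measure)"
proof
  obtain A :: "'a set set" where "countable A" "A \<subseteq> sets lborel" "\<Union>A = space lborel" "\<forall>a\<in>A. emeasure lborel a \<noteq> \<infinity>"
    using lborel.sigma_finite_countable by blast
  then show "\<exists>A::'a set set. countable A \<and> A \<subseteq> sets lebesgue \<and> \<Union> A = space lebesgue \<and> (\<forall>a\<in>A. emeasure lebesgue a \<noteq> \<infinity>)"
    by (intro exI[of _ A]) auto
qed

text \<open>Bumps converge to indicators of boxes, so \<open>g\<close> integrates to zero over every
  box in \<open>\<Omega>\<close>. Boxes are stable under intersection and generate the Borel sets,
  so a Dynkin argument gives zero integrals over all measurable parts of a fixed box, and
  \<open>g\<close> vanishes almost everywhere there. Countably many boxes cover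
  \<open>\<Omega>\<close>.\<close>

lemma fundamental_lemma:
  fixes g :: "complex \<Rightarrow> complex"
  assumes \<Omega>: "open \<Omega>" and g: "sqi (lebesgue_on \<Omega>) g"
    and zero: "\<And>\<phi> :: complex \<Rightarrow> real. \<phi> \<in> test_functions \<Omega> \<Longrightarrow> (LINT x|lebesgue_on \<Omega>. \<phi> x *\<^sub>R g x) = 0"
  shows "AE x in lebesgue_on \<Omega>. g x = 0"
proof -
  have \<Omega>s: "\<Omega> \<in> sets lebesgue" using \<Omega> by simp
  define G where "G x = indicator \<Omega> x *\<^sub>R g x" for x
  have gm: "G \<in> borel_measurable lebesgue"
    using sqi_measurable[OF g] \<Omega>s unfolding G_def by (simp add: borel_measurable_restrict_space_iff)
  have G2: "integrable lebesgue (\<lambda>x. (norm (G x))\<^sup>2)"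
  proof -
    have "integrable lebesgue (\<lambda>x. indicator \<Omega> x *\<^sub>R (norm (g x))\<^sup>2)"
      using sqi_integrable[OF g] \<Omega>s by (simp add: integrable_restrict_space)
    moreover have "(\<lambda>x. indicator \<Omega> x *\<^sub>R (norm (g x))\<^sup>2) = (\<lambda>x. (norm (G x))\<^sup>2)"
      by (auto simp: G_def indicator_def fun_eq_iff)
    ultimately show ?thesis by simp
  qed
  have boxint: "integrable lebesgue (\<lambda>x. indicator (box a b) x *\<^sub>R G x)" for a b
  proof (rule Bochner_Integration.integrable_bound)
    show "integrable lebesgue (\<lambda>x. (norm (G x))\<^sup>2 + indicator (box a b) x :: real)"
      by (intro Bochner_Integration.integrable_add G2 integrable_real_indicator)
        (auto simp: emeasure_bounded_finite[OF bounded_box, unfolded infinity_ennreal_def])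
    show "(\<lambda>x. indicator (box a b) x *\<^sub>R G x) \<in> borel_measurable lebesgue"
      by (intro borel_measurable_scaleR borel_measurable_indicator gm) simp
    have "norm (indicator (box a b) x *\<^sub>R G x) \<le> norm ((norm (G x))\<^sup>2 + indicator (box a b) x :: real)" for x
    proof -
      \<comment> \<open>Square integrability gives integrability on bounded sets.\<close>
      have "r \<le> r\<^sup>2 + 1" for r :: real using sum_squares_bound[of r 1] by (simp add: power2_eq_square) (smt (verit) zero_le_square)
      then show ?thesis by (auto simp: indicator_def)
    qed
    then show "AE x in lebesgue. norm (indicator (box a b) x *\<^sub>R G x) \<le> norm ((norm (G x))\<^sup>2 + indicator (box a b) x :: real)" by simp
  qed
  have box0: "(LINT x|lebesgue. indicator (box a b) x *\<^sub>R G x) = 0" if sub: "box a b \<subseteq> \<Omega>" for a b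
  proof -
    have "(\<lambda>n. LINT x|lebesgue. bump2 (Suc n) a b x *\<^sub>R G x) \<longlonglongrightarrow> (LINT x|lebesgue. indicator (box a b) x *\<^sub>R G x)"
    proof (rule integral_dominated_convergence)
      show "(\<lambda>x. indicator (box a b) x *\<^sub>R G x) \<in> borel_measurable lebesgue"
      by (intro borel_measurable_scaleR borel_measurable_indicator gm) simp
      show "(\<lambda>x. bump2 (Suc n) a b x *\<^sub>R G x) \<in> borel_measurable lebesgue" for n
      proof -
        have "bump2 (Suc n) a b \<in> borel_measurable lebesgue"
          using borel_measurable_continuous_onI[OF smooth_continuous[OF smooth_bump2]] by (intro measurable_completion) simp
        then show ?thesis by (intro borel_measurable_scaleR gm)
      qed
      show "integrable lebesgue (\<lambda>x. norm (indicator (box a b) x *\<^sub>R G x))" using boxint by (rule integrable_norm)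
      show "AE x in lebesgue. (\<lambda>n. bump2 (Suc n) a b x *\<^sub>R G x) \<longlonglongrightarrow> indicator (box a b) x *\<^sub>R G x"
        by (intro AE_I2 tendsto_scaleR tendsto_const LIMSEQ_Suc[OF bump2_tendsto])
      show "AE x in lebesgue. norm (bump2 (Suc n) a b x *\<^sub>R G x) \<le> norm (indicator (box a b) x *\<^sub>R G x)" for n
      proof (intro AE_I2)
        fix x
        have "\<bar>bump2 (Suc n) a b x\<bar> \<le> indicator (box a b) x" by (rule bump2_bounds) simp
        then show "norm (bump2 (Suc n) a b x *\<^sub>R G x) \<le> norm (indicator (box a b) x *\<^sub>R G x)"
          by (simp add: mult_right_mono)
      qed
    qed
    moreover have "(LINT x|lebesgue. bump2 (Suc n) a b x *\<^sub>R G x) = 0" for n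
    proof -
      have "(LINT x|lebesgue_on \<Omega>. bump2 (Suc n) a b x *\<^sub>R g x) = 0"
        by (rule zero) (rule bump2_test; use sub in simp)
      then show ?thesis using \<Omega>s by (simp add: integral_restrict_space G_def mult.commute)
    qed
    ultimately show ?thesis by (simp add: LIMSEQ_const_iff)
  qed
  have main: "AE x in lebesgue. x \<in> box a b \<longrightarrow> g x = 0" if sub: "box a b \<subseteq> \<Omega>" for a b
  proof -
    \<comment> \<open>Confined to one box, the function is integrable over the whole plane, so the
      complement case of the induction can subtract from a finite total integral, which is itself
      zero.\<close>
    define h where "h x = indicator (box a b) x *\<^sub>R G x" for x
    have hi: "integrable lebesgue h" unfolding h_def by (rule boxint)
    have si: "set_integrable lebesgue A h" if "A \<in> sets borel" for A
      unfolding set_integrable_def using that by (intro integrable_mult_indicator hi) auto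
    let ?E = "range (\<lambda>(a, b). box a b :: complex set)"
    have h0: "integral\<^sup>L lebesgue h = 0" using box0[OF sub] by (simp add: h_def[abs_def])
    have E: "Int_stable ?E" "?E \<subseteq> Pow UNIV" by (auto simp: Int_stable_def box_Int_box)
    have sig: "set_lebesgue_integral lebesgue A h = 0" if A: "A \<in> sigma_sets UNIV ?E" for A
      using E A
    proof (induction rule: sigma_sets_induct_disjoint)
      case (basic A)
      then obtain c d where A: "A = box c d" by auto
      obtain c' d' where cd: "box c d \<inter> box a b = box c' d'" by (auto simp: box_Int_box)
      have "(\<lambda>x. indicator A x *\<^sub>R h x) = (\<lambda>x. indicator (box c' d') x *\<^sub>R G x)"
        unfolding A h_def cd[symmetric] by (auto simp: indicator_def fun_eq_iff)
      then show ?case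
        using box0[of c' d'] cd sub by (auto simp: set_lebesgue_integral_def)
    next
      case empty
      show ?case by (simp add: set_lebesgue_integral_def)
    next
      case (compl A)
      have Ab: "A \<in> sets borel" using compl by (simp add: borel_eq_box)
      have "integral\<^sup>L lebesgue h = set_lebesgue_integral lebesgue (A \<union> (UNIV - A)) h"
        by (simp add: set_lebesgue_integral_def)
      also have "\<dots> = set_lebesgue_integral lebesgue A h + set_lebesgue_integral lebesgue (UNIV - A) h"
        by (rule set_integral_Un) (use si[OF Ab] si[of "UNIV - A"] Ab in auto)
      finally show ?case
        using compl.IH h0 by simp
    next
      case (union A)
      have Ab: "A i \<in> sets borel" for i using union by (auto simp: borel_eq_box)
      have "set_lebesgue_integral lebesgue (\<Union> (range A)) h = (\<Sum>i. set_lebesgue_integral lebesgue (A i) h)"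
        by (rule lebesgue_integral_countable_add)
          (use Ab union.hyps si[of "\<Union> (range A)"] in \<open>auto simp: disjoint_family_on_def\<close>)
      then show ?case using union.IH by simp
    qed
    have bor: "set_lebesgue_integral lebesgue A h = 0" if "A \<in> sets borel" for A
      using sig[of A] that by (simp add: borel_eq_box)
    have "AE x in lebesgue. h x = 0"
    proof (rule sigma_finite_measure.density_zero[OF _ hi])
      show "sigma_finite_measure (lebesgue :: complex measure)" by (rule sigma_finite_lebesgue)
      fix A :: "complex set" assume "A \<in> sets lebesgue"
      \<comment> \<open>The induction reaches Borel sets only; a Lebesgue set differs from a Borel
        set by a null set, which does not change the integral.\<close>
      then obtain S N N' where A: "A = S \<union> N" "S \<in> sets lborel" "N \<subseteq> N'" "N' \<in> null_sets lborel"
        by (elim sets_completionE)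
      have N: "N' \<in> null_sets lebesgue" using A(4) by (simp add: null_sets_completionI)
      have "set_lebesgue_integral lebesgue A h = set_lebesgue_integral lebesgue S h"
        unfolding set_lebesgue_integral_def
      proof (rule integral_cong_AE)
        have "A \<in> sets lebesgue" "S \<in> sets lebesgue" using A \<open>A \<in> sets lebesgue\<close> by auto
        then show "(\<lambda>x. indicator A x *\<^sub>R h x) \<in> borel_measurable lebesgue" "(\<lambda>x. indicator S x *\<^sub>R h x) \<in> borel_measurable lebesgue"
          by (intro borel_measurable_scaleR borel_measurable_indicator borel_measurable_integrable[OF hi]; simp)+
        show "AE x in lebesgue. indicator A x *\<^sub>R h x = indicator S x *\<^sub>R h x"
          using AE_not_in[OF N] by eventually_elim (use A in \<open>auto simp: indicator_def\<close>)
      qed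
      then show "set_lebesgue_integral lebesgue A h = 0" using bor A by simp
    qed
    then show ?thesis by eventually_elim (use sub in \<open>auto simp: h_def G_def\<close>)
  qed
  obtain D where D: "countable D" "\<And>X. X \<in> D \<Longrightarrow> \<exists>a b. X = box a b" "D \<subseteq> Pow \<Omega>" "\<Union>D = \<Omega>"
    using open_countable_Union_open_box[OF \<Omega>] by metis
  have "AE x in lebesgue. \<forall>X\<in>D. x \<in> X \<longrightarrow> g x = 0"
  proof (subst AE_ball_countable[OF D(1)], intro ballI)
    fix X assume "X \<in> D"
    then obtain a b where "X = box a b" using D by blast
    then show "AE x in lebesgue. x \<in> X \<longrightarrow> g x = 0" using main[of a b] D \<open>X \<in> D\<close> by auto
  qed
  then have "AE x in lebesgue. x \<in> \<Omega> \<longrightarrow> g x = 0" by eventually_elim (use D(4) in auto)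
  then show ?thesis using \<Omega>s by (simp add: AE_restrict_space_iff)
qed

end

locale step_domain = smooth_step +
  fixes \<Omega> :: "complex set"
  assumes open_\<Omega>: "open \<Omega>"
begin

abbreviation "M \<equiv> lebesgue_on \<Omega>"

lemma sets_\<Omega>: "\<Omega> \<in> sets lebesgue" using open_\<Omega> by simp

lemma L2_sqi: "w \<in> L2 \<Omega> \<longleftrightarrow> sqi M w" by (rule L2_iff_sqi[OF sets_\<Omega>])
lemma L2_norm_nrm: "L2_norm \<Omega> = nrm M" by (rule L2_norm_eq_nrm[OF sets_\<Omega>])
lemma set_integral_M:
  fixes f :: "complex \<Rightarrow> 'b::{banach, second_countable_topology}"
  shows "(LINT x:\<Omega>|lebesgue. f x) = integral\<^sup>L M f" by (rule LINT_restrict[OF sets_\<Omega>])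

lemma sqi_test:
  fixes f :: "complex \<Rightarrow> 'b::euclidean_space"
  shows "f \<in> test_functions \<Omega> \<Longrightarrow> sqi M f" by (rule test_sqi[OF sets_\<Omega>])

lemma test_mult_integrable:
  fixes w :: "complex \<Rightarrow> 'b::euclidean_space" and \<phi> :: "complex \<Rightarrow> real"
  assumes "\<phi> \<in> test_functions \<Omega>" "sqi M w" shows "integrable M (\<lambda>x. \<phi> x *\<^sub>R w x)"
proof (rule Bochner_Integration.integrable_bound[OF sqi_norm_mult_integrable[OF sqi_test[OF assms(1)] assms(2)]])
  show "(\<lambda>x. \<phi> x *\<^sub>R w x) \<in> borel_measurable M"
    using sqi_measurable[OF sqi_test[OF assms(1)]] sqi_measurable[OF assms(2)] by measurable
qed auto

lemma weak_partial_unique: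
  assumes "sqi M g" "sqi M h" "has_weak_partial \<Omega> e w g" "has_weak_partial \<Omega> e w h"
  shows "AE x in M. g x = h x"
proof -
  have "AE x in M. g x - h x = 0"
  proof (rule fundamental_lemma[OF open_\<Omega> sqi_diff[OF assms(1,2)]])
    fix \<phi> :: "complex \<Rightarrow> real" assume \<phi>: "\<phi> \<in> test_functions \<Omega>"
    have "(LINT x|M. \<phi> x *\<^sub>R g x) = (LINT x|M. \<phi> x *\<^sub>R h x)"
      using assms(3,4) \<phi> unfolding has_weak_partial_def set_integral_M by (metis neg_equal_iff_equal)
    then show "(LINT x|M. \<phi> x *\<^sub>R (g x - h x)) = 0"
      using test_mult_integrable[OF \<phi> assms(1)] test_mult_integrable[OF \<phi> assms(2)]
      by (simp add: scaleR_diff_right)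
  qed
  then show ?thesis by simp
qed

lemma has_weak_partial_diff:
  assumes "sqi M w" "sqi M z" "sqi M g" "sqi M h" "has_weak_partial \<Omega> e w g" "has_weak_partial \<Omega> e z h" "e \<in> Basis"
  shows "has_weak_partial \<Omega> e (\<lambda>x. w x - z x) (\<lambda>x. g x - h x)"
  unfolding has_weak_partial_def set_integral_M
proof (intro allI impI)
  fix \<phi> :: "complex \<Rightarrow> real" assume \<phi>: "\<phi> \<in> test_functions \<Omega>"
  note i = test_mult_integrable[OF test_pd[OF \<phi> assms(7)]] test_mult_integrable[OF \<phi>]
  have "(LINT x|M. pd e \<phi> x *\<^sub>R w x) = - (LINT x|M. \<phi> x *\<^sub>R g x)"
    "(LINT x|M. pd e \<phi> x *\<^sub>R z x) = - (LINT x|M. \<phi> x *\<^sub>R h x)"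
    using assms(5,6) \<phi> unfolding has_weak_partial_def set_integral_M by auto
  then show "(LINT x|M. pd e \<phi> x *\<^sub>R (w x - z x)) = - (LINT x|M. \<phi> x *\<^sub>R (g x - h x))"
    using assms(1-4) by (simp add: scaleR_diff_right i)
qed

lemma has_weak_partial_test:
  fixes f :: "complex \<Rightarrow> complex"
  assumes "f \<in> test_functions \<Omega>" "e \<in> Basis"
  shows "has_weak_partial \<Omega> e f (pd e f)"
  unfolding has_weak_partial_def set_integral_M
  using integral_by_parts[OF bounded_bilinear_scaleR sets_\<Omega> _ assms(1) assms(2)] by simp

lemma H1_sqi: "w \<in> H1 \<Omega> \<Longrightarrow> sqi M w"
  by (simp add: H1_def L2_sqi)

lemma weak_partial_prop:
  assumes "w \<in> H1 \<Omega>" "e \<in> Basis"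
  shows "sqi M (weak_partial \<Omega> e w)" "has_weak_partial \<Omega> e w (weak_partial \<Omega> e w)"
proof -
  have "\<exists>g. g \<in> L2 \<Omega> \<and> has_weak_partial \<Omega> e w g" using assms unfolding H1_def by blast
  from someI_ex[OF this] show "sqi M (weak_partial \<Omega> e w)" "has_weak_partial \<Omega> e w (weak_partial \<Omega> e w)"
    by (auto simp: weak_partial_def L2_sqi)
qed

text \<open>Recording a function together with its weak gradient turns the Sobolev norm into an \<open>L\<^sup>2\<close> norm.\<close>

definition jet :: "(complex \<Rightarrow> complex) \<Rightarrow> complex \<Rightarrow> complex \<times> complex \<times> complex" where
  "jet w x = (w x, weak_partial \<Omega> 1 w x, weak_partial \<Omega> \<i> w x)"

lemma sqi_triple:
  assumes "sqi M f" "sqi M g" "sqi M h"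
  shows "sqi M (\<lambda>x. (f x, g x, h x))"
    and "(nrm M (\<lambda>x. (f x, g x, h x)))\<^sup>2 = (nrm M f)\<^sup>2 + (nrm M g)\<^sup>2 + (nrm M h)\<^sup>2"
proof -
  have n: "(norm (f x, g x, h x))\<^sup>2 = (norm (f x))\<^sup>2 + (norm (g x))\<^sup>2 + (norm (h x))\<^sup>2" for x
    by (simp add: norm_prod_def)
  show "sqi M (\<lambda>x. (f x, g x, h x))" unfolding sqi_def n
    using assms by (auto simp: sqi_def intro!: borel_measurable_Pair)
  show "(nrm M (\<lambda>x. (f x, g x, h x)))\<^sup>2 = (nrm M f)\<^sup>2 + (nrm M g)\<^sup>2 + (nrm M h)\<^sup>2"
    unfolding nrm_sq n using assms by (simp add: sqi_integrable)
qed

lemma Basis_complex_mem: "1 \<in> (Basis :: complex set)" "\<i> \<in> (Basis :: complex set)" by (auto simp: Basis_complex_def)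

lemma jet_sqi: "w \<in> H1 \<Omega> \<Longrightarrow> sqi M (jet w)"
  unfolding jet_def[abs_def] by (intro sqi_triple H1_sqi weak_partial_prop Basis_complex_mem)

lemma H1_norm_jet: "w \<in> H1 \<Omega> \<Longrightarrow> H1_norm \<Omega> w = nrm M (jet w)"
  using sqi_triple(2)[OF H1_sqi weak_partial_prop(1)[OF _ Basis_complex_mem(1)] weak_partial_prop(1)[OF _ Basis_complex_mem(2)], of w w w]
  unfolding H1_norm_def L2_norm_nrm jet_def[abs_def]
  by (simp add: Basis_complex_def add.assoc real_sqrt_unique)

text \<open>\<open>weak_partial\<close> picks an arbitrary representative, so it is linear only
  almost everywhere. The identity for jets comes from uniqueness of weak derivatives and suffices
  for norms.\<close>

lemma H1_diff:
  assumes "w \<in> H1 \<Omega>" "z \<in> H1 \<Omega>"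
  shows "(\<lambda>x. w x - z x) \<in> H1 \<Omega>" and "AE x in M. jet (\<lambda>x. w x - z x) x = jet w x - jet z x"
proof -
  have d: "has_weak_partial \<Omega> e (\<lambda>x. w x - z x) (\<lambda>x. weak_partial \<Omega> e w x - weak_partial \<Omega> e z x)"
    "sqi M (\<lambda>x. weak_partial \<Omega> e w x - weak_partial \<Omega> e z x)" if "e \<in> Basis" for e
    using that assms[THEN H1_sqi] weak_partial_prop[OF assms(1)] weak_partial_prop[OF assms(2)]
    by (simp_all add: has_weak_partial_diff sqi_diff)
  then show 1: "(\<lambda>x. w x - z x) \<in> H1 \<Omega>"
    unfolding H1_def Bex_def L2_sqi using sqi_diff[OF assms[THEN H1_sqi]] by (auto simp: L2_sqi)
  have "AE x in M. weak_partial \<Omega> e (\<lambda>x. w x - z x) x = weak_partial \<Omega> e w x - weak_partial \<Omega> e z x" if "e \<in> Basis" for e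
    by (rule weak_partial_unique[OF weak_partial_prop(1)[OF 1 that] d(2)[OF that] weak_partial_prop(2)[OF 1 that] d(1)[OF that]])
  from this[OF Basis_complex_mem(1)] this[OF Basis_complex_mem(2)]
  show "AE x in M. jet (\<lambda>x. w x - z x) x = jet w x - jet z x"
    by eventually_elim (simp add: jet_def)
qed

lemma H1_norm_diff:
  assumes "w \<in> H1 \<Omega>" "z \<in> H1 \<Omega>"
  shows "H1_norm \<Omega> (\<lambda>x. w x - z x) = nrm M (\<lambda>x. jet w x - jet z x)"
  unfolding H1_norm_jet[OF H1_diff(1)[OF assms]]
  by (rule nrm_cong_AE[OF jet_sqi[OF H1_diff(1)[OF assms]] sqi_diff[OF assms[THEN jet_sqi]] H1_diff(2)[OF assms]])

text \<open>The representative picked by \<open>weak_partial\<close> agrees almost everywhere with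
  the classical derivative; this lets estimates proved by classical calculus speak about
  \<open>H1_norm\<close>.\<close>

lemma test_H1:
  fixes f :: "complex \<Rightarrow> complex"
  assumes "f \<in> test_functions \<Omega>"
  shows "f \<in> H1 \<Omega>" and "AE x in M. jet f x = (f x, pd 1 f x, pd \<i> f x)"
proof -
  show 1: "f \<in> H1 \<Omega>" unfolding H1_def Bex_def L2_sqi
    using sqi_test[OF assms] sqi_test[OF test_pd[OF assms]] has_weak_partial_test[OF assms] by (auto simp: L2_sqi)
  have "AE x in M. weak_partial \<Omega> e f x = pd e f x" if "e \<in> Basis" for e
    by (rule weak_partial_unique[OF weak_partial_prop(1)[OF 1 that] sqi_test[OF test_pd[OF assms that]]
          weak_partial_prop(2)[OF 1 that] has_weak_partial_test[OF assms that]])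
  from this[OF Basis_complex_mem(1)] this[OF Basis_complex_mem(2)]
  show "AE x in M. jet f x = (f x, pd 1 f x, pd \<i> f x)" by eventually_elim (simp add: jet_def)
qed

lemma test_H1_norm:
  assumes f: "f \<in> test_functions \<Omega>"
  shows "(H1_norm \<Omega> f)\<^sup>2 = (nrm M f)\<^sup>2 + (\<Sum>e\<in>Basis. (nrm M (pd e f))\<^sup>2)"
proof -
  note s = sqi_test[OF f] sqi_test[OF test_pd[OF f Basis_complex_mem(1)]] sqi_test[OF test_pd[OF f Basis_complex_mem(2)]]
  have "H1_norm \<Omega> f = nrm M (\<lambda>x. (f x, pd 1 f x, pd \<i> f x))"
    unfolding H1_norm_jet[OF test_H1(1)[OF f]]
    by (rule nrm_cong_AE[OF jet_sqi[OF test_H1(1)[OF f]] sqi_triple(1)[OF s] test_H1(2)[OF f]])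
  then show ?thesis using sqi_triple(2)[OF s] by (simp add: Basis_complex_def)
qed

lemma H1_norm_nonneg: "0 \<le> H1_norm \<Omega> w"
  unfolding H1_norm_def by (intro real_sqrt_ge_zero add_nonneg_nonneg sum_nonneg) auto

lemma nrm_le_H1_norm: "nrm M w \<le> H1_norm \<Omega> w"
  unfolding H1_norm_def L2_norm_nrm by (rule real_le_rsqrt) (simp add: sum_nonneg)

lemma H1_norm_triangle:
  assumes "a \<in> H1 \<Omega>" "b \<in> H1 \<Omega>" "c \<in> H1 \<Omega>"
  shows "H1_norm \<Omega> (\<lambda>x. a x - c x) \<le> H1_norm \<Omega> (\<lambda>x. a x - b x) + H1_norm \<Omega> (\<lambda>x. b x - c x)"
  using assms nrm_triangle3[OF assms[THEN jet_sqi]] by (simp add: H1_norm_diff)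

lemma H1_norm_commute:
  assumes "a \<in> H1 \<Omega>" "b \<in> H1 \<Omega>"
  shows "H1_norm \<Omega> (\<lambda>x. a x - b x) = H1_norm \<Omega> (\<lambda>x. b x - a x)"
  unfolding H1_norm_diff[OF assms] H1_norm_diff[OF assms(2,1)] by (rule nrm_minus_commute)

lemma H1_norm_diff_abs:
  assumes "a \<in> H1 \<Omega>" "b \<in> H1 \<Omega>"
  shows "\<bar>H1_norm \<Omega> a - H1_norm \<Omega> b\<bar> \<le> H1_norm \<Omega> (\<lambda>x. a x - b x)"
  using assms nrm_diff_abs[OF assms[THEN jet_sqi]] by (simp add: H1_norm_diff H1_norm_jet)

lemma H1_norm_diff_diff:
  assumes "a \<in> H1 \<Omega>" "b \<in> H1 \<Omega>" "c \<in> H1 \<Omega>" "d \<in> H1 \<Omega>"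
  shows "H1_norm \<Omega> (\<lambda>x. (a x - b x) - (c x - d x)) \<le> H1_norm \<Omega> (\<lambda>x. a x - c x) + H1_norm \<Omega> (\<lambda>x. b x - d x)"
proof -
  note s = assms[THEN jet_sqi]
  have "H1_norm \<Omega> (\<lambda>x. (a x - b x) - (c x - d x)) = nrm M (\<lambda>x. (jet a x - jet c x) - (jet b x - jet d x))"
    unfolding H1_norm_diff[OF H1_diff(1)[OF assms(1,2)] H1_diff(1)[OF assms(3,4)]]
  proof (rule nrm_cong_AE)
    show "sqi M (\<lambda>x. jet (\<lambda>x. a x - b x) x - jet (\<lambda>x. c x - d x) x)" by (intro sqi_diff jet_sqi H1_diff assms)
    show "sqi M (\<lambda>x. jet a x - jet c x - (jet b x - jet d x))" by (intro sqi_diff s)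
    show "AE x in M. jet (\<lambda>x. a x - b x) x - jet (\<lambda>x. c x - d x) x = jet a x - jet c x - (jet b x - jet d x)"
      using H1_diff(2)[OF assms(1,2)] H1_diff(2)[OF assms(3,4)] by eventually_elim simp
  qed
  also have "\<dots> \<le> nrm M (\<lambda>x. jet a x - jet c x) + nrm M (\<lambda>x. jet b x - jet d x)"
    by (intro nrm_triangle_diff sqi_diff s)
  finally show ?thesis using assms by (simp add: H1_norm_diff)
qed

lemma V_H1: "w \<in> V_space \<Omega> \<Longrightarrow> w \<in> H1 \<Omega>" by (simp add: V_space_def)

lemma sol_test: "\<phi> \<in> solenoidal_tests \<Omega> \<Longrightarrow> \<phi> \<in> test_functions \<Omega>" by (simp add: solenoidal_tests_def)

end

section \<open>Estimates for the convective, background and viscous terms on smooth fields\<close>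

section \<open>Energy estimates\<close>

text \<open>Its pointwise norm is the Hilbert-Schmidt norm of the Jacobian matrix, and for test
  fields its squared L^2 norm is \<open>grad_sq\<close>.\<close>

definition gradpair :: "(complex \<Rightarrow> 'b::euclidean_space) \<Rightarrow> complex \<Rightarrow> 'b \<times> 'b" where
  "gradpair f x = (pd 1 f x, pd \<i> f x)"

lemma advect_complex: "advect a f x = Re (a x) *\<^sub>R pd 1 f x + Im (a x) *\<^sub>R pd \<i> f x"
  by (simp add: advect_def Basis_complex_def)

lemma norm_advect_le:
  fixes f :: "complex \<Rightarrow> 'b::euclidean_space"
  shows "norm (advect a f x) \<le> norm (a x) * norm (gradpair f x)"
proof (rule power2_le_imp_le)
  let ?p = "norm (pd 1 f x)" and ?q = "norm (pd \<i> f x)"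
  have "norm (advect a f x) \<le> \<bar>Re (a x)\<bar> * ?p + \<bar>Im (a x)\<bar> * ?q"
    unfolding advect_complex by (rule norm_triangle_le) simp
  then have "(norm (advect a f x))\<^sup>2 \<le> (\<bar>Re (a x)\<bar> * ?p + \<bar>Im (a x)\<bar> * ?q)\<^sup>2" by (rule power_mono) simp
  also have "\<dots> \<le> ((Re (a x))\<^sup>2 + (Im (a x))\<^sup>2) * (?p\<^sup>2 + ?q\<^sup>2)"
  proof -
    \<comment> \<open>Lagrange's identity: this square is the defect in the Cauchy-Schwarz
      inequality for two-component vectors.\<close>
    have "0 \<le> (\<bar>Re (a x)\<bar> * ?q - \<bar>Im (a x)\<bar> * ?p)\<^sup>2" by simp
    also have "\<dots> = ((Re (a x))\<^sup>2 + (Im (a x))\<^sup>2) * (?p\<^sup>2 + ?q\<^sup>2) - (\<bar>Re (a x)\<bar> * ?p + \<bar>Im (a x)\<bar> * ?q)\<^sup>2"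
      by (simp add: power2_eq_square algebra_simps)
    finally show ?thesis by simp
  qed
  also have "\<dots> = (norm (a x) * norm (gradpair f x))\<^sup>2"
    by (simp add: power_mult_distrib cmod_power2 gradpair_def norm_prod_def)
  finally show "(norm (advect a f x))\<^sup>2 \<le> (norm (a x) * norm (gradpair f x))\<^sup>2" .
qed simp

lemma inner_gradient:
  fixes f :: "complex \<Rightarrow> real"
  shows "a x \<bullet> gradient f x = Re (a x) * pd 1 f x + Im (a x) * pd \<i> f x"
  by (simp add: gradient_def Basis_complex_def inner_complex_def)

lemma measurable_Re_Im:
  assumes "a \<in> borel_measurable N"
  shows "(\<lambda>x. Re (a x)) \<in> borel_measurable N" "(\<lambda>x. Im (a x)) \<in> borel_measurable N"
  using assms by measurable

context step_domain begin

lemma integral_div_free: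
  fixes f :: "complex \<Rightarrow> real"
  assumes a: "a \<in> solenoidal_tests \<Omega>" and f: "f \<in> test_functions \<Omega>"
  shows "(LINT x|M. a x \<bullet> gradient f x) = 0"
proof -
  note at = sol_test[OF a]
  have p: "bounded_bilinear (\<lambda>(y::complex) (z::real). (y \<bullet> e) * z)" for e
    by (rule bounded_bilinear.comp1[OF bounded_bilinear_mult bounded_linear_inner_left])
  have parts: "(LINT x|M. (a x \<bullet> e) * pd e f x) = - (LINT x|M. (pd e a x \<bullet> e) * f x)" if "e \<in> Basis" for e
    by (rule integral_by_parts[OF p sets_\<Omega> at f that])
  have int1: "integrable M (\<lambda>x. (a x \<bullet> e) * pd e f x)" if "e \<in> Basis" for e
    by (rule test_integrable[OF sets_\<Omega> test_bilinear1[OF p at test_functionsD(1)[OF test_pd[OF f that]]]])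
  have int2: "integrable M (\<lambda>x. (pd e a x \<bullet> e) * f x)" if "e \<in> Basis" for e
    by (rule test_integrable[OF sets_\<Omega> test_bilinear1[OF p test_pd[OF at that] test_functionsD(1)[OF f]]])
  have "(LINT x|M. a x \<bullet> gradient f x) = (LINT x|M. (\<Sum>e\<in>Basis. (a x \<bullet> e) * pd e f x))"
    by (simp add: gradient_def inner_sum_right mult.commute)
  also have "\<dots> = (\<Sum>e\<in>Basis. LINT x|M. (a x \<bullet> e) * pd e f x)"
    by (rule Bochner_Integration.integral_sum[OF int1])
  also have "\<dots> = - (\<Sum>e\<in>Basis. LINT x|M. (pd e a x \<bullet> e) * f x)"
    by (simp add: parts sum_negf)
  also have "(\<Sum>e\<in>Basis. LINT x|M. (pd e a x \<bullet> e) * f x) = (LINT x|M. (\<Sum>e\<in>Basis. (pd e a x \<bullet> e) * f x))"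
    by (rule Bochner_Integration.integral_sum[OF int2, symmetric])
  also have "(\<lambda>x. (\<Sum>e\<in>Basis. (pd e a x \<bullet> e) * f x)) = (\<lambda>x. 0)"
    using a by (auto simp: solenoidal_tests_def divergence_def simp flip: sum_distrib_right)
  finally show ?thesis by simp
qed

end

text \<open>What the estimates retain of the arc and its conformal map: a bounded measurable
  background that is weakly free of divergence. The property \<open>v_div\<close> is later obtained
  from the existence of a solution instead of a computation with \<open>H_field\<close>.\<close>

locale ns_setting = step_domain +
  fixes v :: "complex \<Rightarrow> complex" and Mv \<nu> :: real
  assumes v_measurable: "v \<in> borel_measurable (lebesgue_on \<Omega>)"
    and v_bound: "x \<in> \<Omega> \<Longrightarrow> norm (v x) \<le> Mv" and Mv_nonneg: "0 \<le> Mv"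
    and \<nu>_pos: "0 < \<nu>"
    and v_div: "\<And>f :: complex \<Rightarrow> real. f \<in> test_functions \<Omega> \<Longrightarrow> (LINT x|lebesgue_on \<Omega>. v x \<bullet> gradient f x) = 0"
begin

abbreviation "grad_nrm f \<equiv> nrm M (gradpair f)"

lemma gradpair_sqi:
  fixes f :: "complex \<Rightarrow> complex"
  assumes "f \<in> test_functions \<Omega>"
  shows "sqi M (gradpair f)" "(grad_nrm f)\<^sup>2 = (nrm M (pd 1 f))\<^sup>2 + (nrm M (pd \<i> f))\<^sup>2"
    "(grad_nrm f)\<^sup>2 = grad_sq \<Omega> f" "(H1_norm \<Omega> f)\<^sup>2 = (nrm M f)\<^sup>2 + (grad_nrm f)\<^sup>2" "grad_nrm f \<le> H1_norm \<Omega> f"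
proof -
  have s: "sqi M (pd 1 f)" "sqi M (pd \<i> f)" using sqi_test test_pd[OF assms] Basis_complex_mem by auto
  have n: "(norm (gradpair f x))\<^sup>2 = (norm (pd 1 f x))\<^sup>2 + (norm (pd \<i> f x))\<^sup>2" for x
    by (simp add: gradpair_def norm_prod_def)
  have m: "gradpair f \<in> borel_measurable M" unfolding gradpair_def[abs_def]
    using s[THEN sqi_measurable] by (rule borel_measurable_Pair)
  then show "sqi M (gradpair f)" unfolding sqi_def n using s by (simp add: sqi_integrable)
  show 1: "(grad_nrm f)\<^sup>2 = (nrm M (pd 1 f))\<^sup>2 + (nrm M (pd \<i> f))\<^sup>2"
    unfolding nrm_sq n using s by (simp add: sqi_integrable)
  then show "(grad_nrm f)\<^sup>2 = grad_sq \<Omega> f" by (simp add: grad_sq_def Basis_complex_def)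
  show 2: "(H1_norm \<Omega> f)\<^sup>2 = (nrm M f)\<^sup>2 + (grad_nrm f)\<^sup>2"
    using 1 test_H1_norm[OF assms] by (simp add: Basis_complex_def)
  show "grad_nrm f \<le> H1_norm \<Omega> f" by (rule power2_le_imp_le) (use 2 H1_norm_nonneg in simp_all)
qed

lemma advect_measurable:
  fixes f :: "complex \<Rightarrow> complex"
  assumes "a \<in> borel_measurable M" "f \<in> test_functions \<Omega>"
  shows "advect a f \<in> borel_measurable M"
proof -
  have "pd 1 f \<in> borel_measurable M" "pd \<i> f \<in> borel_measurable M"
    using sqi_test test_pd[OF assms(2)] Basis_complex_mem sqi_measurable by blast+
  then show ?thesis unfolding advect_complex using measurable_Re_Im[OF assms(1)] by measurable
qed

lemma advect_sqi:
  fixes f :: "complex \<Rightarrow> complex"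
  assumes "sqi M a" "f \<in> test_functions \<Omega>"
  shows "sqi M (advect a f)"
proof -
  obtain B1 where B1: "\<And>x. norm (pd 1 f x) \<le> B1" using test_bounded[OF test_pd[OF assms(2) Basis_complex_mem(1)]] by blast
  obtain B2 where B2: "\<And>x. norm (pd \<i> f x) \<le> B2" using test_bounded[OF test_pd[OF assms(2) Basis_complex_mem(2)]] by blast
  show ?thesis
  proof (rule sqi_bounded_by[OF assms(1) advect_measurable[OF sqi_measurable[OF assms(1)] assms(2)]])
    fix x
    have "norm (gradpair f x) \<le> B1 + B2"
      unfolding gradpair_def using norm_Pair_le[of "pd 1 f x" "pd \<i> f x"] B1[of x] B2[of x] by linarith
    then show "norm (advect a f x) \<le> (B1 + B2) * norm (a x)"
      using norm_advect_le[of a f x] mult_left_mono[of "norm (gradpair f x)" "B1 + B2" "norm (a x)"] by (simp add: mult.commute)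
  qed
qed

lemma advect_v_sqi:
  fixes f :: "complex \<Rightarrow> complex"
  assumes "f \<in> test_functions \<Omega>"
  shows "sqi M (advect v f)" "nrm M (advect v f) \<le> Mv * grad_nrm f"
proof -
  have b: "norm (advect v f x) \<le> Mv * norm (gradpair f x)" if "x \<in> space M" for x
    using norm_advect_le[of v f x] mult_right_mono[OF v_bound[of x], of "norm (gradpair f x)"] that by auto
  note m = advect_measurable[OF v_measurable assms]
  show "sqi M (advect v f)" by (rule sqi_bounded_by[OF gradpair_sqi(1)[OF assms] m b])
  show "nrm M (advect v f) \<le> Mv * grad_nrm f" by (rule nrm_le_bounded_by[OF gradpair_sqi(1)[OF assms] m b Mv_nonneg])
qed

subsection \<open>The transport terms\<close>

lemma advect_self:
  fixes w :: "complex \<Rightarrow> complex"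
  assumes "w \<in> test_functions \<Omega>"
  shows "a x \<bullet> gradient (\<lambda>x. (norm (w x))\<^sup>2) x = 2 * (advect a w x \<bullet> w x)"
  unfolding inner_gradient advect_complex pd_norm_sq[OF test_functionsD(4)[OF assms]]
  by (simp add: inner_add_left inner_commute[of "w x"] algebra_simps)

text \<open>The integrand is half the derivative of \<open>|w|^2\<close> along a field without
  divergence.\<close>

lemma transport_a:
  fixes w :: "complex \<Rightarrow> complex"
  shows "a \<in> solenoidal_tests \<Omega> \<Longrightarrow> w \<in> test_functions \<Omega> \<Longrightarrow> ip M (advect a w) w = 0"
  using integral_div_free[OF _ test_norm_sq, of a w] unfolding ip_def by (simp add: advect_self[of w a])

lemma transport_v:
  fixes w :: "complex \<Rightarrow> complex"
  shows "w \<in> test_functions \<Omega> \<Longrightarrow> ip M (advect v w) w = 0"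
  using v_div[OF test_norm_sq, of w] unfolding ip_def by (simp add: advect_self[of w v])

text \<open>The derivative of the scalar product of \<open>w\<close> and \<open>b\<close> along the
  solenoidal field \<open>w\<close> integrates to zero. The exchange puts the derivative on
  \<open>b\<close>, whose gradient can be charged to the Gronwall weight.\<close>

lemma transport_swap:
  assumes w: "w \<in> solenoidal_tests \<Omega>" and b: "b \<in> test_functions \<Omega>"
  shows "ip M (advect w w) b = - ip M (advect w b) w"
proof -
  note wt = sol_test[OF w]
  have eq: "w x \<bullet> gradient (\<lambda>x. w x \<bullet> b x) x = advect w w x \<bullet> b x + advect w b x \<bullet> w x" for x
    unfolding inner_gradient advect_complex
      pd_bilinear[OF bounded_bilinear_inner test_functionsD(4)[OF wt] test_functionsD(4)[OF b]]
    by (simp add: inner_add_left inner_commute[of "w x"] algebra_simps)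
  have "(LINT x|M. w x \<bullet> gradient (\<lambda>x. w x \<bullet> b x) x) = 0"
    by (rule integral_div_free[OF w test_inner[OF wt test_functionsD(1)[OF b]]])
  moreover have "integrable M (\<lambda>x. advect w w x \<bullet> b x)" "integrable M (\<lambda>x. advect w b x \<bullet> w x)"
    by (intro sqi_ip_integrable advect_sqi sqi_test wt b)+
  ultimately show ?thesis unfolding eq ip_def by simp
qed

text \<open>\<open>2 x y \<le> x^2 + y^2\<close> reduces the squared product to half the sum of the
  fourth powers; the constant 2 in \<open>ladyzhenskaya\<close> cancels this half. Stating the bound
  as a sum keeps square roots of norms out of all later estimates.\<close>

lemma sqi_product:
  fixes a w :: "complex \<Rightarrow> complex"
  assumes a: "a \<in> test_functions \<Omega>" and w: "w \<in> test_functions \<Omega>"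
  shows "sqi M (\<lambda>x. norm (a x) * norm (w x))"
    and "nrm M (\<lambda>x. norm (a x) * norm (w x)) \<le> nrm M a * grad_nrm a + nrm M w * grad_nrm w"
proof -
  have m: "a \<in> borel_measurable M" "w \<in> borel_measurable M" using sqi_measurable sqi_test a w by blast+
  have q: "integrable M (\<lambda>x. (norm (f x))^4)" if "f \<in> test_functions \<Omega>" for f :: "complex \<Rightarrow> complex"
    using test_integrable[OF sets_\<Omega> test_norm_sq[OF test_norm_sq[OF that]]] by (simp flip: power_mult)
  have le: "(norm (norm (a x) * norm (w x)))\<^sup>2 \<le> ((norm (a x))^4 + (norm (w x))^4) / 2" for x
    using sum_squares_bound[of "(norm (a x))\<^sup>2" "(norm (w x))\<^sup>2"] by (simp add: power_mult_distrib flip: power_mult)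
  have i: "integrable M (\<lambda>x. ((norm (a x))^4 + (norm (w x))^4) / 2)" using q a w by simp
  have "integrable M (\<lambda>x. (norm (norm (a x) * norm (w x)))\<^sup>2)"
    by (rule Bochner_Integration.integrable_bound[OF i]) (use m le in \<open>auto intro!: AE_I2 borel_measurable_power borel_measurable_norm borel_measurable_times\<close>)
  then show s: "sqi M (\<lambda>x. norm (a x) * norm (w x))"
    unfolding sqi_def using m by (auto intro: borel_measurable_norm borel_measurable_times)
  have lad: "(LINT x|M. (norm (f x))^4) \<le> 2 * (nrm M f * grad_nrm f)\<^sup>2" if "f \<in> test_functions \<Omega>" for f :: "complex \<Rightarrow> complex"
    using ladyzhenskaya[OF sets_\<Omega> that] gradpair_sqi(3)[OF that] by (simp add: power_mult_distrib)
  have "(nrm M (\<lambda>x. norm (a x) * norm (w x)))\<^sup>2 \<le> (LINT x|M. ((norm (a x))^4 + (norm (w x))^4) / 2)"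
    unfolding nrm_sq by (rule integral_mono[OF sqi_integrable[OF s] i le])
  also have "\<dots> = ((LINT x|M. (norm (a x))^4) + (LINT x|M. (norm (w x))^4)) / 2" using q a w by simp
  also have "\<dots> \<le> (nrm M a * grad_nrm a)\<^sup>2 + (nrm M w * grad_nrm w)\<^sup>2" using lad[OF a] lad[OF w] by simp
  also have "\<dots> \<le> (nrm M a * grad_nrm a + nrm M w * grad_nrm w)\<^sup>2" by (simp add: power2_sum)
  finally show "nrm M (\<lambda>x. norm (a x) * norm (w x)) \<le> nrm M a * grad_nrm a + nrm M w * grad_nrm w"
    by (rule power2_le_imp_le) simp
qed

lemma trilinear_bound:
  fixes a w r :: "complex \<Rightarrow> complex"
  assumes a: "a \<in> test_functions \<Omega>" and w: "w \<in> test_functions \<Omega>" and r: "r \<in> test_functions \<Omega>"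
  shows "\<bar>ip M (advect a r) w\<bar> \<le> (nrm M a * grad_nrm a + nrm M w * grad_nrm w) * grad_nrm r"
proof -
  note s = sqi_product(1)[OF a w] gradpair_sqi(1)[OF r]
  have i: "integrable M (\<lambda>x. advect a r x \<bullet> w x)" by (intro sqi_ip_integrable advect_sqi sqi_test a w r)
  have "\<bar>ip M (advect a r) w\<bar> \<le> (LINT x|M. \<bar>advect a r x \<bullet> w x\<bar>)" unfolding ip_def by simp
  also have "\<dots> \<le> (LINT x|M. norm (norm (a x) * norm (w x)) * norm (gradpair r x))"
  proof (rule integral_mono[OF integrable_abs[OF i] sqi_norm_mult_integrable[OF s]])
    fix x
    have "\<bar>advect a r x \<bullet> w x\<bar> \<le> norm (advect a r x) * norm (w x)" by (rule Cauchy_Schwarz_ineq2)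
    also have "\<dots> \<le> (norm (a x) * norm (gradpair r x)) * norm (w x)" by (intro mult_right_mono norm_advect_le) simp
    finally show "\<bar>advect a r x \<bullet> w x\<bar> \<le> norm (norm (a x) * norm (w x)) * norm (gradpair r x)" by (simp add: mult_ac)
  qed
  also have "\<dots> \<le> nrm M (\<lambda>x. norm (a x) * norm (w x)) * grad_nrm r" by (rule nrm_norm_mult_le[OF s])
  also have "\<dots> \<le> (nrm M a * grad_nrm a + nrm M w * grad_nrm w) * grad_nrm r" by (intro mult_right_mono sqi_product(2)[OF a w]) simp
  finally show ?thesis .
qed

lemma v_term_bound:
  fixes w r :: "complex \<Rightarrow> complex"
  assumes w: "w \<in> test_functions \<Omega>" and r: "r \<in> test_functions \<Omega>"
  shows "\<bar>LINT x|M. advect w r x \<bullet> v x\<bar> \<le> Mv * (nrm M w * grad_nrm r)"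
    and "integrable M (\<lambda>x. advect w r x \<bullet> v x)"
proof -
  note s = sqi_test[OF w] gradpair_sqi(1)[OF r]
  have b: "\<bar>advect w r x \<bullet> v x\<bar> \<le> Mv * (norm (w x) * norm (gradpair r x))" if "x \<in> space M" for x
  proof -
    have "\<bar>advect w r x \<bullet> v x\<bar> \<le> norm (advect w r x) * norm (v x)" by (rule Cauchy_Schwarz_ineq2)
    also have "\<dots> \<le> (norm (w x) * norm (gradpair r x)) * Mv"
      using that by (intro mult_mono norm_advect_le v_bound) auto
    finally show ?thesis by (simp add: mult_ac)
  qed
  have ib: "integrable M (\<lambda>x. Mv * (norm (w x) * norm (gradpair r x)))" using sqi_norm_mult_integrable[OF s] by simp
  show i: "integrable M (\<lambda>x. advect w r x \<bullet> v x)"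
  proof (rule Bochner_Integration.integrable_bound[OF ib])
    show "(\<lambda>x. advect w r x \<bullet> v x) \<in> borel_measurable M"
      using advect_measurable[OF sqi_measurable[OF s(1)] r] v_measurable by measurable
    show "AE x in M. norm (advect w r x \<bullet> v x) \<le> norm (Mv * (norm (w x) * norm (gradpair r x)))"
      by (rule AE_I2) (use b in fastforce)
  qed
  have "\<bar>LINT x|M. advect w r x \<bullet> v x\<bar> \<le> (LINT x|M. \<bar>advect w r x \<bullet> v x\<bar>)" by simp
  also have "\<dots> \<le> (LINT x|M. Mv * (norm (w x) * norm (gradpair r x)))"
    by (rule integral_mono[OF integrable_abs[OF i] ib b])
  also have "\<dots> \<le> Mv * (nrm M w * grad_nrm r)" using nrm_norm_mult_le[OF s] Mv_nonneg by (simp add: mult_left_mono)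
  finally show "\<bar>LINT x|M. advect w r x \<bullet> v x\<bar> \<le> Mv * (nrm M w * grad_nrm r)" .
qed

lemma ip_laplacian:
  fixes w r :: "complex \<Rightarrow> complex"
  assumes w: "w \<in> test_functions \<Omega>" and r: "r \<in> test_functions \<Omega>"
  shows "ip M w (laplacian r) = - (\<Sum>e\<in>Basis. ip M (pd e w) (pd e r))"
proof -
  have "ip M w (laplacian r) = (LINT x|M. (\<Sum>e\<in>Basis. w x \<bullet> pd e (pd e r) x))"
    by (simp add: ip_def laplacian_def inner_sum_right)
  also have "\<dots> = (\<Sum>e\<in>Basis. LINT x|M. w x \<bullet> pd e (pd e r) x)"
    by (rule Bochner_Integration.integral_sum) (intro sqi_ip_integrable sqi_test w test_pd r)
  also have "\<dots> = (\<Sum>e\<in>Basis. - ip M (pd e w) (pd e r))"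
    unfolding ip_def by (intro sum.cong refl integral_by_parts[OF bounded_bilinear_inner sets_\<Omega> w] test_pd r)
  finally show ?thesis by (simp add: sum_negf)
qed

lemma ip_laplacian_self:
  fixes w :: "complex \<Rightarrow> complex"
  shows "w \<in> test_functions \<Omega> \<Longrightarrow> ip M w (laplacian w) = - (grad_nrm w)\<^sup>2"
  by (simp add: ip_laplacian gradpair_sqi(2) Basis_complex_def flip: nrm_sq_ip)

lemma ip_laplacian_le:
  fixes w r :: "complex \<Rightarrow> complex"
  assumes w: "w \<in> test_functions \<Omega>" and r: "r \<in> test_functions \<Omega>"
  shows "\<bar>ip M w (laplacian r)\<bar> \<le> grad_nrm w * grad_nrm r"
proof -
  have s: "sqi M (pd e f)" if "e \<in> Basis" "f \<in> test_functions \<Omega>" for e and f :: "complex \<Rightarrow> complex"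
    using sqi_test test_pd that by blast
  have "ip M (gradpair w) (gradpair r) = (\<Sum>e\<in>Basis. ip M (pd e w) (pd e r))"
    using s[OF Basis_complex_mem(1)] s[OF Basis_complex_mem(2)] w r
    by (simp add: Basis_complex_def ip_def gradpair_def sqi_ip_integrable)
  then show ?thesis using ip_laplacian[OF w r] ip_le[OF gradpair_sqi(1)[OF w] gradpair_sqi(1)[OF r]] by simp
qed

end

context ns_setting begin

subsection \<open>The weak form of the equation for a difference of solutions\<close>

text \<open>The right-hand side of the equation for the difference of the solutions
  \<open>a + v\<close> and \<open>b + v\<close>, tested with \<open>\<phi>\<close>. All derivatives
  sit on \<open>\<phi>\<close>, so square integrable \<open>a\<close> and \<open>b\<close> are
  enough. With \<open>b = 0\<close> it also expresses, up to terms in \<open>v\<close> alone, the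
  equation of a single solution.\<close>

definition ns_form :: "(complex \<Rightarrow> complex) \<Rightarrow> (complex \<Rightarrow> complex) \<Rightarrow> (complex \<Rightarrow> complex) \<Rightarrow> real" where
  "ns_form a b \<phi> = (LINT x|M. advect (\<lambda>x. a x + v x) \<phi> x \<bullet> (a x + v x))
     - (LINT x|M. advect (\<lambda>x. b x + v x) \<phi> x \<bullet> (b x + v x)) + \<nu> * ip M (\<lambda>x. a x - b x) (laplacian \<phi>)"

text \<open>The background field decays only like the inverse of the distance, so it is cut off to the
  support of the test function to make the products square integrable.\<close>

definition vloc :: "(complex \<Rightarrow> complex) \<Rightarrow> complex \<Rightarrow> complex" where
  "vloc \<phi> x = indicator (supp \<phi>) x *\<^sub>R v x"

lemma vloc_sqi:
  assumes "\<phi> \<in> test_functions \<Omega>" shows "sqi M (vloc \<phi>)"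
proof (rule sqi_bounded_by)
  have c: "compact (supp \<phi>)" by (rule test_functionsD(2)[OF assms])
  then have b: "supp \<phi> \<in> sets borel" by (intro borel_closed compact_imp_closed)
  have "integrable lborel (indicator (supp \<phi>) :: complex \<Rightarrow> real)"
    by (intro integrable_real_indicator) (use b emeasure_compact_finite[OF c] in auto)
  then have i: "integrable M (indicator (supp \<phi>) :: complex \<Rightarrow> real)"
    by (rule integrable_lebesgue_on_if_lborel[OF sets_\<Omega>])
  then show "sqi M (indicator (supp \<phi>) :: complex \<Rightarrow> real)"
    unfolding sqi_def by (auto simp: power2_eq_square simp flip: indicator_inter_arith)
  show "vloc \<phi> \<in> borel_measurable M" unfolding vloc_def
    by (intro borel_measurable_scaleR borel_measurable_integrable[OF i] v_measurable)
  show "norm (vloc \<phi> x) \<le> Mv * norm (indicator (supp \<phi>) x :: real)" if "x \<in> space M" for x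
    unfolding vloc_def using that v_bound[of x] by (simp add: mult_left_mono mult.commute[of Mv])
qed

lemma advect_vloc:
  "advect (\<lambda>x. a x + v x) \<phi> x \<bullet> (a x + v x) = advect (\<lambda>x. a x + vloc \<phi> x) \<phi> x \<bullet> (a x + vloc \<phi> x)"
proof (cases "x \<in> supp \<phi>")
  case True then show ?thesis by (simp add: advect_complex vloc_def)
next
  case False
  then have "pd e \<phi> x = 0" for e by (rule pd_zero_outside_supp)
  then show ?thesis by (simp add: advect_complex)
qed

lemma ns_form_integrable:
  assumes "sqi M a" "\<phi> \<in> test_functions \<Omega>"
  shows "integrable M (\<lambda>x. advect (\<lambda>x. a x + v x) \<phi> x \<bullet> (a x + v x))"
  unfolding advect_vloc by (intro sqi_ip_integrable advect_sqi sqi_add vloc_sqi assms)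

lemma ns_form_vloc: "ns_form a b \<phi> = ip M (advect (\<lambda>x. a x + vloc \<phi> x) \<phi>) (\<lambda>x. a x + vloc \<phi> x)
     - ip M (advect (\<lambda>x. b x + vloc \<phi> x) \<phi>) (\<lambda>x. b x + vloc \<phi> x) + \<nu> * ip M (\<lambda>x. a x - b x) (laplacian \<phi>)"
  unfolding ns_form_def advect_vloc ip_def ..

lemma advect_bound:
  fixes \<phi> :: "complex \<Rightarrow> complex"
  assumes "\<phi> \<in> test_functions \<Omega>"
  obtains B where "B \<ge> 0" "\<And>a. sqi M a \<Longrightarrow> nrm M (advect a \<phi>) \<le> B * nrm M a"
proof -
  obtain B1 where B1: "B1 \<ge> 0" "\<And>x. norm (pd 1 \<phi> x) \<le> B1" using test_bounded[OF test_pd[OF assms Basis_complex_mem(1)]] by blast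
  obtain B2 where B2: "B2 \<ge> 0" "\<And>x. norm (pd \<i> \<phi> x) \<le> B2" using test_bounded[OF test_pd[OF assms Basis_complex_mem(2)]] by blast
  show ?thesis
  proof (rule that[of "B1 + B2"])
    fix a :: "complex \<Rightarrow> complex" assume a: "sqi M a"
    show "nrm M (advect a \<phi>) \<le> (B1 + B2) * nrm M a"
    proof (rule nrm_le_bounded_by[OF a advect_measurable[OF sqi_measurable[OF a] assms]])
      fix x
      have "norm (gradpair \<phi> x) \<le> B1 + B2"
        unfolding gradpair_def using norm_Pair_le[of "pd 1 \<phi> x" "pd \<i> \<phi> x"] B1(2)[of x] B2(2)[of x] by linarith
      then show "norm (advect a \<phi> x) \<le> (B1 + B2) * norm (a x)"
        using norm_advect_le[of a \<phi> x] mult_left_mono[of "norm (gradpair \<phi> x)" "B1 + B2" "norm (a x)"] by (simp add: mult.commute)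
    qed (use B1 B2 in simp)
  qed (use B1 B2 in simp)
qed

text \<open>An arbitrary filter, together with a set \<open>I\<close> on which integrability is
  known, lets the same lemma serve sequences and limits in time restricted to
  \<open>t \<ge> 0\<close>.\<close>

lemma ip_tendsto:
  assumes a: "\<And>s. s \<in> I \<Longrightarrow> sqi M (a s)" "sqi M a0" "((\<lambda>s. nrm M (\<lambda>x. a s x - a0 x)) \<longlongrightarrow> 0) F"
    and c: "\<And>s. s \<in> I \<Longrightarrow> sqi M (c s)" "sqi M c0" "((\<lambda>s. nrm M (\<lambda>x. c s x - c0 x)) \<longlongrightarrow> 0) F"
    and I: "\<forall>\<^sub>F s in F. s \<in> I"
  shows "((\<lambda>s. ip M (a s) (c s)) \<longlongrightarrow> ip M a0 c0) F"
proof -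
  have "((\<lambda>s. ip M (a s) (c s) - ip M a0 c0) \<longlongrightarrow> 0) F"
  proof (rule Lim_null_comparison)
    let ?da = "\<lambda>s. nrm M (\<lambda>x. a s x - a0 x)" and ?dc = "\<lambda>s. nrm M (\<lambda>x. c s x - c0 x)"
    show "\<forall>\<^sub>F s in F. norm (ip M (a s) (c s) - ip M a0 c0) \<le> ?da s * (nrm M c0 + ?dc s) + nrm M a0 * ?dc s"
      using I
    proof eventually_elim
      fix s assume s: "s \<in> I"
      note q = a(1)[OF s] c(1)[OF s]
      have "ip M (a s) (c s) - ip M a0 c0 = ip M (\<lambda>x. a s x - a0 x) (c s) + ip M a0 (\<lambda>x. c s x - c0 x)"
        using q a(2) c(2) by (simp add: ip_diff_left ip_diff_right)
      moreover have "\<bar>ip M (\<lambda>x. a s x - a0 x) (c s)\<bar> \<le> ?da s * nrm M (c s)"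
        by (intro ip_le sqi_diff q a(2))
      moreover have "nrm M (c s) \<le> nrm M c0 + ?dc s" using nrm_diff_abs[OF q(2) c(2)] by linarith
      then have "?da s * nrm M (c s) \<le> ?da s * (nrm M c0 + ?dc s)" by (rule mult_left_mono) simp
      moreover have "\<bar>ip M a0 (\<lambda>x. c s x - c0 x)\<bar> \<le> nrm M a0 * ?dc s"
        by (intro ip_le sqi_diff q a(2) c(2))
      ultimately show "norm (ip M (a s) (c s) - ip M a0 c0) \<le> ?da s * (nrm M c0 + ?dc s) + nrm M a0 * ?dc s"
        unfolding real_norm_def by linarith
    qed
    have "((\<lambda>s. ?da s * (nrm M c0 + ?dc s) + nrm M a0 * ?dc s) \<longlongrightarrow> 0 * (nrm M c0 + 0) + nrm M a0 * 0) F"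
      by (intro tendsto_intros a c)
    then show "((\<lambda>s. ?da s * (nrm M c0 + ?dc s) + nrm M a0 * ?dc s) \<longlongrightarrow> 0) F" by simp
  qed
  then show ?thesis by (rule LIM_zero_cancel)
qed

text \<open>Convergence in L^2 is enough because the derivatives of \<open>\<phi>\<close> are
  bounded. This yields continuity in time for solutions in C([0,oo); H), and also the passage from
  test fields to elements of V.\<close>

lemma ns_form_tendsto:
  assumes \<phi>: "\<phi> \<in> test_functions \<Omega>"
    and a: "\<And>s. s \<in> I \<Longrightarrow> sqi M (a s)" "sqi M a0" "((\<lambda>s. nrm M (\<lambda>x. a s x - a0 x)) \<longlongrightarrow> 0) F"
    and b: "\<And>s. s \<in> I \<Longrightarrow> sqi M (b s)" "sqi M b0" "((\<lambda>s. nrm M (\<lambda>x. b s x - b0 x)) \<longlongrightarrow> 0) F"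
    and I: "\<forall>\<^sub>F s in F. s \<in> I"
  shows "((\<lambda>s. ns_form (a s) (b s) \<phi>) \<longlongrightarrow> ns_form a0 b0 \<phi>) F"
proof -
  note v = vloc_sqi[OF \<phi>]
  obtain B where B: "B \<ge> 0" "\<And>a. sqi M a \<Longrightarrow> nrm M (advect a \<phi>) \<le> B * nrm M a"
    using advect_bound[OF \<phi>] by blast
  have *: "((\<lambda>s. ip M (advect (\<lambda>x. c s x + vloc \<phi> x) \<phi>) (\<lambda>x. c s x + vloc \<phi> x)) \<longlongrightarrow>
      ip M (advect (\<lambda>x. c0 x + vloc \<phi> x) \<phi>) (\<lambda>x. c0 x + vloc \<phi> x)) F"
    if c: "\<And>s. s \<in> I \<Longrightarrow> sqi M (c s)" "sqi M c0" "((\<lambda>s. nrm M (\<lambda>x. c s x - c0 x)) \<longlongrightarrow> 0) F" for c c0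
  proof (rule ip_tendsto[where I = I])
    show "((\<lambda>s. nrm M (\<lambda>x. c s x + vloc \<phi> x - (c0 x + vloc \<phi> x))) \<longlongrightarrow> 0) F" using c(3) by simp
    show "((\<lambda>s. nrm M (\<lambda>x. advect (\<lambda>x. c s x + vloc \<phi> x) \<phi> x - advect (\<lambda>x. c0 x + vloc \<phi> x) \<phi> x)) \<longlongrightarrow> 0) F"
    proof (rule Lim_null_comparison)
      have eq: "(\<lambda>x. advect (\<lambda>x. c s x + vloc \<phi> x) \<phi> x - advect (\<lambda>x. c0 x + vloc \<phi> x) \<phi> x) = advect (\<lambda>x. c s x - c0 x) \<phi>" for s
        by (rule ext) (simp add: advect_complex algebra_simps)
      show "\<forall>\<^sub>F s in F. norm (nrm M (\<lambda>x. advect (\<lambda>x. c s x + vloc \<phi> x) \<phi> x - advect (\<lambda>x. c0 x + vloc \<phi> x) \<phi> x))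
          \<le> B * nrm M (\<lambda>x. c s x - c0 x)"
        using I unfolding eq by eventually_elim (simp add: B(2) sqi_diff c)
      show "((\<lambda>s. B * nrm M (\<lambda>x. c s x - c0 x)) \<longlongrightarrow> 0) F" using tendsto_mult_left[OF c(3), of B] by simp
    qed
  qed (auto intro!: advect_sqi sqi_add v c \<phi> I)
  have "((\<lambda>s. ip M (\<lambda>x. a s x - b s x) (laplacian \<phi>)) \<longlongrightarrow> ip M (\<lambda>x. a0 x - b0 x) (laplacian \<phi>)) F"
  proof (rule ip_tendsto[where I = I])
    show "((\<lambda>s. nrm M (\<lambda>x. a s x - b s x - (a0 x - b0 x))) \<longlongrightarrow> 0) F"
    proof (rule Lim_null_comparison)
      show "\<forall>\<^sub>F s in F. norm (nrm M (\<lambda>x. a s x - b s x - (a0 x - b0 x))) \<le> nrm M (\<lambda>x. a s x - a0 x) + nrm M (\<lambda>x. b s x - b0 x)"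
        using I
      proof eventually_elim
        fix s assume s: "s \<in> I"
        have "(\<lambda>x. a s x - b s x - (a0 x - b0 x)) = (\<lambda>x. (a s x - a0 x) - (b s x - b0 x))" by (auto simp: algebra_simps)
        then show "norm (nrm M (\<lambda>x. a s x - b s x - (a0 x - b0 x))) \<le> nrm M (\<lambda>x. a s x - a0 x) + nrm M (\<lambda>x. b s x - b0 x)"
          using nrm_triangle_diff[OF sqi_diff[OF a(1)[OF s] a(2)] sqi_diff[OF b(1)[OF s] b(2)]] by simp
      qed
      show "((\<lambda>s. nrm M (\<lambda>x. a s x - a0 x) + nrm M (\<lambda>x. b s x - b0 x)) \<longlongrightarrow> 0) F"
        using tendsto_add[OF a(3) b(3)] by simp
    qed
  qed (use sqi_diff[OF a(1) b(1)] sqi_diff[OF a(2) b(2)] sqi_test[OF test_laplacian[OF \<phi>]] I in \<open>simp_all add: nrm_def\<close>)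
  then show ?thesis unfolding ns_form_vloc by (intro tendsto_intros * a b)
qed

lemma pd_diff: "f differentiable at x \<Longrightarrow> g differentiable at x \<Longrightarrow>
    pd e (\<lambda>x. f x - g x) x = pd e f x - pd e g x"
  unfolding pd_def[of e f] pd_def[of e g]
  by (rule pd_eq[OF has_derivative_diff]) (auto simp: frechet_derivative_works)

lemma test_diff_ops:
  fixes \<phi> \<psi> :: "complex \<Rightarrow> complex"
  assumes "\<phi> \<in> test_functions \<Omega>" "\<psi> \<in> test_functions \<Omega>"
  shows "pd e (\<lambda>x. \<phi> x - \<psi> x) = (\<lambda>x. pd e \<phi> x - pd e \<psi> x)"
    and "advect u (\<lambda>x. \<phi> x - \<psi> x) x = advect u \<phi> x - advect u \<psi> x"
    and "laplacian (\<lambda>x. \<phi> x - \<psi> x) = (\<lambda>x. laplacian \<phi> x - laplacian \<psi> x)"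
    and "gradpair (\<lambda>x. \<phi> x - \<psi> x) = (\<lambda>x. gradpair \<phi> x - gradpair \<psi> x)"
proof -
  have p: "pd e (\<lambda>x. \<phi> x - \<psi> x) = (\<lambda>x. pd e \<phi> x - pd e \<psi> x)"
    if "\<phi> \<in> test_functions \<Omega>" "\<psi> \<in> test_functions \<Omega>" for e and \<phi> \<psi> :: "complex \<Rightarrow> complex"
    by (intro ext pd_diff test_functionsD(4)[OF that(1)] test_functionsD(4)[OF that(2)])
  show "pd e (\<lambda>x. \<phi> x - \<psi> x) = (\<lambda>x. pd e \<phi> x - pd e \<psi> x)" by (rule p[OF assms])
  show "advect u (\<lambda>x. \<phi> x - \<psi> x) x = advect u \<phi> x - advect u \<psi> x"
    unfolding advect_complex p[OF assms] by (simp add: algebra_simps)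
  show "laplacian (\<lambda>x. \<phi> x - \<psi> x) = (\<lambda>x. laplacian \<phi> x - laplacian \<psi> x)"
    unfolding laplacian_def p[OF assms]
    by (rule ext) (simp add: p test_pd assms sum_subtractf)
  show "gradpair (\<lambda>x. \<phi> x - \<psi> x) = (\<lambda>x. gradpair \<phi> x - gradpair \<psi> x)"
    unfolding gradpair_def[abs_def] p[OF assms] by simp
qed

lemma ns_form_diff:
  assumes "sqi M a" "sqi M b" "\<phi> \<in> test_functions \<Omega>" "\<psi> \<in> test_functions \<Omega>"
  shows "ns_form a b (\<lambda>x. \<phi> x - \<psi> x) = ns_form a b \<phi> - ns_form a b \<psi>"
proof -
  have l: "sqi M (laplacian \<phi>)" "sqi M (laplacian \<psi>)" "sqi M (\<lambda>x. a x - b x)"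
    using assms by (auto intro: sqi_test test_laplacian sqi_diff)
  have "(LINT x|M. advect (\<lambda>x. c x + v x) (\<lambda>x. \<phi> x - \<psi> x) x \<bullet> (c x + v x)) =
      (LINT x|M. advect (\<lambda>x. c x + v x) \<phi> x \<bullet> (c x + v x)) - (LINT x|M. advect (\<lambda>x. c x + v x) \<psi> x \<bullet> (c x + v x))"
    if "sqi M c" for c
    using ns_form_integrable[OF that assms(3)] ns_form_integrable[OF that assms(4)]
    unfolding test_diff_ops(2)[OF assms(3,4)] by (simp add: inner_diff_left)
  then show ?thesis using assms(1,2) l
    by (simp add: ns_form_def test_diff_ops(3)[OF assms(3,4)] ip_diff_right algebra_simps)
qed

text \<open>With \<open>U = a + v\<close> and \<open>V = b + v\<close> the quadratic terms differ by
  \<open>U (U - V) + (U - V) V\<close>, and \<open>U - V = w\<close>. The pairing with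
  \<open>v\<close> is an integral instead of an \<open>ip\<close> bound because \<open>v\<close>
  need not be square integrable.\<close>

lemma ns_form_decomp:
  assumes a: "a \<in> test_functions \<Omega>" and b: "b \<in> test_functions \<Omega>" and \<phi>: "\<phi> \<in> test_functions \<Omega>"
  defines "w \<equiv> \<lambda>x. a x - b x"
  shows "ns_form a b \<phi> = ip M (advect a \<phi>) w + ip M (advect v \<phi>) w + ip M (advect w \<phi>) b
    + (LINT x|M. advect w \<phi> x \<bullet> v x) + \<nu> * ip M w (laplacian \<phi>)"
proof -
  have w: "w \<in> test_functions \<Omega>" unfolding w_def by (rule test_diff[OF a b])
  note s = sqi_test[OF a] sqi_test[OF b] sqi_test[OF w]
  have i1: "integrable M (\<lambda>x. advect a \<phi> x \<bullet> w x)" "integrable M (\<lambda>x. advect w \<phi> x \<bullet> b x)"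
    by (intro sqi_ip_integrable advect_sqi s \<phi>)+
  have i2: "integrable M (\<lambda>x. advect v \<phi> x \<bullet> w x)" by (rule sqi_ip_integrable[OF advect_v_sqi(1)[OF \<phi>] s(3)])
  note i3 = v_term_bound(2)[OF w \<phi>]
  have eq: "advect (\<lambda>x. a x + v x) \<phi> x \<bullet> (a x + v x) - advect (\<lambda>x. b x + v x) \<phi> x \<bullet> (b x + v x)
    = advect a \<phi> x \<bullet> w x + advect v \<phi> x \<bullet> w x + advect w \<phi> x \<bullet> b x + advect w \<phi> x \<bullet> v x" for x
    unfolding advect_complex w_def by (simp add: inner_add_left inner_add_right inner_diff_left inner_diff_right algebra_simps)
  have "(LINT x|M. advect (\<lambda>x. a x + v x) \<phi> x \<bullet> (a x + v x)) - (LINT x|M. advect (\<lambda>x. b x + v x) \<phi> x \<bullet> (b x + v x))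
    = (LINT x|M. advect a \<phi> x \<bullet> w x + advect v \<phi> x \<bullet> w x + advect w \<phi> x \<bullet> b x + advect w \<phi> x \<bullet> v x)"
    unfolding eq[symmetric] by (rule Bochner_Integration.integral_diff[symmetric]; rule ns_form_integrable[OF _ \<phi>]; rule s)
  also have "\<dots> = ip M (advect a \<phi>) w + ip M (advect v \<phi>) w + ip M (advect w \<phi>) b + (LINT x|M. advect w \<phi> x \<bullet> v x)"
    unfolding ip_def using i1 i2 i3 by simp
  finally show ?thesis unfolding ns_form_def w_def by simp
qed

lemma grad_nrm_diff: "a \<in> test_functions \<Omega> \<Longrightarrow> b \<in> test_functions \<Omega> \<Longrightarrow> grad_nrm (\<lambda>x. a x - b x) \<le> grad_nrm a + grad_nrm b"
  for a b :: "complex \<Rightarrow> complex"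
  using nrm_triangle_diff[OF gradpair_sqi(1) gradpair_sqi(1), of a b] by (simp add: test_diff_ops)

text \<open>With \<open>|w| \<le> 2 R\<close> each of the two trilinear terms contributes
  \<open>3 R\<close>, each of the two terms containing \<open>v\<close> contributes
  \<open>2 * Mv * R\<close>, and the viscous term contributes \<open>\<nu>\<close>.\<close>

definition dual_const :: "real \<Rightarrow> real" where "dual_const R = 6 * R + \<nu> + 4 * Mv * R"
text \<open>The denominator comes from completing the square against the viscosity; the numerator
  comes from \<open>(2 x + Mv)^2 \<le> 8 x^2 + 2 Mv^2\<close>.\<close>

definition growth_const :: real where "growth_const = (8 + 2 * Mv\<^sup>2) / (4 * \<nu>)"

lemma dual_const_nonneg: "R \<ge> 0 \<Longrightarrow> dual_const R \<ge> 0"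
  using \<nu>_pos Mv_nonneg by (simp add: dual_const_def)

lemma growth_const_nonneg: "growth_const \<ge> 0"
  using \<nu>_pos by (simp add: growth_const_def)

lemma ns_form_bound:
  assumes a: "a \<in> test_functions \<Omega>" and b: "b \<in> test_functions \<Omega>" and r: "r \<in> test_functions \<Omega>"
    and R: "nrm M a \<le> R" "nrm M b \<le> R"
  shows "\<bar>ns_form a b r\<bar> \<le> dual_const R * (1 + grad_nrm a + grad_nrm b) * grad_nrm r"
proof -
  define w where "w = (\<lambda>x. a x - b x)"
  have w: "w \<in> test_functions \<Omega>" unfolding w_def by (rule test_diff[OF a b])
  have R0: "R \<ge> 0" using R(1) nrm_nonneg[of M a] by linarith
  have nw: "nrm M w \<le> 2 * R" using nrm_triangle_diff[OF sqi_test[OF a] sqi_test[OF b]] R by (simp add: w_def)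
  have gw: "grad_nrm w \<le> grad_nrm a + grad_nrm b" unfolding w_def by (rule grad_nrm_diff[OF a b])
  have g0: "0 \<le> grad_nrm a" "0 \<le> grad_nrm b" "0 \<le> grad_nrm w" "0 \<le> grad_nrm r" by simp_all
  have p: "nrm M a * grad_nrm a \<le> R * grad_nrm a" "nrm M b * grad_nrm b \<le> R * grad_nrm b" by (intro mult_right_mono R g0)+
  have pw: "nrm M w * grad_nrm w \<le> 2 * R * (grad_nrm a + grad_nrm b)" using nw gw R0 by (intro mult_mono) auto
  have "\<bar>ip M (advect a r) w\<bar> \<le> (nrm M a * grad_nrm a + nrm M w * grad_nrm w) * grad_nrm r" by (rule trilinear_bound[OF a w r])
  also have "\<dots> \<le> (3 * R * (grad_nrm a + grad_nrm b)) * grad_nrm r"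
    using p pw R0 by (intro mult_right_mono) (auto simp: algebra_simps intro: order_trans[OF add_mono])
  finally have 1: "\<bar>ip M (advect a r) w\<bar> \<le> (3 * R * (grad_nrm a + grad_nrm b)) * grad_nrm r" .
  have "\<bar>ip M (advect w r) b\<bar> \<le> (nrm M w * grad_nrm w + nrm M b * grad_nrm b) * grad_nrm r" by (rule trilinear_bound[OF w b r])
  also have "\<dots> \<le> (3 * R * (grad_nrm a + grad_nrm b)) * grad_nrm r"
    using p pw R0 by (intro mult_right_mono) (auto simp: algebra_simps intro: order_trans[OF add_mono])
  finally have 2: "\<bar>ip M (advect w r) b\<bar> \<le> (3 * R * (grad_nrm a + grad_nrm b)) * grad_nrm r" .
  have "\<bar>ip M (advect v r) w\<bar> \<le> nrm M (advect v r) * nrm M w" by (rule ip_le[OF advect_v_sqi(1)[OF r] sqi_test[OF w]])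
  also have "\<dots> \<le> (Mv * grad_nrm r) * (2 * R)"
    using advect_v_sqi(2)[OF r] nw Mv_nonneg by (intro mult_mono) auto
  finally have 3: "\<bar>ip M (advect v r) w\<bar> \<le> (2 * Mv * R) * grad_nrm r" by (simp add: mult_ac)
  have "\<bar>LINT x|M. advect w r x \<bullet> v x\<bar> \<le> Mv * (nrm M w * grad_nrm r)" by (rule v_term_bound(1)[OF w r])
  also have "\<dots> \<le> Mv * ((2 * R) * grad_nrm r)" using nw Mv_nonneg by (intro mult_left_mono mult_right_mono) auto
  finally have 4: "\<bar>LINT x|M. advect w r x \<bullet> v x\<bar> \<le> (2 * Mv * R) * grad_nrm r" by (simp add: mult_ac)
  have "\<bar>\<nu> * ip M w (laplacian r)\<bar> \<le> \<nu> * (grad_nrm w * grad_nrm r)"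
    using ip_laplacian_le[OF w r] \<nu>_pos by (simp add: abs_mult)
  also have "\<dots> \<le> \<nu> * ((grad_nrm a + grad_nrm b) * grad_nrm r)" using gw \<nu>_pos by (intro mult_left_mono mult_right_mono) auto
  finally have 5: "\<bar>\<nu> * ip M w (laplacian r)\<bar> \<le> (\<nu> * (grad_nrm a + grad_nrm b)) * grad_nrm r" by (simp add: mult_ac)
  have "\<bar>ns_form a b r\<bar> \<le> (6 * R * (grad_nrm a + grad_nrm b)) * grad_nrm r + (4 * Mv * R) * grad_nrm r + (\<nu> * (grad_nrm a + grad_nrm b)) * grad_nrm r"
    unfolding ns_form_decomp[OF a b r] w_def[symmetric] using 1 2 3 4 5 by (simp add: abs_le_iff)
  also have "\<dots> = (6 * R * (grad_nrm a + grad_nrm b) + 4 * Mv * R + \<nu> * (grad_nrm a + grad_nrm b)) * grad_nrm r" by (simp add: algebra_simps)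
  also have "\<dots> \<le> (dual_const R * (1 + grad_nrm a + grad_nrm b)) * grad_nrm r"
  proof (rule mult_right_mono)
    have "0 \<le> 6 * R + \<nu> + 4 * Mv * R * (grad_nrm a + grad_nrm b)" using R0 \<nu>_pos Mv_nonneg g0 by simp
    then show "6 * R * (grad_nrm a + grad_nrm b) + 4 * Mv * R + \<nu> * (grad_nrm a + grad_nrm b) \<le> dual_const R * (1 + grad_nrm a + grad_nrm b)"
      by (simp add: dual_const_def algebra_simps)
  qed simp
  finally show ?thesis .
qed

text \<open>Transport of \<open>w\<close> by \<open>a\<close> and by \<open>v\<close> contributes
  nothing, and after \<open>transport_swap\<close> the remaining convective term carries the
  gradient of \<open>b\<close>. What is left is linear in the gradient of \<open>w\<close> and is
  absorbed by the viscous term, so only \<open>|w|^2\<close> survives.\<close>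

lemma ns_form_self:
  assumes a: "a \<in> solenoidal_tests \<Omega>" and b: "b \<in> solenoidal_tests \<Omega>"
    and w: "(\<lambda>x. a x - b x) \<in> solenoidal_tests \<Omega>"
  shows "ns_form a b (\<lambda>x. a x - b x) \<le> growth_const * (1 + (grad_nrm b)\<^sup>2) * (nrm M (\<lambda>x. a x - b x))\<^sup>2"
proof -
  define w where "w = (\<lambda>x. a x - b x)"
  have ws: "w \<in> solenoidal_tests \<Omega>" using w unfolding w_def .
  note at = sol_test[OF a] and bt = sol_test[OF b] and wt = sol_test[OF ws]
  define X where "X = nrm M w * (2 * grad_nrm b + Mv)"
  have "\<bar>ip M (advect w b) w\<bar> \<le> (nrm M w * grad_nrm w + nrm M w * grad_nrm w) * grad_nrm b" by (rule trilinear_bound[OF wt wt bt])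
  moreover have "\<bar>LINT x|M. advect w w x \<bullet> v x\<bar> \<le> Mv * (nrm M w * grad_nrm w)" by (rule v_term_bound(1)[OF wt wt])
  moreover have "ns_form a b w = - ip M (advect w b) w + (LINT x|M. advect w w x \<bullet> v x) - \<nu> * (grad_nrm w)\<^sup>2"
    unfolding ns_form_decomp[OF at bt wt] w_def[symmetric]
    by (simp add: transport_a[OF a wt] transport_v[OF wt] transport_swap[OF ws bt] ip_laplacian_self[OF wt])
  ultimately have "ns_form a b w \<le> X * grad_nrm w - \<nu> * (grad_nrm w)\<^sup>2"
    unfolding X_def by (simp add: algebra_simps abs_le_iff)
  also have "\<dots> \<le> X\<^sup>2 / (4 * \<nu>)"
  proof -
    have "0 \<le> (2 * \<nu> * grad_nrm w - X)\<^sup>2" by simp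
    then have "4 * \<nu> * (X * grad_nrm w - \<nu> * (grad_nrm w)\<^sup>2) \<le> X\<^sup>2" by (simp add: power2_eq_square algebra_simps)
    then show ?thesis using \<nu>_pos by (simp add: field_simps)
  qed
  also have "\<dots> \<le> growth_const * (1 + (grad_nrm b)\<^sup>2) * (nrm M w)\<^sup>2"
  proof -
    have "(2 * grad_nrm b + Mv)\<^sup>2 \<le> 8 * (grad_nrm b)\<^sup>2 + 2 * Mv\<^sup>2"
      using sum_squares_bound[of "2 * grad_nrm b" Mv] by (simp add: power2_sum power_mult_distrib)
    also have "\<dots> \<le> (8 + 2 * Mv\<^sup>2) * (1 + (grad_nrm b)\<^sup>2)" by (simp add: algebra_simps)
    finally have "X\<^sup>2 \<le> (nrm M w)\<^sup>2 * ((8 + 2 * Mv\<^sup>2) * (1 + (grad_nrm b)\<^sup>2))"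
      unfolding X_def power_mult_distrib by (rule mult_left_mono) simp
    then show ?thesis using \<nu>_pos unfolding growth_const_def by (simp add: field_simps)
  qed
  finally show ?thesis unfolding w_def .
qed

lemma sol_diff:
  assumes "a \<in> solenoidal_tests \<Omega>" "b \<in> solenoidal_tests \<Omega>"
  shows "(\<lambda>x. a x - b x) \<in> solenoidal_tests \<Omega>"
  using assms test_diff[OF assms[THEN sol_test]] test_diff_ops(1)[OF assms[THEN sol_test]]
  unfolding solenoidal_tests_def divergence_def by (auto simp: inner_diff_left sum_subtractf)

lemma young: "0 < l \<Longrightarrow> x * y \<le> l * y\<^sup>2 + x\<^sup>2 / (4 * l)" for x y l :: real
proof -
  assume l: "0 < l"
  have "0 \<le> (2 * l * y - x)\<^sup>2" by simp
  then have "4 * l * (x * y) \<le> 4 * l * (l * y\<^sup>2) + x\<^sup>2" by (simp add: power2_eq_square algebra_simps)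
  then show ?thesis using l by (simp add: field_simps)
qed

text \<open>Along the two solutions this is integrable over bounded time intervals, which is why
  both kinds of bounds are brought to a multiple of it.\<close>

definition h1_weight :: "(complex \<Rightarrow> complex) \<Rightarrow> (complex \<Rightarrow> complex) \<Rightarrow> real" where
  "h1_weight a b = 1 + (H1_norm \<Omega> a)\<^sup>2 + (H1_norm \<Omega> b)\<^sup>2"

text \<open>Young's inequality separates the test field from the solutions. The weight
  \<open>l\<close> stays free: it multiplies a quantity that approximation makes small and divides
  one that does not become small.\<close>

lemma ns_form_bound_Q:
  assumes a: "a \<in> test_functions \<Omega>" and b: "b \<in> test_functions \<Omega>" and r: "r \<in> test_functions \<Omega>"
    and R: "nrm M a \<le> R" "nrm M b \<le> R" and l: "0 < l"
  shows "\<bar>ns_form a b r\<bar> \<le> l * (H1_norm \<Omega> r)\<^sup>2 + (dual_const R)\<^sup>2 * h1_weight a b / l"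
proof -
  have R0: "R \<ge> 0" using R(1) nrm_nonneg[of M a] by linarith
  note k = dual_const_nonneg[OF R0]
  let ?x = "dual_const R * (1 + grad_nrm a + grad_nrm b)"
  have "\<bar>ns_form a b r\<bar> \<le> ?x * grad_nrm r" by (rule ns_form_bound[OF a b r R])
  also have "\<dots> \<le> l * (grad_nrm r)\<^sup>2 + ?x\<^sup>2 / (4 * l)" by (rule young[OF l])
  also have "l * (grad_nrm r)\<^sup>2 \<le> l * (H1_norm \<Omega> r)\<^sup>2"
    using l gradpair_sqi(5)[OF r] by (intro mult_left_mono power_mono) auto
  also have "?x\<^sup>2 / (4 * l) \<le> (dual_const R)\<^sup>2 * h1_weight a b / l"
  proof -
    have "(1 + grad_nrm a + grad_nrm b)\<^sup>2 \<le> 3 * (1 + (grad_nrm a)\<^sup>2 + (grad_nrm b)\<^sup>2)"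
      using sum_squares_bound[of 1 "grad_nrm a"] sum_squares_bound[of 1 "grad_nrm b"] sum_squares_bound[of "grad_nrm a" "grad_nrm b"]
      by (simp add: power2_eq_square algebra_simps)
    \<comment> \<open>The factor 4 cancels the one in Young's denominator
      \<open>4 * l\<close>.\<close>
    also have "\<dots> \<le> 4 * h1_weight a b"
      using gradpair_sqi(4)[OF a] gradpair_sqi(4)[OF b] by (simp add: h1_weight_def)
    finally have "?x\<^sup>2 \<le> (dual_const R)\<^sup>2 * (4 * h1_weight a b)" unfolding power_mult_distrib by (rule mult_left_mono) simp
    then show ?thesis using l by (simp add: field_simps)
  qed
  finally show ?thesis by simp
qed

text \<open>By linearity the test field \<open>p\<close> is split into \<open>a - b\<close>, where
  the sharp bound applies, and the error \<open>p - (a - b)\<close>, where the rough bound is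
  affordable.\<close>

lemma ns_form_energy_Q:
  assumes a: "a \<in> solenoidal_tests \<Omega>" and b: "b \<in> solenoidal_tests \<Omega>" and p: "p \<in> solenoidal_tests \<Omega>"
    and R: "nrm M a \<le> R" "nrm M b \<le> R" and l: "0 < l"
  shows "ns_form a b p \<le> growth_const * h1_weight a b * (nrm M (\<lambda>x. a x - b x))\<^sup>2
    + l * (H1_norm \<Omega> (\<lambda>x. p x - (a x - b x)))\<^sup>2 + (dual_const R)\<^sup>2 * h1_weight a b / l"
proof -
  note ws = sol_diff[OF a b]
  note t = sol_test[OF a] sol_test[OF b] sol_test[OF p] sol_test[OF ws]
  have "ns_form a b p = ns_form a b (\<lambda>x. p x - (a x - b x)) + ns_form a b (\<lambda>x. a x - b x)"
    using ns_form_diff[OF sqi_test[OF t(1)] sqi_test[OF t(2)] t(3,4)] by simp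
  moreover have "\<bar>ns_form a b (\<lambda>x. p x - (a x - b x))\<bar> \<le> l * (H1_norm \<Omega> (\<lambda>x. p x - (a x - b x)))\<^sup>2 + (dual_const R)\<^sup>2 * h1_weight a b / l"
    by (rule ns_form_bound_Q[OF t(1,2) test_diff[OF t(3,4)] R l])
  moreover have "ns_form a b (\<lambda>x. a x - b x) \<le> growth_const * h1_weight a b * (nrm M (\<lambda>x. a x - b x))\<^sup>2"
  proof -
    have "1 + (grad_nrm b)\<^sup>2 \<le> h1_weight a b" using gradpair_sqi(4)[OF t(2)] by (simp add: h1_weight_def)
    then have "growth_const * (1 + (grad_nrm b)\<^sup>2) * (nrm M (\<lambda>x. a x - b x))\<^sup>2 \<le> growth_const * h1_weight a b * (nrm M (\<lambda>x. a x - b x))\<^sup>2"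
      using growth_const_nonneg by (intro mult_right_mono mult_left_mono) auto
    then show ?thesis using ns_form_self[OF a b ws] by linarith
  qed
  ultimately show ?thesis by linarith
qed

lemma V_space_seq:
  assumes "a \<in> V_space \<Omega>"
  obtains s where "\<And>n. s n \<in> solenoidal_tests \<Omega>" "(\<lambda>n. H1_norm \<Omega> (\<lambda>x. a x - s n x)) \<longlonglongrightarrow> 0"
proof -
  have "\<exists>\<phi>\<in>solenoidal_tests \<Omega>. H1_norm \<Omega> (\<lambda>x. a x - \<phi> x) < inverse (real (Suc n))" for n
    using assms unfolding V_space_def by simp
  then obtain s where s: "\<And>n. s n \<in> solenoidal_tests \<Omega>" "\<And>n. H1_norm \<Omega> (\<lambda>x. a x - s n x) < inverse (real (Suc n))"
    by metis
  have "(\<lambda>n. H1_norm \<Omega> (\<lambda>x. a x - s n x)) \<longlonglongrightarrow> 0"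
    by (rule tendsto_sandwich[OF _ _ tendsto_const LIMSEQ_inverse_real_of_nat])
       (auto intro!: always_eventually simp: H1_norm_nonneg less_imp_le[OF s(2)] simp del: of_nat_Suc)
  with s(1) show ?thesis by (rule that)
qed

text \<open>The left sides are continuous in L^2 and the right sides in H^1, so both bounds survive
  the approximation of \<open>a\<close> and \<open>b\<close> by solenoidal test fields. The test
  field \<open>p\<close> stays smooth, since the form takes its Laplacian.\<close>

lemma ns_form_V:
  assumes a: "a \<in> V_space \<Omega>" and b: "b \<in> V_space \<Omega>" and p: "p \<in> solenoidal_tests \<Omega>"
    and R: "nrm M a \<le> R" "nrm M b \<le> R" and l: "0 < l"
  shows "\<bar>ns_form a b p\<bar> \<le> l * (H1_norm \<Omega> p)\<^sup>2 + (dual_const (R + 1))\<^sup>2 * h1_weight a b / l"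
    and "ns_form a b p \<le> growth_const * h1_weight a b * (nrm M (\<lambda>x. a x - b x))\<^sup>2
    + l * (H1_norm \<Omega> (\<lambda>x. p x - (a x - b x)))\<^sup>2 + (dual_const (R + 1))\<^sup>2 * h1_weight a b / l"
proof -
  obtain A where A: "\<And>n. A n \<in> solenoidal_tests \<Omega>" "(\<lambda>n. H1_norm \<Omega> (\<lambda>x. a x - A n x)) \<longlonglongrightarrow> 0"
    using V_space_seq[OF a] by blast
  obtain B where B: "\<And>n. B n \<in> solenoidal_tests \<Omega>" "(\<lambda>n. H1_norm \<Omega> (\<lambda>x. b x - B n x)) \<longlonglongrightarrow> 0"
    using V_space_seq[OF b] by blast
  note H = V_H1[OF a] V_H1[OF b] test_H1(1)[OF sol_test[OF A(1)]] test_H1(1)[OF sol_test[OF B(1)]] test_H1(1)[OF sol_test[OF p]]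
  note S = H1_sqi[OF H(1)] H1_sqi[OF H(2)] H1_sqi[OF H(3)] H1_sqi[OF H(4)]
  have lim0: "(\<lambda>n. f n) \<longlonglongrightarrow> L" if "\<And>n. \<bar>f n - L\<bar> \<le> e n" "e \<longlonglongrightarrow> 0" for f e :: "nat \<Rightarrow> real" and L
    by (rule LIM_zero_cancel, rule Lim_null_comparison[OF _ that(2)]) (use that(1) in auto)
  have nA: "(\<lambda>n. nrm M (\<lambda>x. A n x - a x)) \<longlonglongrightarrow> 0"
    by (rule lim0[OF _ A(2)]) (use nrm_le_H1_norm in \<open>simp add: nrm_minus_commute[of _ _ a]\<close>)
  have nB: "(\<lambda>n. nrm M (\<lambda>x. B n x - b x)) \<longlonglongrightarrow> 0"
    by (rule lim0[OF _ B(2)]) (use nrm_le_H1_norm in \<open>simp add: nrm_minus_commute[of _ _ b]\<close>)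
  have limA: "(\<lambda>n. ns_form (A n) (B n) p) \<longlonglongrightarrow> ns_form a b p"
    by (rule ns_form_tendsto[where I = UNIV, OF sol_test[OF p]]) (use S nA nB in auto)
  have HA: "(\<lambda>n. H1_norm \<Omega> (A n)) \<longlonglongrightarrow> H1_norm \<Omega> a"
    by (rule lim0[OF _ A(2)]) (use H1_norm_diff_abs[OF H(1,3)] in \<open>simp add: abs_minus_commute\<close>)
  have HB: "(\<lambda>n. H1_norm \<Omega> (B n)) \<longlonglongrightarrow> H1_norm \<Omega> b"
    by (rule lim0[OF _ B(2)]) (use H1_norm_diff_abs[OF H(2,4)] in \<open>simp add: abs_minus_commute\<close>)
  have limQ: "(\<lambda>n. h1_weight (A n) (B n)) \<longlonglongrightarrow> h1_weight a b" unfolding h1_weight_def by (intro tendsto_intros HA HB)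
  have nw: "(\<lambda>n. nrm M (\<lambda>x. A n x - B n x)) \<longlonglongrightarrow> nrm M (\<lambda>x. a x - b x)"
  proof (rule lim0)
    fix n
    have "\<bar>nrm M (\<lambda>x. A n x - B n x) - nrm M (\<lambda>x. a x - b x)\<bar> \<le> nrm M (\<lambda>x. (A n x - B n x) - (a x - b x))"
      by (intro nrm_diff_abs sqi_diff S)
    also have "(\<lambda>x. (A n x - B n x) - (a x - b x)) = (\<lambda>x. (A n x - a x) - (B n x - b x))" by (auto simp: algebra_simps)
    also have "nrm M \<dots> \<le> nrm M (\<lambda>x. A n x - a x) + nrm M (\<lambda>x. B n x - b x)"
      by (intro nrm_triangle_diff sqi_diff S)
    finally show "\<bar>nrm M (\<lambda>x. A n x - B n x) - nrm M (\<lambda>x. a x - b x)\<bar> \<le> nrm M (\<lambda>x. A n x - a x) + nrm M (\<lambda>x. B n x - b x)" .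
    show "(\<lambda>n. nrm M (\<lambda>x. A n x - a x) + nrm M (\<lambda>x. B n x - b x)) \<longlonglongrightarrow> 0" using tendsto_add[OF nA nB] by simp
  qed
  have Hw: "(\<lambda>n. H1_norm \<Omega> (\<lambda>x. p x - (A n x - B n x))) \<longlonglongrightarrow> H1_norm \<Omega> (\<lambda>x. p x - (a x - b x))"
  proof (rule lim0)
    fix n
    note w = H1_diff(1)[OF H(1,2)] H1_diff(1)[OF H(3,4), of n n]
    have "\<bar>H1_norm \<Omega> (\<lambda>x. p x - (A n x - B n x)) - H1_norm \<Omega> (\<lambda>x. p x - (a x - b x))\<bar>
      \<le> H1_norm \<Omega> (\<lambda>x. (p x - (A n x - B n x)) - (p x - (a x - b x)))"
      by (intro H1_norm_diff_abs H1_diff(1) H)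
    also have "(\<lambda>x. (p x - (A n x - B n x)) - (p x - (a x - b x))) = (\<lambda>x. (a x - b x) - (A n x - B n x))" by auto
    also have "H1_norm \<Omega> \<dots> \<le> H1_norm \<Omega> (\<lambda>x. a x - A n x) + H1_norm \<Omega> (\<lambda>x. b x - B n x)"
      by (intro H1_norm_diff_diff H)
    finally show "\<bar>H1_norm \<Omega> (\<lambda>x. p x - (A n x - B n x)) - H1_norm \<Omega> (\<lambda>x. p x - (a x - b x))\<bar>
      \<le> H1_norm \<Omega> (\<lambda>x. a x - A n x) + H1_norm \<Omega> (\<lambda>x. b x - B n x)" .
    show "(\<lambda>n. H1_norm \<Omega> (\<lambda>x. a x - A n x) + H1_norm \<Omega> (\<lambda>x. b x - B n x)) \<longlonglongrightarrow> 0"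
      using tendsto_add[OF A(2) B(2)] by simp
  qed
  have "\<forall>\<^sub>F n in sequentially. nrm M (\<lambda>x. A n x - a x) < 1" "\<forall>\<^sub>F n in sequentially. nrm M (\<lambda>x. B n x - b x) < 1"
    using nA nB by (auto dest: order_tendstoD(2)[where a = 1])
  \<comment> \<open>The approximants may exceed the L^2 bound \<open>R\<close> slightly; allowing
    \<open>R + 1\<close> is the origin of \<open>dual_const (R + 1)\<close>.\<close>
  then have ev: "\<forall>\<^sub>F n in sequentially. nrm M (A n) \<le> R + 1 \<and> nrm M (B n) \<le> R + 1"
  proof eventually_elim
    case (elim n)
    then show ?case using nrm_diff_abs[OF S(3,1), of n] nrm_diff_abs[OF S(4,2), of n] R by linarith
  qed
  show "\<bar>ns_form a b p\<bar> \<le> l * (H1_norm \<Omega> p)\<^sup>2 + (dual_const (R + 1))\<^sup>2 * h1_weight a b / l"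
  proof (rule tendsto_le[OF sequentially_bot _ tendsto_rabs[OF limA]])
    show "(\<lambda>n. l * (H1_norm \<Omega> p)\<^sup>2 + (dual_const (R + 1))\<^sup>2 * h1_weight (A n) (B n) / l) \<longlonglongrightarrow> l * (H1_norm \<Omega> p)\<^sup>2 + (dual_const (R + 1))\<^sup>2 * h1_weight a b / l"
      using l by (intro tendsto_intros limQ) auto
    show "\<forall>\<^sub>F n in sequentially. \<bar>ns_form (A n) (B n) p\<bar> \<le> l * (H1_norm \<Omega> p)\<^sup>2 + (dual_const (R + 1))\<^sup>2 * h1_weight (A n) (B n) / l"
      using ev by eventually_elim (intro ns_form_bound_Q sol_test A B p l; simp)
  qed
  show "ns_form a b p \<le> growth_const * h1_weight a b * (nrm M (\<lambda>x. a x - b x))\<^sup>2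
    + l * (H1_norm \<Omega> (\<lambda>x. p x - (a x - b x)))\<^sup>2 + (dual_const (R + 1))\<^sup>2 * h1_weight a b / l"
  proof (rule tendsto_le[OF sequentially_bot _ limA])
    show "(\<lambda>n. growth_const * h1_weight (A n) (B n) * (nrm M (\<lambda>x. A n x - B n x))\<^sup>2
      + l * (H1_norm \<Omega> (\<lambda>x. p x - (A n x - B n x)))\<^sup>2 + (dual_const (R + 1))\<^sup>2 * h1_weight (A n) (B n) / l) \<longlonglongrightarrow> growth_const * h1_weight a b * (nrm M (\<lambda>x. a x - b x))\<^sup>2
      + l * (H1_norm \<Omega> (\<lambda>x. p x - (a x - b x)))\<^sup>2 + (dual_const (R + 1))\<^sup>2 * h1_weight a b / l"
      using l by (intro tendsto_intros limQ nw Hw) auto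
    show "\<forall>\<^sub>F n in sequentially. ns_form (A n) (B n) p \<le> growth_const * h1_weight (A n) (B n) * (nrm M (\<lambda>x. A n x - B n x))\<^sup>2
      + l * (H1_norm \<Omega> (\<lambda>x. p x - (A n x - B n x)))\<^sup>2 + (dual_const (R + 1))\<^sup>2 * h1_weight (A n) (B n) / l"
      using ev by eventually_elim (intro ns_form_energy_Q A B p l; simp)
  qed
qed

end

section \<open>From a weak derivative in time to an integral identity for increments\<close>

subsection \<open>Du Bois-Reymond in time\<close>

lemma integrable_continuous_support:
  fixes g :: "real \<Rightarrow> real"
  assumes "continuous_on UNIV g" "\<And>s. s \<notin> {a..b} \<Longrightarrow> g s = 0"
  shows "integrable lborel g"
proof -
  have "integrable lborel (\<lambda>x. indicator {a..b} x *\<^sub>R g x)"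
    by (rule borel_integrable_compact) (use assms(1) in \<open>auto intro: continuous_on_subset\<close>)
  moreover have "(\<lambda>x. indicator {a..b} x *\<^sub>R g x) = g"
    using assms(2) by (auto simp: indicator_def fun_eq_iff)
  ultimately show ?thesis by simp
qed

context smooth_step begin

abbreviation "S' \<equiv> pd 1 S"

lemma S_deriv: "(S has_real_derivative S' s) (at s)"
proof -
  have "(S has_derivative frechet_derivative S (at s)) (at s)"
    using smooth_differentiable[OF smooth_S] by (simp add: frechet_derivative_works)
  moreover have "frechet_derivative S (at s) = (*) (S' s)"
  proof
    fix h :: real
    have "frechet_derivative S (at s) (h *\<^sub>R 1) = h *\<^sub>R frechet_derivative S (at s) 1"
      by (rule linear_cmul[OF linear_frechet_derivative[OF smooth_differentiable[OF smooth_S]]])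
    then show "frechet_derivative S (at s) h = S' s * h"
      unfolding pd_def by (metis mult.commute mult.right_neutral real_scaleR_def)
  qed
  ultimately show ?thesis by (simp add: has_field_derivative_def)
qed

lemma S'_cont: "continuous_on A S'"
  by (rule smooth_continuous[OF smooth_pd[OF smooth_S]]) simp

lemma S'_zero: "s \<notin> {0..1} \<Longrightarrow> S' s = 0"
proof -
  assume s: "s \<notin> {0..1}"
  then consider "s < 0" | "s > 1" by fastforce
  then have "(S has_real_derivative 0) (at s)"
  proof cases
    case 1
    have "((\<lambda>s. 0::real) has_real_derivative 0) (at s)" by simp
    then show ?thesis
      by (rule has_field_derivative_transform_within_open[where S = "{..<0}"]) (use 1 S_0 in auto)
  next
    case 2
    have "((\<lambda>s. 1::real) has_real_derivative 0) (at s)" by simp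
    then show ?thesis
      by (rule has_field_derivative_transform_within_open[where S = "{1<..}"]) (use 2 S_1 in auto)
  qed
  from DERIV_unique[OF S_deriv this] show ?thesis .
qed

lemma S'_integral: "(LBINT r. S' r) = 1"
proof -
  have "has_bochner_integral lborel (\<lambda>s. indicator {0..1} s *\<^sub>R S' s) (S 1 - S 0)"
    by (rule has_bochner_integral_FTC_Icc)
      (use S_deriv S'_cont in \<open>auto simp: has_real_derivative_iff_has_vector_derivative[symmetric] intro: has_field_derivative_at_within\<close>)
  moreover have "(\<lambda>s. indicator {0..1} s *\<^sub>R S' s) = S'" using S'_zero by (auto simp: indicator_def fun_eq_iff)
  ultimately show ?thesis using S_0[of 0] S_1[of 1] has_bochner_integral_integral_eq by fastforce
qed

text \<open>\<open>S'\<close> has mass one and support in \<open>[0, 1]\<close>, so its rescalings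
  concentrate at \<open>s\<close> from the right. After an affine substitution the limit is a case
  of dominated convergence.\<close>

lemma S'_dirac:
  fixes f :: "real \<Rightarrow> real"
  assumes f: "continuous_on UNIV f"
  shows "(\<lambda>n. LBINT r. real (Suc n) * S' (real (Suc n) * (r - s)) * f r) \<longlonglongrightarrow> f s"
proof -
  have eq: "(LBINT r. real (Suc n) * S' (real (Suc n) * (r - s)) * f r) = (LBINT r. S' r * f (s + r / real (Suc n)))" for n
  proof -
    let ?c = "1 / real (Suc n)"
    have c: "?c \<noteq> 0" by simp
    have "(LBINT r. real (Suc n) * S' (real (Suc n) * (r - s)) * f r) =
        \<bar>?c\<bar> *\<^sub>R (LBINT r. real (Suc n) * S' (real (Suc n) * ((s + ?c * r) - s)) * f (s + ?c * r))"
      by (rule lborel_integral_real_affine[OF c])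
    also have "\<dots> = (LBINT r. ?c * (real (Suc n) * S' (real (Suc n) * ((s + ?c * r) - s)) * f (s + ?c * r)))"
      unfolding real_scaleR_def integral_mult_right_zero by (simp del: of_nat_Suc)
    also have "\<dots> = (LBINT r. S' r * f (s + r / real (Suc n)))"
      by (rule Bochner_Integration.integral_cong) (auto simp del: of_nat_Suc)
    finally show ?thesis .
  qed
  obtain C where C: "\<And>r. r \<in> {s..s+1} \<Longrightarrow> \<bar>f r\<bar> \<le> C"
  proof -
    have "compact (f ` {s..s+1})" by (intro compact_continuous_image continuous_on_subset[OF f]) auto
    then show ?thesis using that by (metis bounded_iff compact_imp_bounded imageI real_norm_def)
  qed
  have intS: "integrable lborel S'" by (rule integrable_continuous_support[OF S'_cont S'_zero])
  have fm: "f \<in> borel_measurable borel" by (rule borel_measurable_continuous_onI[OF f])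
  have Sm: "S' \<in> borel_measurable borel" by (rule borel_measurable_continuous_onI[OF S'_cont])
  have "(\<lambda>n. LBINT r. S' r * f (s + r / real (Suc n))) \<longlonglongrightarrow> (LBINT r. S' r * f s)"
  proof (rule integral_dominated_convergence)
    show "integrable lborel (\<lambda>r. \<bar>S' r\<bar> * C)" using intS by simp
    show "AE r in lborel. (\<lambda>n. S' r * f (s + r / real (Suc n))) \<longlonglongrightarrow> S' r * f s"
    proof (intro AE_I2 tendsto_mult tendsto_const)
      fix r
      have "(\<lambda>n. r / real (Suc n)) \<longlonglongrightarrow> 0" using tendsto_mult[OF tendsto_const[of r] LIMSEQ_inverse_real_of_nat] by (simp add: divide_inverse)
      then have "(\<lambda>n. s + r / real (Suc n)) \<longlonglongrightarrow> s" using tendsto_add[OF tendsto_const[of s]] by fastforce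
      then show "(\<lambda>n. f (s + r / real (Suc n))) \<longlonglongrightarrow> f s"
        by (rule continuous_on_tendsto_compose[OF f]) auto
    qed
    show "AE r in lborel. norm (S' r * f (s + r / real (Suc n))) \<le> \<bar>S' r\<bar> * C" for n
    proof (intro AE_I2)
      fix r
      show "norm (S' r * f (s + r / real (Suc n))) \<le> \<bar>S' r\<bar> * C"
      proof (cases "r \<in> {0..1}")
        case True
        then have "s + r / real (Suc n) \<in> {s..s+1}" by (auto simp: divide_le_eq)
        then show ?thesis using C by (simp add: abs_mult mult_left_mono)
      qed (simp add: S'_zero)
    qed
    show "(\<lambda>r. S' r * f s) \<in> borel_measurable lborel" using Sm by measurable
    show "(\<lambda>r. S' r * f (s + r / real (Suc n))) \<in> borel_measurable lborel" for n using Sm fm by measurable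
  qed
  then show ?thesis unfolding eq using S'_integral by simp
qed

text \<open>A smooth version of the indicator of \<open>{s<..t}\<close> whose derivative
  approximates a Dirac mass at \<open>s\<close> minus one at \<open>t\<close>. Its support lies in
  \<open>[s, t + 1]\<close>, inside positive times when \<open>0 < s\<close>.\<close>

definition step_diff :: "real \<Rightarrow> real \<Rightarrow> nat \<Rightarrow> real \<Rightarrow> real" where
  "step_diff s t n r = S (real (Suc n) * (r - s)) - S (real (Suc n) * (r - t))"

lemma smooth_step_scaled: "smooth (\<lambda>r. S (real (Suc n) * (r - s)))"
  using smooth_affine[OF bounded_linear_mult_right[of "real (Suc n)"] smooth_S, of "- real (Suc n) * s"] by (simp add: algebra_simps)

lemma pd_step_diff: "pd 1 (step_diff s t n) r = real (Suc n) * S' (real (Suc n) * (r - s)) - real (Suc n) * S' (real (Suc n) * (r - t))"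
proof -
  have "((\<lambda>r. S (real (Suc n) * (r - c))) has_real_derivative S' (real (Suc n) * (r - c)) * real (Suc n)) (at r)" for c
    by (rule DERIV_chain2[OF S_deriv]) (auto intro!: derivative_eq_intros)
  from DERIV_diff[OF this[of s] this[of t]] have "(step_diff s t n has_derivative (*) (S' (real (Suc n) * (r - s)) * real (Suc n) - S' (real (Suc n) * (r - t)) * real (Suc n))) (at r)"
    unfolding step_diff_def[abs_def] has_field_derivative_def .
  from pd_eq[OF this, of 1] show ?thesis by (simp only: mult_1_right mult.commute[of _ "real (Suc n)"])
qed

lemma step_diff_zero: "s < t \<Longrightarrow> r \<notin> {s..t+1} \<Longrightarrow> step_diff s t n r = 0"
proof -
  assume st: "s < t" and r: "r \<notin> {s..t+1}"
  then consider "r < s" | "r > t + 1" by fastforce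
  then show ?thesis
  proof cases
    case 1
    then have "real (Suc n) * (r - s) \<le> 0" "real (Suc n) * (r - t) \<le> 0" using st by (auto simp: mult_le_0_iff)
    then show ?thesis by (simp add: step_diff_def S_0 del: of_nat_Suc)
  next
    case 2
    then have "1 * 1 \<le> real (Suc n) * (r - s)" "1 * 1 \<le> real (Suc n) * (r - t)" using st by (intro mult_mono; simp)+
    then show ?thesis by (simp add: step_diff_def S_1 del: of_nat_Suc)
  qed
qed

lemma step_diff_test:
  assumes "0 < s" "s < t" shows "step_diff s t n \<in> test_functions {0<..}"
proof (rule test_functionsI)
  show "smooth (step_diff s t n)" unfolding step_diff_def[abs_def]
    by (rule smooth_diff[OF smooth_step_scaled smooth_step_scaled])
  show "step_diff s t n r = 0" if "r \<notin> {s..t+1}" for r by (rule step_diff_zero[OF assms(2) that])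
qed (use assms in auto)

lemma step_diff_tendsto: "s < t \<Longrightarrow> (\<lambda>n. step_diff s t n r) \<longlonglongrightarrow> indicator {s<..t} r"
proof -
  assume st: "s < t"
  have *: "(\<lambda>n. S (real (Suc n) * (r - c))) \<longlonglongrightarrow> indicator {c<..} r" for c
  proof (cases "r > c")
    case True
    obtain N where N: "real N * (r - c) > 1" using True reals_Archimedean3[of "r - c"] by auto
    have "S (real (Suc n) * (r - c)) = 1" if "n \<ge> N" for n
    proof (rule S_1)
      have "real N * (r - c) \<le> real (Suc n) * (r - c)" using True that by (intro mult_right_mono) auto
      then show "1 \<le> real (Suc n) * (r - c)" using N by linarith
    qed
    then have "\<forall>\<^sub>F n in sequentially. S (real (Suc n) * (r - c)) = 1" by (auto simp: eventually_sequentially simp del: of_nat_Suc)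
    then show ?thesis using True by (simp add: tendsto_eventually del: of_nat_Suc)
  next
    case False
    then have "S (real (Suc n) * (r - c)) = 0" for n by (intro S_0) (simp add: mult_le_0_iff)
    then show ?thesis using False by (simp del: of_nat_Suc)
  qed
  have "(\<lambda>n. step_diff s t n r) \<longlonglongrightarrow> indicator {s<..} r - indicator {t<..} r"
    unfolding step_diff_def by (intro tendsto_diff *)
  moreover have "indicator {s<..} r - indicator {t<..} r = (indicator {s<..t} r :: real)" using st by (auto simp: indicator_def)
  ultimately show ?thesis by simp
qed

text \<open>Test with \<open>step_diff\<close>: the two halves of its derivative tend to
  \<open>f s\<close> and \<open>- f t\<close>, and the function itself tends to an indicator.
  Continuity of \<open>f\<close> gives the identity for every pair \<open>s < t\<close>, not merely
  for almost all.\<close>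

lemma du_bois_reymond:
  fixes f A :: "real \<Rightarrow> real"
  assumes f: "continuous_on UNIV f" and A: "continuous_on UNIV A"
    and weak: "\<And>\<eta>. \<eta> \<in> test_functions {0<..} \<Longrightarrow> (LBINT r. pd 1 \<eta> r * f r + \<eta> r * A r) = 0"
    and s: "0 < s" "s < t"
  shows "f t - f s = integral {s..t} A"
proof -
  have Am: "A \<in> borel_measurable borel" by (rule borel_measurable_continuous_onI[OF A])
  let ?d = "\<lambda>c n r. real (Suc n) * S' (real (Suc n) * (r - c)) * f r"
  have intd: "integrable lborel (?d c n)" for c n
  proof (rule integrable_continuous_support)
    show "continuous_on UNIV (?d c n)"
      by (intro continuous_intros f continuous_on_compose2[OF S'_cont[of UNIV]]) auto
    fix r assume "r \<notin> {c..c+1}"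
    then consider "r < c" | "r > c + 1" by fastforce
    then have "real (Suc n) * (r - c) \<notin> {0..1}"
    proof cases
      case 1 then show ?thesis by (simp add: zero_le_mult_iff del: of_nat_Suc)
    next
      case 2
      then have "1 * 1 < real (Suc n) * (r - c)" by (intro mult_le_less_imp_less) auto
      then show ?thesis by simp
    qed
    then show "?d c n r = 0" using S'_zero by (simp del: of_nat_Suc)
  qed
  have intA: "integrable lborel (\<lambda>r. step_diff s t n r * A r)" for n
    by (rule integrable_continuous_support[where a = s and b = "t+1"])
      (auto intro!: continuous_intros A test_functionsD(5)[OF step_diff_test] s simp: step_diff_zero[OF s(2)])
  have sum0: "(LBINT r. ?d s n r) - (LBINT r. ?d t n r) + (LBINT r. step_diff s t n r * A r) = 0" for n
  proof -
    have "(LBINT r. (?d s n r - ?d t n r) + step_diff s t n r * A r) = 0"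
      using weak[OF step_diff_test[OF s, of n]] unfolding pd_step_diff by (simp add: algebra_simps)
    then show ?thesis using intd intA by simp
  qed
  have "(\<lambda>n. LBINT r. step_diff s t n r * A r) \<longlonglongrightarrow> (LBINT r. indicator {s<..t} r * A r)"
  proof (rule integral_dominated_convergence)
    have i: "integrable lborel (\<lambda>x. indicator {s..t+1} x *\<^sub>R A x)"
      by (rule borel_integrable_compact) (auto intro: continuous_on_subset[OF A])
    then show "integrable lborel (\<lambda>r. indicator {s..t+1} r * \<bar>A r\<bar>)"
      using integrable_abs[OF i] by (simp add: abs_mult)
    show "AE r in lborel. (\<lambda>n. step_diff s t n r * A r) \<longlonglongrightarrow> indicator {s<..t} r * A r"
      by (intro AE_I2 tendsto_mult tendsto_const step_diff_tendsto s)
    show "AE r in lborel. norm (step_diff s t n r * A r) \<le> indicator {s..t+1} r * \<bar>A r\<bar>" for n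
    proof (intro AE_I2)
      fix r
      have "\<bar>step_diff s t n r\<bar> \<le> indicator {s..t+1} r"
      proof (cases "r \<in> {s..t+1}")
        case True
        have "\<bar>step_diff s t n r\<bar> \<le> 1" unfolding step_diff_def
          using S_ge[of "real (Suc n) * (r - s)"] S_le[of "real (Suc n) * (r - s)"] S_ge[of "real (Suc n) * (r - t)"] S_le[of "real (Suc n) * (r - t)"]
          by linarith
        then show ?thesis using True by simp
      qed (simp add: step_diff_zero[OF s(2)])
      then show "norm (step_diff s t n r * A r) \<le> indicator {s..t+1} r * \<bar>A r\<bar>" by (simp add: abs_mult mult_right_mono)
    qed
    show "(\<lambda>r. indicator {s<..t} r * A r) \<in> borel_measurable lborel" using Am by measurable
    show "(\<lambda>r. step_diff s t n r * A r) \<in> borel_measurable lborel" for n using intA by (rule borel_measurable_integrable)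
  qed
  then have "(\<lambda>n. (LBINT r. ?d s n r) - (LBINT r. ?d t n r) + (LBINT r. step_diff s t n r * A r)) \<longlonglongrightarrow> f s - f t + (LBINT r. indicator {s<..t} r * A r)"
    by (intro tendsto_add tendsto_diff S'_dirac f)
  then have "f s - f t + (LBINT r. indicator {s<..t} r * A r) = 0" unfolding sum0 by (simp add: LIMSEQ_const_iff)
  moreover have "(LBINT r. indicator {s<..t} r * A r) = integral {s..t} A"
  proof -
    have si: "set_integrable lborel {s..t} A" by (rule borel_integrable_atLeastAtMost') (rule continuous_on_subset[OF A], simp)
    have "(LBINT r. indicator {s<..t} r * A r) = (LBINT r. indicator {s..t} r *\<^sub>R A r)"
    proof (rule integral_cong_AE)
      show "AE r in lborel. indicator {s<..t} r * A r = indicator {s..t} r *\<^sub>R A r"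
        using AE_lborel_singleton[of s] by eventually_elim (auto simp: indicator_def)
    qed (use Am in measurable)
    also have "\<dots> = integral {s..t} A"
      using set_borel_integral_eq_integral(2)[OF si] by (simp add: set_lebesgue_integral_def)
    finally show ?thesis .
  qed
  ultimately show ?thesis by simp
qed

end

section \<open>Separation of variables in the space-time formulation; the divergence of the
  background\<close>

subsection \<open>Product test functions\<close>

text \<open>Separated variables reduce the space-time identity to a scalar one in time, with a fixed
  solenoidal field in space.\<close>

definition tensor :: "(real \<Rightarrow> real) \<Rightarrow> (complex \<Rightarrow> 'b::euclidean_space) \<Rightarrow> real \<times> complex \<Rightarrow> 'b" where
  "tensor \<eta> \<phi> p = \<eta> (fst p) *\<^sub>R \<phi> (snd p)"

lemma tensor_test:
  assumes "\<eta> \<in> test_functions {0<..}" "\<phi> \<in> test_functions \<Omega>"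
  shows "tensor \<eta> \<phi> \<in> test_functions ({0<..} \<times> \<Omega>)"
proof (rule test_functionsI)
  have "smooth (\<lambda>p::real \<times> complex. \<eta> (fst p + 0))" "smooth (\<lambda>p::real \<times> complex. \<phi> (snd p + 0))"
    by (intro smooth_affine bounded_linear_fst bounded_linear_snd test_functionsD(1)[OF assms(1)] test_functionsD(1)[OF assms(2)])+
  then show "smooth (tensor \<eta> \<phi>)" unfolding tensor_def[abs_def]
    using smooth_bilinear[OF bounded_bilinear_scaleR] by fastforce
  show "compact (supp \<eta> \<times> supp \<phi>)" by (intro compact_Times test_functionsD(2)[OF assms(1)] test_functionsD(2)[OF assms(2)])
  show "supp \<eta> \<times> supp \<phi> \<subseteq> {0<..} \<times> \<Omega>" using test_functionsD(3)[OF assms(1)] test_functionsD(3)[OF assms(2)] by blast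
  show "tensor \<eta> \<phi> p = 0" if "p \<notin> supp \<eta> \<times> supp \<phi>" for p
  proof -
    have "fst p \<notin> supp \<eta> \<or> snd p \<notin> supp \<phi>" using that by (cases p) auto
    then have "\<eta> (fst p) = 0 \<or> \<phi> (snd p) = 0" using not_in_supp[of "fst p" \<eta>] not_in_supp[of "snd p" \<phi>] by blast
    then show ?thesis unfolding tensor_def by auto
  qed
qed

lemma tensor_slice: "(\<lambda>y. tensor \<eta> \<phi> (t, y)) = (\<lambda>y. \<eta> t *\<^sub>R \<phi> y)"
  by (simp add: tensor_def)

lemma pd_tensor_slice:
  assumes "\<phi> \<in> test_functions \<Omega>"
  shows "pd e (\<lambda>y. tensor \<eta> \<phi> (t, y)) = (\<lambda>y. \<eta> t *\<^sub>R pd e \<phi> y)"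
  unfolding tensor_slice
  by (intro ext pd_linear_comp[OF bounded_linear_scaleR_right] test_functionsD(4)[OF assms])

lemma pd_tensor_time:
  assumes "\<eta> \<in> test_functions {0<..}" "\<phi> \<in> test_functions \<Omega>"
  shows "pd (1, 0) (tensor \<eta> \<phi>) (t, x) = pd 1 \<eta> t *\<^sub>R \<phi> x"
proof -
  have \<eta>: "(\<eta> has_derivative frechet_derivative \<eta> (at t)) (at t)"
    using test_functionsD(4)[OF assms(1)] by (simp add: frechet_derivative_works)
  have \<phi>: "(\<phi> has_derivative frechet_derivative \<phi> (at x)) (at x)"
    using test_functionsD(4)[OF assms(2)] by (simp add: frechet_derivative_works)
  have 1: "((\<lambda>p. \<eta> (fst p)) has_derivative (\<lambda>h. frechet_derivative \<eta> (at t) (fst h))) (at (t, x))"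
    by (rule has_derivative_compose[where f = fst and g = \<eta>]) (use \<eta> in \<open>auto intro!: bounded_linear_imp_has_derivative bounded_linear_fst\<close>)
  have 2: "((\<lambda>p. \<phi> (snd p)) has_derivative (\<lambda>h. frechet_derivative \<phi> (at x) (snd h))) (at (t, x))"
    by (rule has_derivative_compose[where f = snd and g = \<phi>]) (use \<phi> in \<open>auto intro!: bounded_linear_imp_has_derivative bounded_linear_snd\<close>)
  have z: "frechet_derivative \<phi> (at x) 0 = 0"
    by (rule linear_0[OF linear_frechet_derivative[OF test_functionsD(4)[OF assms(2)]]])
  have "(tensor \<eta> \<phi> has_derivative (\<lambda>h. \<eta> t *\<^sub>R frechet_derivative \<phi> (at x) (snd h) + frechet_derivative \<eta> (at t) (fst h) *\<^sub>R \<phi> x)) (at (t, x))"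
    unfolding tensor_def[abs_def] using has_derivative_scaleR[OF 1 2] by simp
  from pd_eq[OF this, of "(1, 0)"] show ?thesis by (simp add: z pd_def)
qed

lemma tensor_ops:
  fixes \<phi> :: "complex \<Rightarrow> complex"
  assumes "\<phi> \<in> test_functions \<Omega>"
  shows "divergence (\<lambda>y. tensor \<eta> \<phi> (t, y)) x = \<eta> t * divergence \<phi> x"
    and "advect u (\<lambda>y. tensor \<eta> \<phi> (t, y)) x = \<eta> t *\<^sub>R advect u \<phi> x"
    and "laplacian (\<lambda>y. tensor \<eta> \<phi> (t, y)) x = \<eta> t *\<^sub>R laplacian \<phi> x"
proof -
  note p = pd_tensor_slice[OF assms, of _ \<eta> t]
  show "divergence (\<lambda>y. tensor \<eta> \<phi> (t, y)) x = \<eta> t * divergence \<phi> x"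
    unfolding divergence_def p by (simp add: sum_distrib_left)
  show "advect u (\<lambda>y. tensor \<eta> \<phi> (t, y)) x = \<eta> t *\<^sub>R advect u \<phi> x"
    unfolding advect_complex p by (simp add: scaleR_add_right mult.commute)
  have "pd e (\<lambda>y. \<eta> t *\<^sub>R pd e \<phi> y) x = \<eta> t *\<^sub>R pd e (pd e \<phi>) x" if "e \<in> Basis" for e
    by (rule pd_linear_comp[OF bounded_linear_scaleR_right test_functionsD(4)[OF test_pd[OF assms that]]])
  then show "laplacian (\<lambda>y. tensor \<eta> \<phi> (t, y)) x = \<eta> t *\<^sub>R laplacian \<phi> x"
    unfolding laplacian_def p by (simp add: scaleR_sum_right)
qed

lemma tensor_gradient:
  fixes \<phi> :: "complex \<Rightarrow> real"
  assumes "\<phi> \<in> test_functions \<Omega>"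
  shows "gradient (\<lambda>y. tensor \<eta> \<phi> (t, y)) x = \<eta> t *\<^sub>R gradient \<phi> x"
  unfolding gradient_def pd_tensor_slice[OF assms] by (simp add: scaleR_sum_right)

text \<open>Extension by zero to nonpositive times replaces the half line and the completed measure
  by the whole line with Borel functions, as the du Bois-Reymond lemma expects.\<close>

lemma LINT_pos_eq_LBINT:
  fixes g h :: "real \<Rightarrow> real"
  assumes "h \<in> borel_measurable borel" "\<And>t. t > 0 \<Longrightarrow> g t = h t" "\<And>t. t \<le> 0 \<Longrightarrow> h t = 0"
  shows "(LINT t:{0<..}|lebesgue. g t) = (LBINT t. h t)"
proof -
  have "(\<lambda>t. indicator {0<..} t *\<^sub>R g t) = h" using assms(2,3) by (auto simp: indicator_def fun_eq_iff)
  then show ?thesis using assms(1) by (simp add: set_lebesgue_integral_def integral_completion)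
qed

lemma test_time_zero: "\<eta> \<in> test_functions {0<..} \<Longrightarrow> t \<le> 0 \<Longrightarrow> \<eta> t = (0::real)"
  for t :: real
  using test_zero_outside[of \<eta> "{0<..}" t] by simp

context step_domain begin

lemma gradient_test:
  fixes f :: "complex \<Rightarrow> real"
  shows "f \<in> test_functions \<Omega> \<Longrightarrow> gradient f \<in> test_functions \<Omega>"
  unfolding gradient_def[abs_def]
  by (intro test_sum test_linear[OF bounded_linear_scaleR_left] test_pd)

lemma H_sqi: "W \<in> H_space \<Omega> \<Longrightarrow> sqi M W" by (simp add: H_space_def L2_sqi)

lemma H_approx:
  assumes "W \<in> H_space \<Omega>" "\<epsilon> > 0"
  obtains \<phi> where "\<phi> \<in> solenoidal_tests \<Omega>" "nrm M (\<lambda>x. W x - \<phi> x) < \<epsilon>"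
  using assms unfolding H_space_def L2_norm_nrm by blast

lemma eq_zero_if_small: "(\<And>e. e > 0 \<Longrightarrow> \<bar>x\<bar> \<le> e * C) \<Longrightarrow> C \<ge> 0 \<Longrightarrow> x = 0" for x C :: real
proof (rule ccontr)
  assume a: "\<And>e. e > 0 \<Longrightarrow> \<bar>x\<bar> \<le> e * C" "C \<ge> 0" "x \<noteq> 0"
  have "\<bar>x\<bar> \<le> \<bar>x\<bar> / (2 * (C + 1)) * C" by (rule a(1)) (use a in auto)
  also have "\<dots> < \<bar>x\<bar>" using a by (simp add: field_simps) (smt (verit) mult_nonneg_nonneg zero_less_abs_iff)
  finally show False by simp
qed

text \<open>Solenoidal test fields are orthogonal to gradients by integration by parts, and the
  pairing is continuous in L^2.\<close>

lemma H_gradient: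
  fixes f :: "complex \<Rightarrow> real"
  assumes W: "W \<in> H_space \<Omega>" and f: "f \<in> test_functions \<Omega>"
  shows "ip M W (gradient f) = 0"
proof (rule eq_zero_if_small)
  note s = H_sqi[OF W] sqi_test[OF gradient_test[OF f]]
  fix e :: real assume "e > 0"
  then obtain \<phi> where \<phi>: "\<phi> \<in> solenoidal_tests \<Omega>" "nrm M (\<lambda>x. W x - \<phi> x) < e" using H_approx[OF W] by blast
  have "ip M \<phi> (gradient f) = 0" using integral_div_free[OF \<phi>(1) f] by (simp add: ip_def)
  then have "\<bar>ip M W (gradient f)\<bar> = \<bar>ip M (\<lambda>x. W x - \<phi> x) (gradient f)\<bar>"
    using s sqi_test[OF sol_test[OF \<phi>(1)]] by (simp add: ip_diff_left)
  also have "\<dots> \<le> nrm M (\<lambda>x. W x - \<phi> x) * nrm M (gradient f)"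
    by (intro ip_le sqi_diff s sqi_test[OF sol_test[OF \<phi>(1)]])
  also have "\<dots> \<le> e * nrm M (gradient f)" using \<phi>(2) by (intro mult_right_mono) auto
  finally show "\<bar>ip M W (gradient f)\<bar> \<le> e * nrm M (gradient f)" .
qed simp

lemma bounded_test_integrable:
  fixes f :: "complex \<Rightarrow> complex"
  assumes "v \<in> borel_measurable M" "\<And>x. x \<in> \<Omega> \<Longrightarrow> norm (v x) \<le> Mv" "f \<in> test_functions \<Omega>"
  shows "integrable M (\<lambda>x. v x \<bullet> f x)"
proof (rule Bochner_Integration.integrable_bound)
  note i = test_integrable[OF sets_\<Omega> assms(3)]
  show "integrable M (\<lambda>x. Mv * norm (f x))" using i by simp
  show "(\<lambda>x. v x \<bullet> f x) \<in> borel_measurable M" using assms(1) borel_measurable_integrable[OF i] by measurable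
  show "AE x in M. norm (v x \<bullet> f x) \<le> norm (Mv * norm (f x))"
  proof (rule AE_I2)
    fix x assume "x \<in> space M"
    then have "norm (v x) \<le> Mv" by (simp add: assms(2))
    then have "norm (v x) * norm (f x) \<le> Mv * norm (f x)" by (rule mult_right_mono) simp
    then have "norm (v x \<bullet> f x) \<le> Mv * norm (f x)"
      using Cauchy_Schwarz_ineq2[of "v x" "f x"] by simp
    also have "\<dots> \<le> norm (Mv * norm (f x))" unfolding real_norm_def by (rule abs_ge_self)
    finally show "norm (v x \<bullet> f x) \<le> norm (Mv * norm (f x))" .
  qed
qed

text \<open>The field \<open>v\<close> is divergence free because a solution exists: both \<open>u\<close> and \<open>u - v\<close> are.\<close>

lemma weak_div_imp_div_v:
  fixes f :: "complex \<Rightarrow> real"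
  assumes v: "v \<in> borel_measurable M" "\<And>x. x \<in> \<Omega> \<Longrightarrow> norm (v x) \<le> Mv"
    and W: "\<And>t. t \<ge> 0 \<Longrightarrow> (\<lambda>x. u t x - v x) \<in> H_space \<Omega>"
    and weak: "\<And>\<phi> :: real \<times> complex \<Rightarrow> real. \<phi> \<in> test_functions ({0<..} \<times> \<Omega>) \<Longrightarrow>
        (LINT t:{0<..}|lebesgue. (LINT x:\<Omega>|lebesgue. u t x \<bullet> gradient (\<lambda>y. \<phi> (t, y)) x)) = 0"
    and f: "f \<in> test_functions \<Omega>"
  shows "(LINT x|M. v x \<bullet> gradient f x) = 0"
proof -
  define c where "c = (LINT x|M. v x \<bullet> gradient f x)"
  note iv = bounded_test_integrable[OF v gradient_test[OF f]]
  have inner: "(LINT x:\<Omega>|lebesgue. u t x \<bullet> gradient (\<lambda>y. tensor \<eta> f (t, y)) x) = \<eta> t * c" if t: "t > 0" for t \<eta>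
  proof -
    have W0: "ip M (\<lambda>x. u t x - v x) (gradient f) = 0" by (rule H_gradient[OF W f]) (use t in simp)
    have iW: "integrable M (\<lambda>x. (u t x - v x) \<bullet> gradient f x)"
      by (rule sqi_ip_integrable[OF H_sqi[OF W] sqi_test[OF gradient_test[OF f]]]) (use t in simp)
    have "(LINT x:\<Omega>|lebesgue. u t x \<bullet> gradient (\<lambda>y. tensor \<eta> f (t, y)) x)
        = (LINT x|M. \<eta> t * ((u t x - v x) \<bullet> gradient f x + v x \<bullet> gradient f x))"
      unfolding set_integral_M tensor_gradient[OF f] by (simp add: inner_diff_left)
    also have "\<dots> = \<eta> t * (ip M (\<lambda>x. u t x - v x) (gradient f) + c)"
      using iW iv by (simp add: ip_def c_def)
    finally show ?thesis using W0 by simp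
  qed
  \<comment> \<open>Tested with products, the divergence equation says that \<open>\<eta>\<close>
    times the constant \<open>c\<close> integrates to zero. The du Bois-Reymond lemma with
    \<open>f = 0\<close> on \<open>[1, 2]\<close> then gives \<open>c = 0\<close>.\<close>
  have "(\<lambda>_::real. 0 :: real) 2 - (\<lambda>_. 0) 1 = integral {1..2::real} (\<lambda>_. c)"
  proof (rule du_bois_reymond[where f = "\<lambda>_. 0" and A = "\<lambda>_. c" and s = 1 and t = 2])
    fix \<eta> :: "real \<Rightarrow> real" assume \<eta>: "\<eta> \<in> test_functions {0<..}"
    have "(LBINT r. \<eta> r * c) = (LINT t:{0<..}|lebesgue. (LINT x:\<Omega>|lebesgue. u t x \<bullet> gradient (\<lambda>y. tensor \<eta> f (t, y)) x))"
      by (rule LINT_pos_eq_LBINT[symmetric]) (use test_borel[OF \<eta>] inner test_time_zero[OF \<eta>] in auto)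
    also have "\<dots> = 0" by (rule weak[OF tensor_test[OF \<eta> f]])
    finally show "(LBINT r. pd 1 \<eta> r * 0 + \<eta> r * c) = 0" by simp
  qed (auto intro: continuous_intros)
  then show ?thesis by (simp add: c_def)
qed

end

section \<open>The integrated equations of one solution and of the difference, and the initial
  value\<close>

text \<open>Solutions are known for \<open>t \<ge> 0\<close> only; extending by the initial value
  supplies the global continuity asked for by \<open>du_bois_reymond\<close> without changing
  anything at positive times.\<close>

lemma continuous_on_max0:
  fixes f :: "real \<Rightarrow> real"
  assumes "continuous_on {0..} f" shows "continuous_on UNIV (\<lambda>t. f (max 0 t))"
  by (rule continuous_on_compose2[OF assms]) (auto intro!: continuous_intros)

context ns_setting begin

lemma C_H_props:
  assumes "W \<in> C_H \<Omega>"
  shows "t \<ge> 0 \<Longrightarrow> W t \<in> H_space \<Omega>" "t \<ge> 0 \<Longrightarrow> sqi M (W t)"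
    and "t \<ge> 0 \<Longrightarrow> ((\<lambda>s. nrm M (\<lambda>x. W s x - W t x)) \<longlongrightarrow> 0) (at t within {0..})"
  using assms H_sqi unfolding C_H_def L2_norm_nrm by auto

lemma at_within_ev: "\<forall>\<^sub>F s in at t within I. s \<in> I"
  by (simp add: eventually_at_filter)

lemma ip_continuous:
  assumes "W \<in> C_H \<Omega>" "sqi M \<phi>"
  shows "continuous_on {0..} (\<lambda>t. ip M (W t) \<phi>)"
  unfolding continuous_on_def
  by (intro ballI ip_tendsto[where I = "{0..}"]) (use C_H_props[OF assms(1)] assms(2) in \<open>auto simp: at_within_ev[where I = "{0..}", unfolded atLeast_iff] nrm_def[of M "\<lambda>x. 0"]\<close>)

lemma ns_form_continuous:
  assumes "W1 \<in> C_H \<Omega>" "W2 \<in> C_H \<Omega>" "\<phi> \<in> test_functions \<Omega>"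
  shows "continuous_on {0..} (\<lambda>t. ns_form (W1 t) (W2 t) \<phi>)"
  unfolding continuous_on_def
  by (intro ballI ns_form_tendsto[where I = "{0..}"]) (use C_H_props[OF assms(1)] C_H_props[OF assms(2)] assms(3) in \<open>auto simp: at_within_ev[where I = "{0..}", unfolded atLeast_iff]\<close>)

lemma zero_C_H: "(\<lambda>t x. 0) \<in> C_H \<Omega>"
proof -
  have "(\<lambda>x. 0) \<in> solenoidal_tests \<Omega>" by (simp add: solenoidal_tests_def test_zero divergence_def)
  then have "(\<lambda>x. 0) \<in> H_space \<Omega>" by (auto simp: H_space_def L2_sqi sqi_zero L2_norm_nrm nrm_def[of M "\<lambda>x. 0"] intro!: bexI[of _ "\<lambda>x. 0"])
  then show ?thesis by (simp add: C_H_def L2_norm_nrm nrm_def[of M "\<lambda>x. 0"])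
qed

text \<open>After inserting product test functions the weak formulation reads
  \<open>\<eta>' F + \<eta> B\<close> under the time integral, with scalar continuous functions
  \<open>F\<close> and \<open>B\<close>.\<close>

lemma weak_identity:
  assumes W: "(\<lambda>t x. u t x - v x) \<in> C_H \<Omega>" and \<phi>: "\<phi> \<in> solenoidal_tests \<Omega>"
    and weak: "\<And>\<psi> :: real \<times> complex \<Rightarrow> complex. \<psi> \<in> test_functions ({0<..} \<times> \<Omega>) \<Longrightarrow>
        (\<forall>t x. divergence (\<lambda>y. \<psi> (t, y)) x = 0) \<Longrightarrow>
        (LINT t:{0<..}|lebesgue. (LINT x:\<Omega>|lebesgue.
            u t x \<bullet> pd (1, 0) \<psi> (t, x)
          + advect (u t) (\<lambda>y. \<psi> (t, y)) x \<bullet> u t x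
          + \<nu> * (u t x \<bullet> laplacian (\<lambda>y. \<psi> (t, y)) x))) = 0"
    and s: "0 < s" "s < t"
  defines "Z \<equiv> \<lambda>t x. u t x - v x"
  shows "ip M (Z t) \<phi> - ip M (Z s) \<phi> = integral {s..t} (\<lambda>r. ns_form (Z r) (\<lambda>x. 0) \<phi>
      + ((LINT x|M. advect v \<phi> x \<bullet> v x) + \<nu> * (LINT x|M. v x \<bullet> laplacian \<phi> x)))"
proof -
  have ZC: "Z \<in> C_H \<Omega>" using W by (simp add: Z_def)
  note Zs = C_H_props(2)[OF ZC]
  note \<phi>t = sol_test[OF \<phi>]
  \<comment> \<open>The contributions of \<open>v\<close> alone do not depend on time:
    \<open>d\<close> cancels in the increment of \<open>F\<close>, and \<open>c\<close> cancels
    later between the two solutions.\<close>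
  define c where "c = (LINT x|M. advect v \<phi> x \<bullet> v x) + \<nu> * (LINT x|M. v x \<bullet> laplacian \<phi> x)"
  define d where "d = (LINT x|M. v x \<bullet> \<phi> x)"
  note iv = bounded_test_integrable[OF v_measurable v_bound \<phi>t] bounded_test_integrable[OF v_measurable v_bound test_laplacian[OF \<phi>t]]
  have inner: "(LINT x:\<Omega>|lebesgue. u t x \<bullet> pd (1, 0) (tensor \<eta> \<phi>) (t, x)
          + advect (u t) (\<lambda>y. tensor \<eta> \<phi> (t, y)) x \<bullet> u t x + \<nu> * (u t x \<bullet> laplacian (\<lambda>y. tensor \<eta> \<phi> (t, y)) x))
      = pd 1 \<eta> t * (ip M (Z t) \<phi> + d) + \<eta> t * (ns_form (Z t) (\<lambda>x. 0) \<phi> + c)"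
    if t: "t > 0" and \<eta>: "\<eta> \<in> test_functions {0<..}" for t \<eta>
  proof -
    have zt: "sqi M (Z t)" by (rule Zs) (use t in simp)
    have u: "u t = (\<lambda>x. Z t x + v x)" by (simp add: Z_def)
    have i1: "integrable M (\<lambda>x. u t x \<bullet> \<phi> x)" "(LINT x|M. u t x \<bullet> \<phi> x) = ip M (Z t) \<phi> + d"
      using sqi_ip_integrable[OF zt sqi_test[OF \<phi>t]] iv(1) unfolding u by (simp_all add: inner_add_left ip_def d_def)
    have i2: "integrable M (\<lambda>x. u t x \<bullet> laplacian \<phi> x)" "(LINT x|M. u t x \<bullet> laplacian \<phi> x) = ip M (Z t) (laplacian \<phi>) + (LINT x|M. v x \<bullet> laplacian \<phi> x)"
      using sqi_ip_integrable[OF zt sqi_test[OF test_laplacian[OF \<phi>t]]] iv(2) unfolding u by (simp_all add: inner_add_left ip_def)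
    have i3: "integrable M (\<lambda>x. advect (u t) \<phi> x \<bullet> u t x)" using ns_form_integrable[OF zt \<phi>t] unfolding u .
    have A: "ns_form (Z t) (\<lambda>x. 0) \<phi> = (LINT x|M. advect (u t) \<phi> x \<bullet> u t x) - (LINT x|M. advect v \<phi> x \<bullet> v x) + \<nu> * ip M (Z t) (laplacian \<phi>)"
      unfolding ns_form_def u by simp
    have "(LINT x:\<Omega>|lebesgue. u t x \<bullet> pd (1, 0) (tensor \<eta> \<phi>) (t, x)
          + advect (u t) (\<lambda>y. tensor \<eta> \<phi> (t, y)) x \<bullet> u t x + \<nu> * (u t x \<bullet> laplacian (\<lambda>y. tensor \<eta> \<phi> (t, y)) x))
       = (LINT x|M. pd 1 \<eta> t * (u t x \<bullet> \<phi> x) + \<eta> t * (advect (u t) \<phi> x \<bullet> u t x) + \<eta> t * \<nu> * (u t x \<bullet> laplacian \<phi> x))"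
      unfolding set_integral_M tensor_ops[OF \<phi>t] pd_tensor_time[OF \<eta> \<phi>t] by (simp add: mult_ac)
    also have "\<dots> = pd 1 \<eta> t * (ip M (Z t) \<phi> + d) + \<eta> t * (LINT x|M. advect (u t) \<phi> x \<bullet> u t x)
       + \<eta> t * \<nu> * (ip M (Z t) (laplacian \<phi>) + (LINT x|M. v x \<bullet> laplacian \<phi> x))"
      unfolding i1(2)[symmetric] i2(2)[symmetric] using i1(1) i2(1) i3 by simp
    also have "\<dots> = pd 1 \<eta> t * (ip M (Z t) \<phi> + d) + \<eta> t * (ns_form (Z t) (\<lambda>x. 0) \<phi> + c)"
      unfolding A c_def by (simp add: algebra_simps)
    finally show ?thesis .
  qed
  define F where "F r = ip M (Z (max 0 r)) \<phi> + d" for r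
  define B where "B r = ns_form (Z (max 0 r)) (\<lambda>x. 0) \<phi> + c" for r
  have Fc: "continuous_on UNIV F" unfolding F_def
    by (intro continuous_intros continuous_on_max0[OF ip_continuous[OF ZC sqi_test[OF \<phi>t]]])
  have Bc: "continuous_on UNIV B" unfolding B_def
    by (intro continuous_intros continuous_on_max0[OF ns_form_continuous[OF ZC zero_C_H \<phi>t]])
  have "F t - F s = integral {s..t} B"
  proof (rule du_bois_reymond[OF Fc Bc _ s])
    fix \<eta> :: "real \<Rightarrow> real" assume \<eta>: "\<eta> \<in> test_functions {0<..}"
    have \<eta>': "pd 1 \<eta> \<in> test_functions {0<..}" by (rule test_pd[OF \<eta>]) simp
    have "(LBINT r. pd 1 \<eta> r * F r + \<eta> r * B r) = (LINT t:{0<..}|lebesgue. (LINT x:\<Omega>|lebesgue. u t x \<bullet> pd (1, 0) (tensor \<eta> \<phi>) (t, x)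
          + advect (u t) (\<lambda>y. tensor \<eta> \<phi> (t, y)) x \<bullet> u t x + \<nu> * (u t x \<bullet> laplacian (\<lambda>y. tensor \<eta> \<phi> (t, y)) x)))"
    proof (rule LINT_pos_eq_LBINT[symmetric])
      show "(\<lambda>r. pd 1 \<eta> r * F r + \<eta> r * B r) \<in> borel_measurable borel"
        by (intro borel_measurable_continuous_onI continuous_intros Fc Bc test_functionsD(5)[OF \<eta>] test_functionsD(5)[OF \<eta>'])
      show "pd 1 \<eta> t * F t + \<eta> t * B t = 0" if "t \<le> 0" for t
        using test_time_zero[OF \<eta> that] test_time_zero[OF \<eta>' that] by simp
    qed (simp add: inner \<eta> F_def B_def max_def)
    also have "\<dots> = 0"
      by (rule weak[OF tensor_test[OF \<eta> \<phi>t]]) (use \<phi> in \<open>simp add: tensor_ops(1)[OF \<phi>t] solenoidal_tests_def\<close>)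
    finally show "(LBINT r. pd 1 \<eta> r * F r + \<eta> r * B r) = 0" .
  qed
  moreover have "integral {s..t} B = integral {s..t} (\<lambda>r. ns_form (Z r) (\<lambda>x. 0) \<phi> + c)"
    by (rule Henstock_Kurzweil_Integration.integral_cong) (use s in \<open>simp add: B_def max_def\<close>)
  ultimately show ?thesis using s by (simp add: F_def c_def max_def)
qed

lemma weak_solution_diff_identity:
  assumes u1: "weak_solution \<nu> \<Omega> v u0 u1" and u2: "weak_solution \<nu> \<Omega> v u0 u2"
    and \<phi>: "\<phi> \<in> solenoidal_tests \<Omega>" and s: "0 < s" "s < t"
  defines "W1 \<equiv> \<lambda>t x. u1 t x - v x" and "W2 \<equiv> \<lambda>t x. u2 t x - v x"
  shows "ip M (\<lambda>x. (W1 t x - W2 t x) - (W1 s x - W2 s x)) \<phi> = integral {s..t} (\<lambda>r. ns_form (W1 r) (W2 r) \<phi>)"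
proof -
  have C: "W1 \<in> C_H \<Omega>" "W2 \<in> C_H \<Omega>" using u1 u2 unfolding weak_solution_def W1_def W2_def by auto
  note \<phi>t = sol_test[OF \<phi>]
  note s1 = C_H_props(2)[OF C(1)] and s2 = C_H_props(2)[OF C(2)]
  define c where "c = (LINT x|M. advect v \<phi> x \<bullet> v x) + \<nu> * (LINT x|M. v x \<bullet> laplacian \<phi> x)"
  have e: "ip M (W1 t) \<phi> - ip M (W1 s) \<phi> = integral {s..t} (\<lambda>r. ns_form (W1 r) (\<lambda>x. 0) \<phi> + c)"
    "ip M (W2 t) \<phi> - ip M (W2 s) \<phi> = integral {s..t} (\<lambda>r. ns_form (W2 r) (\<lambda>x. 0) \<phi> + c)"
    unfolding W1_def W2_def c_def
    by (rule weak_identity[OF _ \<phi> _ s]; use u1 u2 in \<open>auto simp: weak_solution_def\<close>)+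
  have int: "(\<lambda>r. ns_form (W r) (\<lambda>x. 0) \<phi> + c) integrable_on {s..t}" if "W \<in> C_H \<Omega>" for W
    by (intro integrable_continuous_interval continuous_intros continuous_on_subset[OF ns_form_continuous[OF that zero_C_H \<phi>t]]) (use s in auto)
  have A: "ns_form (W1 r) (\<lambda>x. 0) \<phi> + c - (ns_form (W2 r) (\<lambda>x. 0) \<phi> + c) = ns_form (W1 r) (W2 r) \<phi>" if "r \<ge> 0" for r
    unfolding ns_form_def using s1[OF that] s2[OF that] sqi_test[OF test_laplacian[OF \<phi>t]]
    by (simp add: ip_diff_left algebra_simps)
  have "ip M (\<lambda>x. (W1 t x - W2 t x) - (W1 s x - W2 s x)) \<phi> = (ip M (W1 t) \<phi> - ip M (W1 s) \<phi>) - (ip M (W2 t) \<phi> - ip M (W2 s) \<phi>)"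
    using s1[of t] s1[of s] s2[of t] s2[of s] s sqi_test[OF \<phi>t] by (simp add: ip_diff_left sqi_diff)
  also have "\<dots> = integral {s..t} (\<lambda>r. ns_form (W1 r) (\<lambda>x. 0) \<phi> + c - (ns_form (W2 r) (\<lambda>x. 0) \<phi> + c))"
    unfolding e by (rule Henstock_Kurzweil_Integration.integral_diff[symmetric]) (rule int[OF C(1)] int[OF C(2)])+
  also have "\<dots> = integral {s..t} (\<lambda>r. ns_form (W1 r) (W2 r) \<phi>)"
    by (rule Henstock_Kurzweil_Integration.integral_cong) (use s A in auto)
  finally show ?thesis .
qed

text \<open>Both velocities have the same distributional limit at time zero, and continuity in L^2
  identifies it with the value at zero. Hence the initial difference is orthogonal to all test
  fields; being itself a limit of test fields, it is orthogonal to itself.\<close>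

lemma weak_solution_initial:
  assumes u1: "weak_solution \<nu> \<Omega> v u0 u1" and u2: "weak_solution \<nu> \<Omega> v u0 u2"
  defines "W1 \<equiv> \<lambda>t x. u1 t x - v x" and "W2 \<equiv> \<lambda>t x. u2 t x - v x"
  shows "nrm M (\<lambda>x. W1 0 x - W2 0 x) = 0"
proof -
  have C: "W1 \<in> C_H \<Omega>" "W2 \<in> C_H \<Omega>" using u1 u2 unfolding weak_solution_def W1_def W2_def by auto
  note s1 = C_H_props(2)[OF C(1)] and s2 = C_H_props(2)[OF C(2)]
  have orth: "ip M (\<lambda>x. W1 0 x - W2 0 x) \<phi> = 0" if \<phi>: "\<phi> \<in> test_functions \<Omega>" for \<phi>
  proof -
    note ps = sqi_test[OF \<phi>]
    note iv = bounded_test_integrable[OF v_measurable v_bound \<phi>]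
    have u: "(LINT x:\<Omega>|lebesgue. u1 t x \<bullet> \<phi> x) = ip M (W1 t) \<phi> + (LINT x|M. v x \<bullet> \<phi> x)"
      "(LINT x:\<Omega>|lebesgue. u2 t x \<bullet> \<phi> x) = ip M (W2 t) \<phi> + (LINT x|M. v x \<bullet> \<phi> x)" if "t \<ge> 0" for t
    proof -
      have "(LINT x|M. (W1 t x + v x) \<bullet> \<phi> x) = ip M (W1 t) \<phi> + (LINT x|M. v x \<bullet> \<phi> x)"
        "(LINT x|M. (W2 t x + v x) \<bullet> \<phi> x) = ip M (W2 t) \<phi> + (LINT x|M. v x \<bullet> \<phi> x)"
        using sqi_ip_integrable[OF s1[OF that] ps] sqi_ip_integrable[OF s2[OF that] ps] iv by (simp_all add: inner_add_left ip_def)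
      then show "(LINT x:\<Omega>|lebesgue. u1 t x \<bullet> \<phi> x) = ip M (W1 t) \<phi> + (LINT x|M. v x \<bullet> \<phi> x)"
        "(LINT x:\<Omega>|lebesgue. u2 t x \<bullet> \<phi> x) = ip M (W2 t) \<phi> + (LINT x|M. v x \<bullet> \<phi> x)"
        unfolding set_integral_M by (simp_all add: W1_def W2_def)
    qed
    have "((\<lambda>t. LINT x:\<Omega>|lebesgue. u1 t x \<bullet> \<phi> x) \<longlongrightarrow> (LINT x:\<Omega>|lebesgue. u0 x \<bullet> \<phi> x)) (at_right 0)"
      "((\<lambda>t. LINT x:\<Omega>|lebesgue. u2 t x \<bullet> \<phi> x) \<longlongrightarrow> (LINT x:\<Omega>|lebesgue. u0 x \<bullet> \<phi> x)) (at_right 0)"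
      using u1 u2 \<phi> unfolding weak_solution_def by auto
    from tendsto_diff[OF this] have "((\<lambda>t. (LINT x:\<Omega>|lebesgue. u1 t x \<bullet> \<phi> x) - (LINT x:\<Omega>|lebesgue. u2 t x \<bullet> \<phi> x)) \<longlongrightarrow> 0) (at_right 0)" by simp
    moreover have "\<forall>\<^sub>F t in at_right 0. (LINT x:\<Omega>|lebesgue. u1 t x \<bullet> \<phi> x) - (LINT x:\<Omega>|lebesgue. u2 t x \<bullet> \<phi> x) = ip M (W1 t) \<phi> - ip M (W2 t) \<phi>"
      using eventually_at_right_less[of 0] by eventually_elim (simp add: u)
    ultimately have l1: "((\<lambda>t. ip M (W1 t) \<phi> - ip M (W2 t) \<phi>) \<longlongrightarrow> 0) (at_right 0)"
      by (rule Lim_transform_eventually)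
    have "continuous_on {0..} (\<lambda>t. ip M (W1 t) \<phi> - ip M (W2 t) \<phi>)"
      by (intro continuous_intros ip_continuous C ps)
    then have "((\<lambda>t. ip M (W1 t) \<phi> - ip M (W2 t) \<phi>) \<longlongrightarrow> ip M (W1 0) \<phi> - ip M (W2 0) \<phi>) (at 0 within {0..})"
      unfolding continuous_on_def by auto
    then have "((\<lambda>t. ip M (W1 t) \<phi> - ip M (W2 t) \<phi>) \<longlongrightarrow> ip M (W1 0) \<phi> - ip M (W2 0) \<phi>) (at_right 0)"
      by (rule tendsto_within_subset) auto
    from tendsto_unique[OF trivial_limit_at_right_real l1 this]
    show ?thesis using s1[of 0] s2[of 0] ps by (simp add: ip_diff_left)
  qed
  let ?w = "\<lambda>x. W1 0 x - W2 0 x"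
  have w: "sqi M ?w" using s1[of 0] s2[of 0] by (simp add: sqi_diff)
  have "(nrm M ?w)\<^sup>2 = 0"
  proof (rule eq_zero_if_small[where C = "2 * nrm M ?w"])
    fix e :: real assume e: "e > 0"
    obtain p1 where p1: "p1 \<in> solenoidal_tests \<Omega>" "nrm M (\<lambda>x. W1 0 x - p1 x) < e" using H_approx[OF C_H_props(1)[OF C(1)] e] by auto
    obtain p2 where p2: "p2 \<in> solenoidal_tests \<Omega>" "nrm M (\<lambda>x. W2 0 x - p2 x) < e" using H_approx[OF C_H_props(1)[OF C(2)] e] by auto
    let ?p = "\<lambda>x. p1 x - p2 x"
    have pt: "?p \<in> test_functions \<Omega>" by (intro test_diff sol_test p1 p2)
    note q = sqi_test[OF sol_test[OF p1(1)]] sqi_test[OF sol_test[OF p2(1)]]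
    have "(\<lambda>x. ?w x - ?p x) = (\<lambda>x. (W1 0 x - p1 x) - (W2 0 x - p2 x))" by (auto simp: algebra_simps)
    then have "nrm M (\<lambda>x. ?w x - ?p x) \<le> nrm M (\<lambda>x. W1 0 x - p1 x) + nrm M (\<lambda>x. W2 0 x - p2 x)"
      using nrm_triangle_diff[OF sqi_diff[OF s1[of 0] q(1)] sqi_diff[OF s2[of 0] q(2)]] by simp
    then have le: "nrm M (\<lambda>x. ?w x - ?p x) \<le> 2 * e" using p1(2) p2(2) by linarith
    have "(nrm M ?w)\<^sup>2 = ip M ?w (\<lambda>x. ?w x - ?p x)"
      using ip_diff_right[OF w sqi_test[OF pt] w] orth[OF pt] by (simp add: nrm_sq_ip)
    also have "\<dots> \<le> nrm M ?w * nrm M (\<lambda>x. ?w x - ?p x)"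
      using ip_le[OF w sqi_diff[OF w sqi_test[OF pt]]] by linarith
    also have "\<dots> \<le> nrm M ?w * (2 * e)" by (intro mult_left_mono le) simp
    finally show "\<bar>(nrm M ?w)\<^sup>2\<bar> \<le> e * (2 * nrm M ?w)" by (simp add: mult_ac)
  qed simp
  then show ?thesis by simp
qed

end

section \<open>Finitely valued functions of time and dominated approximation in V\<close>

section \<open>Simple approximation in the Bochner space\<close>

text \<open>With a finite range, measurability of the level sets is enough; no sigma-algebra on the
  space of values has to be chosen.\<close>

definition simple_fun :: "(real \<Rightarrow> 'b) \<Rightarrow> bool" where
  "simple_fun s \<longleftrightarrow> finite (range s) \<and> (\<forall>f. {t. s t = f} \<in> sets lebesgue)"

lemma simple_fun_sets:
  assumes "simple_fun s" "\<And>f. f \<in> range s \<Longrightarrow> {t. Q t f} \<in> sets lebesgue"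
  shows "{t. Q t (s t)} \<in> sets lebesgue"
proof -
  have "{t. Q t (s t)} = (\<Union>f\<in>range s. {t. s t = f} \<inter> {t. Q t f})" by auto
  also have "\<dots> \<in> sets lebesgue" using assms unfolding simple_fun_def by (intro sets.finite_UN sets.Int) auto
  finally show ?thesis .
qed

text \<open>Time enters twice, through the value \<open>s t\<close> and directly. Freezing the value
  splits the real line into finitely many measurable pieces, on each of which only one scalar
  function matters.\<close>

lemma simple_fun_measurable:
  fixes F :: "'b \<Rightarrow> real \<Rightarrow> real"
  assumes "simple_fun s" "\<And>f. f \<in> range s \<Longrightarrow> F f \<in> borel_measurable lebesgue"
  shows "(\<lambda>t. F (s t) t) \<in> borel_measurable lebesgue"
proof (rule measurableI)
  fix A :: "real set" assume A: "A \<in> sets borel"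
  have "{t. F (s t) t \<in> A} \<in> sets lebesgue"
  proof (rule simple_fun_sets[OF assms(1)])
    fix f assume "f \<in> range s"
    from measurable_sets[OF assms(2)[OF this] A] show "{t. F f t \<in> A} \<in> sets lebesgue" by (simp add: vimage_def)
  qed
  then show "(\<lambda>t. F (s t) t) -` A \<inter> space lebesgue \<in> sets lebesgue" by (simp add: vimage_def)
qed simp

lemma simple_fun_map2:
  assumes "simple_fun s" "simple_fun r" shows "simple_fun (\<lambda>t. P (s t) (r t))"
  unfolding simple_fun_def[of "\<lambda>t. P (s t) (r t)"]
proof (intro conjI allI)
  have fin: "finite (range s)" "finite (range r)" using assms by (simp_all only: simple_fun_def)
  have "range (\<lambda>t. P (s t) (r t)) \<subseteq> (\<lambda>(f, g). P f g) ` (range s \<times> range r)" by auto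
  moreover have "finite ((\<lambda>(f, g). P f g) ` (range s \<times> range r))"
    by (rule finite_imageI[OF finite_cartesian_product[OF fin]])
  ultimately show "finite (range (\<lambda>t. P (s t) (r t)))" by (rule finite_subset)
  show "{t. P (s t) (r t) = h} \<in> sets lebesgue" for h
    by (rule simple_fun_sets[OF assms(1), where Q = "\<lambda>t f. P f (r t) = h"])
       (rule simple_fun_sets[OF assms(2), where Q = "\<lambda>t g. P _ g = h"], simp)
qed

context step_domain begin

lemma sol_zero: "(\<lambda>x. 0) \<in> solenoidal_tests \<Omega>"
  by (simp add: solenoidal_tests_def test_zero divergence_def)

lemma H1_norm_zero: "H1_norm \<Omega> (\<lambda>x. 0) = 0"
  using test_H1_norm[OF test_zero] by (simp add: nrm_def)

lemma sol_V: "\<phi> \<in> solenoidal_tests \<Omega> \<Longrightarrow> \<phi> \<in> V_space \<Omega>"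
  unfolding V_space_def using test_H1(1)[OF sol_test] H1_norm_zero by (auto intro!: bexI[of _ \<phi>])

text \<open>Approximation by simple functions with values in test functions is what replaces the
  continuity of translations in the Bochner space: below, only scalar functions of time are
  averaged.\<close>

lemma bochner_approx:
  assumes W: "W \<in> L2loc_V \<Omega>" and b: "0 < b" and \<epsilon>: "0 < \<epsilon>"
  obtains s D where "simple_fun s" "range s \<subseteq> solenoidal_tests \<Omega>"
    "integrable lebesgue D" "\<And>t. 0 \<le> D t" "integral\<^sup>L lebesgue D < \<epsilon>"
    "AE t in lebesgue. t \<in> {0..b} \<longrightarrow> W t \<in> V_space \<Omega> \<and> (H1_norm \<Omega> (\<lambda>x. W t x - s t x))\<^sup>2 \<le> D t"
proof -
  from W obtain s where s: "\<And>n. finite (range (s n))" "\<And>n. range (s n) \<subseteq> V_space \<Omega>" "\<And>n f. {t. s n t = f} \<in> sets lebesgue"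
    and lim: "AE t in lebesgue. 0 \<le> t \<longrightarrow> (\<lambda>n. H1_norm \<Omega> (\<lambda>x. s n t x - W t x)) \<longlonglongrightarrow> 0"
    unfolding L2loc_V_def by blast
  have WV: "AE t in lebesgue. 0 \<le> t \<longrightarrow> W t \<in> V_space \<Omega>" using W by (auto simp: L2loc_V_def)
  define g where "g t = H1_norm \<Omega> (W t)" for t
  have g2: "set_integrable lebesgue {0..b} (\<lambda>t. (g t)\<^sup>2)" using W b by (auto simp: L2loc_V_def g_def)
  have g0: "0 \<le> g t" for t by (simp add: g_def H1_norm_nonneg)
  \<comment> \<open>Integrability is given for the square of the H^1 norm; taking the root of the
    localized square recovers a measurable function that equals \<open>g\<close> on
    \<open>[0, b]\<close>.\<close>
  define gb where "gb t = sqrt (indicator {0..b} t * (g t)\<^sup>2)" for t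
  have gb: "gb t = g t" if "t \<in> {0..b}" for t using that g0 by (simp add: gb_def)
  have gbm: "gb \<in> borel_measurable lebesgue" unfolding gb_def
    using measurable_compose[OF borel_measurable_integrable[OF g2[unfolded set_integrable_def]]
      borel_measurable_continuous_onI[OF continuous_on_real_sqrt[OF continuous_on_id]]] by simp
  have sm: "simple_fun (s n)" for n using s by (auto simp: simple_fun_def)
  define P where "P n f = (SOME p. p \<in> solenoidal_tests \<Omega> \<and> H1_norm \<Omega> (\<lambda>x. f x - p x) < inverse (real (Suc n)))" for n f
  have P: "P n f \<in> solenoidal_tests \<Omega> \<and> H1_norm \<Omega> (\<lambda>x. f x - P n f x) < inverse (real (Suc n))" if "f \<in> V_space \<Omega>" for n f
  proof -
    have "0 < inverse (real (Suc n))" by simp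
    then have "\<exists>p. p \<in> solenoidal_tests \<Omega> \<and> H1_norm \<Omega> (\<lambda>x. f x - p x) < inverse (real (Suc n))"
      using that unfolding V_space_def by blast
    then show ?thesis unfolding P_def by (rule someI_ex)
  qed
  have sV: "s n t \<in> V_space \<Omega>" for n t using s(2) by auto
  \<comment> \<open>Truncation: values too large in norm are replaced by zero, which yields a
    majorant independent of \<open>n\<close>. At almost every time in \<open>[0, b]\<close> nothing
    is discarded once \<open>n\<close> is large.\<close>
  define T where "T n t h \<longleftrightarrow> t \<in> {0..b} \<and> H1_norm \<Omega> (P n h) \<le> 2 * gb t + 1" for n t h
  have Tm: "{t. T n t h} \<in> sets lebesgue" for n h
  proof -
    have "{t \<in> space lebesgue. H1_norm \<Omega> (P n h) \<le> 2 * gb t + 1} \<in> sets lebesgue" using gbm by measurable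
    then have "{0..b} \<inter> {t. H1_norm \<Omega> (P n h) \<le> 2 * gb t + 1} \<in> sets lebesgue" by (intro sets.Int) auto
    moreover have "{t. T n t h} = {0..b} \<inter> {t. H1_norm \<Omega> (P n h) \<le> 2 * gb t + 1}" by (auto simp: T_def)
    ultimately show ?thesis by simp
  qed
  define r where "r n t = (if T n t (s n t) then P n (s n t) else (\<lambda>x. 0))" for n t
  have r_sol: "r n t \<in> solenoidal_tests \<Omega>" for n t using P[OF sV] sol_zero by (simp add: r_def)
  have r_simple: "simple_fun (r n)" for n
    unfolding simple_fun_def
  proof (intro conjI allI)
    have "range (r n) \<subseteq> insert (\<lambda>x. 0) (P n ` range (s n))" by (auto simp: r_def)
    then show "finite (range (r n))" by (rule finite_subset) (intro finite.insertI finite_imageI[OF s(1)])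
    show "{t. r n t = f} \<in> sets lebesgue" for f
      unfolding r_def
    proof (rule simple_fun_sets[OF sm, where Q = "\<lambda>t h. (if T n t h then P n h else (\<lambda>x. 0)) = f"])
      fix h
      have "{t. (if T n t h then P n h else (\<lambda>x. 0)) = f} =
         ({t. T n t h} \<inter> (if P n h = f then UNIV else {})) \<union> ((UNIV - {t. T n t h}) \<inter> (if (\<lambda>x. 0) = f then UNIV else {}))"
        by auto
      also have "\<dots> \<in> sets lebesgue" using Tm[of n h] sets.compl_sets[OF Tm[of n h]] by (auto intro!: sets.Un)
      finally show "{t. (if T n t h then P n h else (\<lambda>x. 0)) = f} \<in> sets lebesgue" .
    qed
  qed
  obtain N where N: "N \<in> null_sets lebesgue" "\<And>t. t \<notin> N \<Longrightarrow> 0 \<le> t \<Longrightarrow> W t \<in> V_space \<Omega> \<and> (\<lambda>n. H1_norm \<Omega> (\<lambda>x. s n t x - W t x)) \<longlonglongrightarrow> 0"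
  proof -
    have "AE t in lebesgue. 0 \<le> t \<longrightarrow> W t \<in> V_space \<Omega> \<and> (\<lambda>n. H1_norm \<Omega> (\<lambda>x. s n t x - W t x)) \<longlonglongrightarrow> 0"
      using lim WV by eventually_elim auto
    then obtain N where N: "{t \<in> space lebesgue. \<not> (0 \<le> t \<longrightarrow> W t \<in> V_space \<Omega> \<and> (\<lambda>n. H1_norm \<Omega> (\<lambda>x. s n t x - W t x)) \<longlonglongrightarrow> 0)} \<subseteq> N" "N \<in> null_sets lebesgue"
      unfolding eventually_ae_filter by blast
    show ?thesis by (rule that[OF N(2)]) (use N(1) in auto)
  qed
  define G where "G = {0..b} - N"
  have Gm: "G \<in> sets lebesgue" using N(1) by (auto simp: G_def)
  have GW: "W t \<in> V_space \<Omega>" "(\<lambda>n. H1_norm \<Omega> (\<lambda>x. W t x - s n t x)) \<longlonglongrightarrow> 0" if "t \<in> G" for t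
  proof -
    show WV: "W t \<in> V_space \<Omega>" using that N(2)[of t] by (auto simp: G_def)
    have "(\<lambda>n. H1_norm \<Omega> (\<lambda>x. s n t x - W t x)) \<longlonglongrightarrow> 0" using that N(2)[of t] by (auto simp: G_def)
    then show "(\<lambda>n. H1_norm \<Omega> (\<lambda>x. W t x - s n t x)) \<longlonglongrightarrow> 0" using H1_norm_commute[OF V_H1[OF WV] V_H1[OF sV]] by simp
  qed
  define D where "D n t = indicator G t * (H1_norm \<Omega> (\<lambda>x. W t x - r n t x))\<^sup>2" for n t
  \<comment> \<open>\<open>W\<close> is not simple, so the distance to \<open>r n\<close> is
    obtained as the limit in \<open>m\<close> of the distances from \<open>s m\<close> to
    \<open>r n\<close>, which are measurable. The indicator of \<open>G\<close> removes the
    exceptional null set, so the limit holds at every time.\<close>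
  have Dm: "D n \<in> borel_measurable lebesgue" for n
  proof (rule borel_measurable_LIMSEQ_metric)
    define e where "e m t = indicator G t * (H1_norm \<Omega> (\<lambda>x. s m t x - r n t x))\<^sup>2" for m t
    show "e m \<in> borel_measurable lebesgue" for m
    proof -
      have "(\<lambda>t. H1_norm \<Omega> (\<lambda>x. s m t x - r n t x)) \<in> borel_measurable lebesgue"
        by (rule simple_fun_measurable[OF sm, where F = "\<lambda>f t. H1_norm \<Omega> (\<lambda>x. f x - r n t x)"])
           (rule simple_fun_measurable[OF r_simple, where F = "\<lambda>h t. H1_norm \<Omega> (\<lambda>x. _ x - h x)"], simp)
      then show ?thesis unfolding e_def using Gm by (intro borel_measurable_times borel_measurable_indicator borel_measurable_power)
    qed
    show "(\<lambda>m. e m t) \<longlonglongrightarrow> D n t" for t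
    proof (cases "t \<in> G")
      case True
      note H = V_H1[OF GW(1)[OF True]] V_H1[OF sV] test_H1(1)[OF sol_test[OF r_sol]]
      have "(\<lambda>m. H1_norm \<Omega> (\<lambda>x. s m t x - r n t x) - H1_norm \<Omega> (\<lambda>x. W t x - r n t x)) \<longlonglongrightarrow> 0"
      proof (rule Lim_null_comparison[OF _ GW(2)[OF True]], intro always_eventually allI)
        fix m
        show "norm (H1_norm \<Omega> (\<lambda>x. s m t x - r n t x) - H1_norm \<Omega> (\<lambda>x. W t x - r n t x)) \<le> H1_norm \<Omega> (\<lambda>x. W t x - s m t x)"
          using H1_norm_triangle[OF H(2)[of m t] H(1) H(3)[of n t]] H1_norm_triangle[OF H(1) H(2)[of m t] H(3)[of n t]]
            H1_norm_commute[OF H(1) H(2)[of m t]] by (simp add: abs_le_iff)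
      qed
      then have "(\<lambda>m. H1_norm \<Omega> (\<lambda>x. s m t x - r n t x)) \<longlonglongrightarrow> H1_norm \<Omega> (\<lambda>x. W t x - r n t x)" by (rule LIM_zero_cancel)
      then show ?thesis unfolding e_def D_def by (intro tendsto_intros)
    qed (simp add: e_def D_def)
  qed
  \<comment> \<open>The triangle inequality adds \<open>g\<close> and the truncation level
    \<open>2 * g + 1\<close>; then \<open>(3 g + 1)^2 \<le> 18 g^2 + 2\<close>.\<close>
  have Dle: "D n t \<le> indicator {0..b} t * (18 * (g t)\<^sup>2 + 2)" for n t
  proof (cases "t \<in> G")
    case True
    then have tb: "t \<in> {0..b}" by (auto simp: G_def)
    note H = V_H1[OF GW(1)[OF True]] test_H1(1)[OF sol_test[OF r_sol[of n t]]]
    have "H1_norm \<Omega> (r n t) \<le> 2 * g t + 1"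
      using gb[OF tb] g0[of t] by (auto simp: r_def T_def H1_norm_zero)
    moreover have "H1_norm \<Omega> (\<lambda>x. W t x - r n t x) \<le> H1_norm \<Omega> (W t) + H1_norm \<Omega> (r n t)"
      using H1_norm_triangle[OF H(1) test_H1(1)[OF test_zero] H(2)] H1_norm_commute[OF test_H1(1)[OF test_zero] H(2)] by simp
    ultimately have "H1_norm \<Omega> (\<lambda>x. W t x - r n t x) \<le> 3 * g t + 1" by (simp add: g_def)
    then have "(H1_norm \<Omega> (\<lambda>x. W t x - r n t x))\<^sup>2 \<le> (3 * g t + 1)\<^sup>2" by (rule power_mono) (rule H1_norm_nonneg)
    also have "\<dots> \<le> 18 * (g t)\<^sup>2 + 2" using sum_squares_bound[of "3 * g t" 1] by (simp add: power2_sum power_mult_distrib)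
    finally show ?thesis using tb True by (simp add: D_def)
  next
    case False
    have "0 \<le> 18 * (g t)\<^sup>2 + 2" by simp
    then show ?thesis using False by (simp add: D_def indicator_def)
  qed
  have D0: "0 \<le> D n t" for n t by (simp add: D_def)
  have bi: "integrable lebesgue (\<lambda>t. indicator {0..b} t * (18 * (g t)\<^sup>2 + 2) :: real)"
  proof -
    have "set_integrable lebesgue {0..b} (\<lambda>t. 18 * (g t)\<^sup>2 + 2)"
      by (intro set_integral_add set_integrable_mult_right g2 absolutely_integrable_continuous_real continuous_intros)
    then show ?thesis by (simp add: set_integrable_def)
  qed
  have Di: "integrable lebesgue (D n)" for n
    by (rule Bochner_Integration.integrable_bound[OF bi Dm]) (use Dle D0 in \<open>auto intro!: AE_I2 order_trans[OF Dle abs_ge_self]\<close>)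
  have Dlim: "(\<lambda>n. D n t) \<longlonglongrightarrow> 0" for t
  proof (cases "t \<in> G")
    case True
    then have tb: "t \<in> {0..b}" by (auto simp: G_def)
    note H = V_H1[OF GW(1)[OF True]] V_H1[OF sV] test_H1(1)[OF sol_test[OF P[THEN conjunct1, OF sV]]]
    define q where "q n = H1_norm \<Omega> (\<lambda>x. W t x - P n (s n t) x)" for n
    have q0: "q \<longlonglongrightarrow> 0"
    proof (rule Lim_null_comparison)
      show "(\<lambda>n. H1_norm \<Omega> (\<lambda>x. W t x - s n t x) + inverse (real (Suc n))) \<longlonglongrightarrow> 0"
        using tendsto_add[OF GW(2)[OF True] LIMSEQ_inverse_real_of_nat] by simp
      show "\<forall>\<^sub>F n in sequentially. norm (q n) \<le> H1_norm \<Omega> (\<lambda>x. W t x - s n t x) + inverse (real (Suc n))"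
      proof (intro always_eventually allI)
        fix n
        have "q n \<le> H1_norm \<Omega> (\<lambda>x. W t x - s n t x) + H1_norm \<Omega> (\<lambda>x. s n t x - P n (s n t) x)"
          unfolding q_def by (rule H1_norm_triangle[OF H])
        moreover have "H1_norm \<Omega> (\<lambda>x. s n t x - P n (s n t) x) < inverse (real (Suc n))" using P[OF sV] by blast
        moreover have "0 \<le> q n" by (simp add: q_def H1_norm_nonneg)
        ultimately show "norm (q n) \<le> H1_norm \<Omega> (\<lambda>x. W t x - s n t x) + inverse (real (Suc n))" by simp
      qed
    qed
    have "\<forall>\<^sub>F n in sequentially. q n < 1" by (rule order_tendstoD(2)[OF q0]) simp
    \<comment> \<open>As soon as \<open>q n < 1\<close> the approximant has norm at most
      \<open>g t + 1\<close>, so it passes the truncation.\<close>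
    then have "\<forall>\<^sub>F n in sequentially. (q n)\<^sup>2 = D n t"
    proof eventually_elim
      case (elim n)
      have Hp: "P n (s n t) \<in> H1 \<Omega>" using P[OF sV] by (intro test_H1 sol_test) blast
      have "H1_norm \<Omega> (P n (s n t)) \<le> g t + q n"
        using H1_norm_diff_abs[OF H(1) Hp] by (simp add: q_def g_def abs_le_iff)
      then have "T n t (s n t)" using elim tb gb[OF tb] g0[of t] by (simp add: T_def)
      then show ?case using True by (simp add: D_def r_def q_def)
    qed
    moreover have "(\<lambda>n. (q n)\<^sup>2) \<longlonglongrightarrow> 0" using tendsto_power[OF q0, of 2] by simp
    ultimately show ?thesis by (rule Lim_transform_eventually[rotated])
  qed (simp add: D_def)
  have "(\<lambda>n. integral\<^sup>L lebesgue (D n)) \<longlonglongrightarrow> integral\<^sup>L lebesgue (\<lambda>t::real. 0 :: real)"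
  proof (rule integral_dominated_convergence)
    show "AE t in lebesgue. norm (D n t) \<le> indicator {0..b} t * (18 * (g t)\<^sup>2 + 2)" for n
      using Dle D0 by (intro AE_I2) simp
  qed (use Dm bi Dlim in auto)
  then have "\<forall>\<^sub>F n in sequentially. integral\<^sup>L lebesgue (D n) < \<epsilon>" using \<epsilon> by (auto dest: order_tendstoD(2))
  then obtain n where n: "integral\<^sup>L lebesgue (D n) < \<epsilon>" by (auto simp: eventually_sequentially)
  show ?thesis
  proof (rule that[OF r_simple[of n] _ Di[of n] D0 n])
    show "range (r n) \<subseteq> solenoidal_tests \<Omega>" using r_sol by auto
    show "AE t in lebesgue. t \<in> {0..b} \<longrightarrow> W t \<in> V_space \<Omega> \<and> (H1_norm \<Omega> (\<lambda>x. W t x - r n t x))\<^sup>2 \<le> D n t"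
      using AE_not_in[OF N(1)] by eventually_elim (use GW(1) in \<open>auto simp: G_def D_def\<close>)
  qed
qed

end

section \<open>Almost everywhere comparison of integrals and a Gronwall lemma for zero initial
  data\<close>

section \<open>Gronwall's inequality\<close>

text \<open>Membership in V is known for almost every time only, so gauge integrals are compared
  through the Lebesgue integral.\<close>

lemma hk_mono_AE:
  fixes f g :: "real \<Rightarrow> real"
  assumes "f absolutely_integrable_on {a..b}" "g absolutely_integrable_on {a..b}"
    "AE x in lebesgue. x \<in> {a..b} \<longrightarrow> f x \<le> g x"
  shows "integral {a..b} f \<le> integral {a..b} g"
  unfolding set_lebesgue_integral_eq_integral(2)[OF assms(1), symmetric] set_lebesgue_integral_eq_integral(2)[OF assms(2), symmetric]
  unfolding set_lebesgue_integral_def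
  by (rule integral_mono_AE) (use assms in \<open>auto simp: set_integrable_def indicator_def\<close>)

lemma abs_integrable_mult_continuous:
  fixes k E :: "real \<Rightarrow> real"
  assumes "k absolutely_integrable_on {a..b}" "continuous_on {a..b} E"
  shows "(\<lambda>t. k t * E t) absolutely_integrable_on {a..b}"
proof -
  have "(\<lambda>t. E t * k t) absolutely_integrable_on {a..b}"
  proof (rule absolutely_integrable_bounded_measurable_product_real[OF _ _ _ assms(1)])
    show "E \<in> borel_measurable (lebesgue_on {a..b})"
      by (rule continuous_imp_measurable_on_sets_lebesgue[OF assms(2)]) simp
    show "bounded (E ` {a..b})" by (intro compact_imp_bounded compact_continuous_image assms(2)) simp
  qed simp
  then show ?thesis by (simp add: mult.commute)
qed

text \<open>No exponential is used. On an interval over which \<open>k\<close> has integral below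
  1/2 and at whose left end \<open>E\<close> vanishes, the maximum of \<open>E\<close> is at most
  half of itself, hence zero. Uniform continuity of the primitive of \<open>k\<close> gives a common
  interval length \<open>\<delta>\<close>, and \<open>[0, T]\<close> is exhausted by
  induction.\<close>

lemma gronwall_zero:
  fixes E k :: "real \<Rightarrow> real"
  assumes E: "continuous_on {0..} E" "\<And>t. t \<ge> 0 \<Longrightarrow> 0 \<le> E t" "E 0 = 0"
    and k: "\<And>t. 0 \<le> k t" "\<And>T. T > 0 \<Longrightarrow> k absolutely_integrable_on {0..T}"
    and le: "\<And>a b. 0 < a \<Longrightarrow> a < b \<Longrightarrow> E b - E a \<le> integral {a..b} (\<lambda>t. k t * E t)"
    and T: "0 \<le> T"
  shows "E T = 0"
proof (cases "T = 0")
  case True then show ?thesis using E by simp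
next
  case False
  with T have T: "T > 0" by simp
  have kE: "(\<lambda>t. k t * E t) absolutely_integrable_on {a..b}" if "0 \<le> a" "b > 0" for a b
  proof -
    have "k absolutely_integrable_on {a..b}" by (rule absolutely_integrable_on_subinterval[OF k(2)[OF that(2)]]) (use that in auto)
    then show ?thesis by (rule abs_integrable_mult_continuous) (rule continuous_on_subset[OF E(1)], use that in auto)
  qed
  \<comment> \<open>The inequality is assumed for positive left endpoints, where test functions in
    time can live; continuity of \<open>E\<close> from the right admits the endpoint zero.\<close>
  have le0: "E b - E a \<le> integral {a..b} (\<lambda>t. k t * E t)" if ab: "0 \<le> a" "a < b" for a b
  proof (cases "a = 0")
    case False then show ?thesis using le ab by simp
  next
    case True
    have "E b - E c \<le> integral {0..b} (\<lambda>t. k t * E t)" if c: "0 < c" "c < b" for c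
    proof -
      have "E b - E c \<le> integral {c..b} (\<lambda>t. k t * E t)" by (rule le[OF c])
      also have "\<dots> \<le> integral {0..b} (\<lambda>t. k t * E t)"
      proof (rule integral_subset_le)
        show "(\<lambda>t. k t * E t) integrable_on {c..b}" "(\<lambda>t. k t * E t) integrable_on {0..b}"
          using kE[of c b] kE[of 0 b] c by (auto intro: set_lebesgue_integral_eq_integral(1))
      qed (use c k E in auto)
      finally show ?thesis .
    qed
    then have ev: "\<forall>\<^sub>F c in at_right 0. E b - E c \<le> integral {0..b} (\<lambda>t. k t * E t)"
      using ab True by (auto simp: eventually_at_right_field)
    have "(E \<longlongrightarrow> E 0) (at 0 within {0..})" using E(1) by (auto simp: continuous_on_def)
    then have "(E \<longlongrightarrow> E 0) (at_right 0)" by (rule tendsto_within_subset) auto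
    then have "((\<lambda>c. E b - E c) \<longlongrightarrow> E b - E 0) (at_right 0)" by (intro tendsto_intros)
    from tendsto_upperbound[OF this ev trivial_limit_at_right_real] show ?thesis using True by simp
  qed
  define K where "K t = integral {0..t} k" for t
  have ki: "k integrable_on {0..T}" using k(2)[OF T] by (rule set_lebesgue_integral_eq_integral(1))
  have Kc: "uniformly_continuous_on {0..T} K" unfolding K_def
    by (rule compact_uniformly_continuous[OF indefinite_integral_continuous_1[OF ki]]) simp
  obtain \<delta> where \<delta>: "\<delta> > 0" "\<And>s t. s \<in> {0..T} \<Longrightarrow> t \<in> {0..T} \<Longrightarrow> dist t s < \<delta> \<Longrightarrow> dist (K t) (K s) < 1/2"
    using Kc unfolding uniformly_continuous_on_def by (metis half_gt_zero_iff zero_less_one)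
  have step: "E t = 0" if z: "\<And>r. r \<in> {0..s} \<Longrightarrow> E r = 0" and s: "0 \<le> s" "s \<le> t" "t \<le> T" "t - s < \<delta>" for s t
  proof (cases "s = t")
    case True then show ?thesis using z s by auto
  next
    case False
    then have st: "s < t" using s by simp
    have "\<exists>m\<in>{s..t}. \<forall>r\<in>{s..t}. E r \<le> E m"
      by (rule continuous_attains_sup) (use s in \<open>auto intro: continuous_on_subset[OF E(1)]\<close>)
    then obtain m where m: "m \<in> {s..t}" "\<And>r. r \<in> {s..t} \<Longrightarrow> E r \<le> E m" by blast
    have Em: "0 \<le> E m" using m s E(2) by auto
    have "E m = 0"
    proof (cases "m = s")
      case True then show ?thesis using z s by auto
    next
      case False
      then have sm: "s < m" using m by simp
      have kI: "k absolutely_integrable_on {s..m}" by (rule absolutely_integrable_on_subinterval[OF k(2)[OF T]]) (use m s in auto)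
      have "E m = E m - E s" using z[of s] s by simp
      also have "\<dots> \<le> integral {s..m} (\<lambda>t. k t * E t)" by (rule le0[OF s(1) sm])
      also have "\<dots> \<le> integral {s..m} (\<lambda>t. k t * E m)"
      proof (rule integral_le)
        show "(\<lambda>t. k t * E t) integrable_on {s..m}" by (rule set_lebesgue_integral_eq_integral(1)[OF kE]) (use s sm in auto)
        show "(\<lambda>t. k t * E m) integrable_on {s..m}"
          by (rule integrable_on_mult_left[OF set_lebesgue_integral_eq_integral(1)[OF kI]])
        show "k r * E r \<le> k r * E m" if "r \<in> {s..m}" for r using that m k(1) by (intro mult_left_mono) auto
      qed
      also have "\<dots> = integral {s..m} k * E m" by simp
      also have "integral {s..m} k = K m - K s" unfolding K_def
        using Henstock_Kurzweil_Integration.integral_combine[of 0 s m k] integrable_on_subinterval[OF ki, of 0 m] s m by auto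
      also have "(K m - K s) * E m \<le> 1/2 * E m"
      proof (rule mult_right_mono[OF _ Em])
        have "dist (K m) (K s) < 1/2" by (rule \<delta>(2)) (use s m in \<open>auto simp: dist_real_def\<close>)
        then show "K m - K s \<le> 1/2" unfolding dist_real_def by linarith
      qed
      finally show ?thesis using Em by simp
    qed
    then show ?thesis using m(2)[of t] E(2)[of t] s by force
  qed
  \<comment> \<open>Advancing by \<open>\<delta> / 2\<close> keeps every step strictly shorter than
    \<open>\<delta>\<close>.\<close>
  have "E t = 0" if "t \<in> {0..T}" "t \<le> real n * (\<delta> / 2)" for n t
    using that
  proof (induction n arbitrary: t)
    case 0 then show ?case using E by auto
  next
    case (Suc n)
    show ?case
    proof (cases "t \<le> real n * (\<delta> / 2)")
      case True then show ?thesis using Suc by blast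
    next
      case False
      show ?thesis
      proof (rule step[where s = "real n * (\<delta> / 2)"])
        show "E r = 0" if "r \<in> {0..real n * (\<delta> / 2)}" for r
          using Suc.IH[of r] that False Suc.prems by auto
        show "t - real n * (\<delta> / 2) < \<delta>" using Suc.prems(2) \<delta>(1) by (simp add: algebra_simps)
      qed (use False Suc.prems \<delta>(1) in auto)
    qed
  qed
  moreover obtain n where "T < real n * (\<delta> / 2)" using reals_Archimedean3[of "\<delta> / 2"] \<delta>(1) by auto
  ultimately show ?thesis using T by (metis atLeastAtMost_iff less_eq_real_def order_refl)
qed

section \<open>Averaged increments over backward steps and their limit\<close>

section \<open>The energy inequality\<close>

lemma continuous_on_Ici:
  fixes f :: "real \<Rightarrow> real"
  assumes "\<And>T. T > 0 \<Longrightarrow> continuous_on {0..T} f" shows "continuous_on {0..} f"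
  unfolding continuous_on_eq_continuous_within
proof
  fix x :: real assume x: "x \<in> {0..}"
  have "continuous (at x within {0..x+1}) f"
    using assms[of "x + 1"] x by (auto simp: continuous_on_eq_continuous_within)
  moreover have "at x within {0..} = at x within {0..x+1}"
    by (rule at_within_nhd[of x "{..<x+1}"]) auto
  ultimately show "continuous (at x within {0..}) f" by simp
qed

lemma primitive_backward_quotient:
  fixes f :: "real \<Rightarrow> real" and h :: "nat \<Rightarrow> real"
  assumes f: "continuous_on {0..} f" and x: "0 < x" and h: "\<And>n. 0 < h n" "h \<longlonglongrightarrow> 0"
  shows "(\<lambda>n. (integral {0..x} f - integral {0..x - h n} f) / h n) \<longlonglongrightarrow> f x"
proof -
  \<comment> \<open>The interval extends past \<open>x\<close>, which makes \<open>x\<close>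
    interior, so the derivative may be taken along the negative increments
    \<open>- h n\<close>.\<close>
  have "((\<lambda>u. integral {0..u} f) has_real_derivative f x) (at x within {0..x+1})"
    by (rule integral_has_real_derivative) (use x in \<open>auto intro: continuous_on_subset[OF f]\<close>)
  then have "((\<lambda>u. integral {0..u} f) has_real_derivative f x) (at x within {0<..<x+1})"
    by (rule has_field_derivative_subset) auto
  then have "((\<lambda>u. integral {0..u} f) has_real_derivative f x) (at x)"
    using at_within_open[of x "{0<..<x+1}"] x by simp
  then have "((\<lambda>k. (integral {0..x + k} f - integral {0..x} f) / k) \<longlongrightarrow> f x) (at 0)"
    by (simp add: DERIV_def)
  moreover have "filterlim (\<lambda>n. - h n) (at 0) sequentially"
    using tendsto_minus[OF h(2)] h(1) by (intro filterlim_atI) (auto intro!: always_eventually simp: less_imp_neq[symmetric])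
  ultimately have "(\<lambda>n. (integral {0..x + - h n} f - integral {0..x} f) / (- h n)) \<longlonglongrightarrow> f x"
    by (rule filterlim_compose)
  then show ?thesis by (simp add: minus_divide_left diff_divide_distrib)
qed

text \<open>After a shift of the integration variable the bulk of the two integrals cancels;
  averages of \<open>f\<close> over short intervals ending at \<open>b\<close> and at
  \<open>a\<close> remain. The condition \<open>h n < a\<close> keeps the shifted times
  positive.\<close>

lemma average_difference:
  fixes f :: "real \<Rightarrow> real" and h :: "nat \<Rightarrow> real"
  assumes f: "continuous_on {0..} f" and ab: "0 < a" "a < b" and h: "\<And>n. 0 < h n" "\<And>n. h n < a" "h \<longlonglongrightarrow> 0"
  shows "(\<lambda>n. integral {a..b} (\<lambda>t. (f t - f (t - h n)) / h n)) \<longlonglongrightarrow> f b - f a"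
proof -
  have fi: "f integrable_on {c..d}" if "0 \<le> c" for c d
    by (rule integrable_continuous_interval, rule continuous_on_subset[OF f]) (use that in auto)
  have comb: "integral {c..d} f = integral {0..d} f - integral {0..c} f" if "0 \<le> c" "c \<le> d" for c d
    using Henstock_Kurzweil_Integration.integral_combine[of 0 c d f] fi[of 0 d] that by simp
  have eq: "integral {a..b} (\<lambda>t. (f t - f (t - h n)) / h n) =
      (integral {0..b} f - integral {0..b - h n} f) / h n - (integral {0..a} f - integral {0..a - h n} f) / h n" for n
  proof -
    have sh: "integral {a..b} (\<lambda>t. f (t - h n)) = integral {a - h n..b - h n} f"
      using integral_shift_Icc_real[of a b f "- h n"] by (simp add: o_def)
    have i2: "(\<lambda>t. f (t - h n)) integrable_on {a..b}"
      by (intro integrable_continuous_interval continuous_on_compose2[OF f])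
         (use ab h(2)[of n] in \<open>auto intro!: continuous_intros\<close>)
    have "integral {a..b} (\<lambda>t. (f t - f (t - h n)) / h n) = integral {a..b} (\<lambda>t. f t - f (t - h n)) / h n"
      by simp
    also have "integral {a..b} (\<lambda>t. f t - f (t - h n)) = integral {a..b} f - integral {a - h n..b - h n} f"
      unfolding sh[symmetric] by (rule Henstock_Kurzweil_Integration.integral_diff[OF _ i2]) (use fi ab in simp)
    also have "\<dots> = (integral {0..b} f - integral {0..a} f) - (integral {0..b - h n} f - integral {0..a - h n} f)"
      using comb[of a b] comb[of "a - h n" "b - h n"] ab h(2)[of n] by simp
    finally show ?thesis by (simp add: diff_divide_distrib)
  qed
  show ?thesis unfolding eq
    by (intro tendsto_diff primitive_backward_quotient f h) (use ab in auto)
qed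

context ns_setting begin

lemma V_diff:
  assumes "a \<in> V_space \<Omega>" "b \<in> V_space \<Omega>" shows "(\<lambda>x. a x - b x) \<in> V_space \<Omega>"
  unfolding V_space_def
proof (intro CollectI conjI allI impI)
  show "(\<lambda>x. a x - b x) \<in> H1 \<Omega>" by (intro H1_diff V_H1 assms)
  fix e :: real assume "e > 0"
  then have e: "e / 2 > 0" by simp
  obtain p where p: "p \<in> solenoidal_tests \<Omega>" "H1_norm \<Omega> (\<lambda>x. a x - p x) < e / 2"
    using assms(1) e unfolding V_space_def by blast
  obtain q where q: "q \<in> solenoidal_tests \<Omega>" "H1_norm \<Omega> (\<lambda>x. b x - q x) < e / 2"
    using assms(2) e unfolding V_space_def by blast
  have "H1_norm \<Omega> (\<lambda>x. (a x - b x) - (p x - q x)) \<le> H1_norm \<Omega> (\<lambda>x. a x - p x) + H1_norm \<Omega> (\<lambda>x. b x - q x)"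
    by (intro H1_norm_diff_diff V_H1 assms test_H1(1) sol_test p q)
  then show "\<exists>\<phi>\<in>solenoidal_tests \<Omega>. H1_norm \<Omega> (\<lambda>x. (a x - b x) - \<phi> x) < e"
    using p q sol_diff[OF p(1) q(1)] by (intro bexI[of _ "\<lambda>x. p x - q x"]) auto
qed

end

text \<open>From here on the equation is used only through \<open>identity\<close>, the integrated
  form for increments of the difference tested with time-independent solenoidal fields.\<close>

locale two_solutions = ns_setting +
  fixes W1 W2 :: "real \<Rightarrow> complex \<Rightarrow> complex"
  assumes C1H: "W1 \<in> C_H \<Omega>" and C2H: "W2 \<in> C_H \<Omega>"
    and L1V: "W1 \<in> L2loc_V \<Omega>" and L2V: "W2 \<in> L2loc_V \<Omega>"
    and identity: "\<And>\<phi> s t. \<phi> \<in> solenoidal_tests \<Omega> \<Longrightarrow> 0 < s \<Longrightarrow> s < t \<Longrightarrow>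
      ip (lebesgue_on \<Omega>) (\<lambda>x. (W1 t x - W2 t x) - (W1 s x - W2 s x)) \<phi> = integral {s..t} (\<lambda>r. ns_form (W1 r) (W2 r) \<phi>)"
begin

definition "w t = (\<lambda>x. W1 t x - W2 t x)"
definition "energy t = (nrm M (w t))\<^sup>2"
definition "weight t = h1_weight (W1 t) (W2 t)"

lemmas W1s = C_H_props(2)[OF C1H] and W2s = C_H_props(2)[OF C2H]

lemma w_sqi: "t \<ge> 0 \<Longrightarrow> sqi M (w t)" unfolding w_def by (intro sqi_diff W1s W2s)

lemma nrm_continuous:
  assumes "W \<in> C_H \<Omega>" shows "continuous_on {0..} (\<lambda>t. nrm M (W t))"
  unfolding continuous_on_def
proof
  fix t :: real assume t: "t \<in> {0..}"
  show "((\<lambda>t. nrm M (W t)) \<longlongrightarrow> nrm M (W t)) (at t within {0..})"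
  proof (rule LIM_zero_cancel, rule Lim_null_comparison)
    show "((\<lambda>s. nrm M (\<lambda>x. W s x - W t x)) \<longlongrightarrow> 0) (at t within {0..})" using C_H_props(3)[OF assms] t by simp
    show "\<forall>\<^sub>F s in at t within {0..}. norm (nrm M (W s) - nrm M (W t)) \<le> nrm M (\<lambda>x. W s x - W t x)"
      using at_within_ev[of "{0..}" t] by eventually_elim (use C_H_props(2)[OF assms] t in \<open>auto intro!: nrm_diff_abs\<close>)
  qed
qed

lemma energy_continuous: "continuous_on {0..} energy"
proof -
  have "((\<lambda>s. nrm M (w s)) \<longlongrightarrow> nrm M (w t)) (at t within {0..})" if t: "t \<in> {0..}" for t
  proof (rule LIM_zero_cancel, rule Lim_null_comparison)
    show "((\<lambda>s. nrm M (\<lambda>x. W1 s x - W1 t x) + nrm M (\<lambda>x. W2 s x - W2 t x)) \<longlongrightarrow> 0) (at t within {0..})"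
      using tendsto_add[OF C_H_props(3)[OF C1H] C_H_props(3)[OF C2H], of t] t by simp
    show "\<forall>\<^sub>F s in at t within {0..}. norm (nrm M (w s) - nrm M (w t)) \<le> nrm M (\<lambda>x. W1 s x - W1 t x) + nrm M (\<lambda>x. W2 s x - W2 t x)"
      using at_within_ev[of "{0..}" t]
    proof eventually_elim
      fix s :: real assume s: "s \<in> {0..}"
      have "norm (nrm M (w s) - nrm M (w t)) \<le> nrm M (\<lambda>x. w s x - w t x)"
        using nrm_diff_abs[OF w_sqi w_sqi] s t by simp
      also have "(\<lambda>x. w s x - w t x) = (\<lambda>x. (W1 s x - W1 t x) - (W2 s x - W2 t x))" by (auto simp: w_def)
      also have "nrm M \<dots> \<le> nrm M (\<lambda>x. W1 s x - W1 t x) + nrm M (\<lambda>x. W2 s x - W2 t x)"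
        by (intro nrm_triangle_diff sqi_diff W1s W2s) (use s t in auto)
      finally show "norm (nrm M (w s) - nrm M (w t)) \<le> nrm M (\<lambda>x. W1 s x - W1 t x) + nrm M (\<lambda>x. W2 s x - W2 t x)" .
    qed
  qed
  then show ?thesis unfolding energy_def continuous_on_def by (auto intro!: tendsto_power)
qed

lemma energy_nonneg: "0 \<le> energy t" by (simp add: energy_def)

lemma weight_ge: "1 \<le> weight t" by (simp add: weight_def h1_weight_def)

lemma weight_integrable: "T > 0 \<Longrightarrow> weight absolutely_integrable_on {0..T}"
proof -
  assume T: "T > 0"
  have "set_integrable lebesgue {0..T} (\<lambda>t. (H1_norm \<Omega> (W1 t))\<^sup>2)" "set_integrable lebesgue {0..T} (\<lambda>t. (H1_norm \<Omega> (W2 t))\<^sup>2)"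
    using L1V L2V T by (auto simp: L2loc_V_def)
  moreover have "set_integrable lebesgue {0..T} (\<lambda>t. 1 :: real)" by (intro absolutely_integrable_continuous_real continuous_intros)
  ultimately show ?thesis unfolding weight_def h1_weight_def by (intro set_integral_add)
qed

lemma weight_integrable_sub: "0 \<le> a \<Longrightarrow> 0 < b \<Longrightarrow> weight absolutely_integrable_on {a..b}"
  by (rule absolutely_integrable_on_subinterval[OF weight_integrable]) auto

definition "weight_int t = integral {0..t} weight"

lemma weight_int_continuous: "continuous_on {0..} weight_int"
  unfolding weight_int_def
  by (rule continuous_on_Ici) (intro indefinite_integral_continuous_1 set_lebesgue_integral_eq_integral(1) weight_integrable)

lemma weight_int_diff: "0 \<le> s \<Longrightarrow> s < t \<Longrightarrow> integral {s..t} weight = weight_int t - weight_int s"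
  unfolding weight_int_def
  using Henstock_Kurzweil_Integration.integral_combine[of 0 s t weight] set_lebesgue_integral_eq_integral(1)[OF weight_integrable[of t]] by simp

lemma bound_R: obtains R where "R \<ge> 0" "\<And>t. t \<in> {0..b} \<Longrightarrow> nrm M (W1 t) \<le> R \<and> nrm M (W2 t) \<le> R"
proof -
  have "bounded ((\<lambda>t. nrm M (W1 t)) ` {0..b})" "bounded ((\<lambda>t. nrm M (W2 t)) ` {0..b})"
    by (intro compact_imp_bounded compact_continuous_image continuous_on_subset[OF nrm_continuous[OF C1H]]
      continuous_on_subset[OF nrm_continuous[OF C2H]]; auto)+
  then obtain R1 R2 where "\<And>t. t \<in> {0..b} \<Longrightarrow> nrm M (W1 t) \<le> R1" "\<And>t. t \<in> {0..b} \<Longrightarrow> nrm M (W2 t) \<le> R2"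
    unfolding bounded_iff by (metis (no_types, lifting) abs_le_D1 imageI real_norm_def)
  then show ?thesis by (intro that[of "max 0 (max R1 R2)"]) fastforce+
qed

abbreviation "At t \<phi> \<equiv> ns_form (W1 t) (W2 t) \<phi>"

lemma At_continuous: "\<phi> \<in> solenoidal_tests \<Omega> \<Longrightarrow> continuous_on {0..} (\<lambda>t. At t \<phi>)"
  by (rule ns_form_continuous[OF C1H C2H sol_test])

lemma AE_V: "AE t in lebesgue. 0 \<le> t \<longrightarrow> W1 t \<in> V_space \<Omega> \<and> W2 t \<in> V_space \<Omega>"
proof -
  have "AE t in lebesgue. 0 \<le> t \<longrightarrow> W1 t \<in> V_space \<Omega>" "AE t in lebesgue. 0 \<le> t \<longrightarrow> W2 t \<in> V_space \<Omega>"
    using L1V L2V by (auto simp: L2loc_V_def)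
  then show ?thesis by eventually_elim auto
qed

text \<open>Integrating the bound of \<open>ns_form_V\<close> over \<open>[s, t]\<close> gives a
  quantitative substitute for a time derivative in the dual of V. The second term is an increment of
  the primitive \<open>weight_int\<close>, so its difference quotients can be averaged like those of
  the energy.\<close>

lemma increment_bound_sol:
  assumes p: "p \<in> solenoidal_tests \<Omega>" and st: "0 < s" "s < t" "t \<le> b" and l: "0 < l"
    and R: "\<And>t. t \<in> {0..b} \<Longrightarrow> nrm M (W1 t) \<le> R \<and> nrm M (W2 t) \<le> R"
  shows "\<bar>ip M (\<lambda>x. w t x - w s x) p\<bar> \<le> l * (t - s) * (H1_norm \<Omega> p)\<^sup>2 + (dual_const (R + 1))\<^sup>2 / l * (weight_int t - weight_int s)"
proof -
  let ?c = "(dual_const (R + 1))\<^sup>2 / l"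
  define f where "f r = l * (H1_norm \<Omega> p)\<^sup>2 + ?c * weight r" for r
  have Qi: "weight absolutely_integrable_on {s..t}" by (rule weight_integrable_sub) (use st in auto)
  have c: "(\<lambda>r. l * (H1_norm \<Omega> p)\<^sup>2) absolutely_integrable_on {s..t}"
    by (intro absolutely_integrable_continuous_real continuous_intros)
  have fi: "f absolutely_integrable_on {s..t}" unfolding f_def
    by (intro set_integral_add(1) c set_integrable_mult_right Qi)
  have Ai: "(\<lambda>r. At r p) absolutely_integrable_on {s..t}"
    by (intro absolutely_integrable_continuous_real continuous_on_subset[OF At_continuous[OF p]]) (use st in auto)
  have bnd: "AE r in lebesgue. r \<in> {s..t} \<longrightarrow> \<bar>At r p\<bar> \<le> f r"
    using AE_V
  proof eventually_elim
    case (elim r)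
    show ?case
    proof
      assume r: "r \<in> {s..t}"
      have "\<bar>At r p\<bar> \<le> l * (H1_norm \<Omega> p)\<^sup>2 + (dual_const (R + 1))\<^sup>2 * h1_weight (W1 r) (W2 r) / l"
        by (rule ns_form_V(1)[OF _ _ p _ _ l]) (use elim r st R[of r] in auto)
      then show "\<bar>At r p\<bar> \<le> f r" by (simp add: f_def weight_def)
    qed
  qed
  have "integral {s..t} (\<lambda>r. At r p) \<le> integral {s..t} f"
  proof (rule hk_mono_AE[OF Ai fi])
    show "AE r in lebesgue. r \<in> {s..t} \<longrightarrow> At r p \<le> f r" using bnd by eventually_elim auto
  qed
  moreover have "integral {s..t} (\<lambda>r. - At r p) \<le> integral {s..t} f"
  proof (rule hk_mono_AE[OF _ fi])
    show "(\<lambda>r. - At r p) absolutely_integrable_on {s..t}"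
      by (intro absolutely_integrable_continuous_real continuous_intros continuous_on_subset[OF At_continuous[OF p]]) (use st in auto)
    show "AE r in lebesgue. r \<in> {s..t} \<longrightarrow> - At r p \<le> f r" using bnd by eventually_elim auto
  qed
  ultimately have "\<bar>integral {s..t} (\<lambda>r. At r p)\<bar> \<le> integral {s..t} f" by simp
  also have "integral {s..t} f = integral {s..t} (\<lambda>r. l * (H1_norm \<Omega> p)\<^sup>2) + integral {s..t} (\<lambda>r. ?c * weight r)"
    unfolding f_def by (rule Henstock_Kurzweil_Integration.integral_add)
      (rule set_lebesgue_integral_eq_integral(1), intro c set_integrable_mult_right Qi)+
  also have "\<dots> = l * (t - s) * (H1_norm \<Omega> p)\<^sup>2 + ?c * (weight_int t - weight_int s)"
    using st weight_int_diff[of s t] by simp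
  finally show ?thesis using identity[OF p st(1,2)] by (simp add: w_def)
qed

text \<open>Both sides are continuous in the H^1 norm of the test field, since no derivative of it
  appears in the pairing. The extension to V matters because the field inserted later is an error
  \<open>w t - s t\<close>.\<close>

lemma increment_bound:
  assumes z: "z \<in> V_space \<Omega>" and st: "0 < s" "s < t" "t \<le> b" and l: "0 < l"
    and R: "\<And>t. t \<in> {0..b} \<Longrightarrow> nrm M (W1 t) \<le> R \<and> nrm M (W2 t) \<le> R"
  shows "\<bar>ip M (\<lambda>x. w t x - w s x) z\<bar> \<le> l * (t - s) * (H1_norm \<Omega> z)\<^sup>2 + (dual_const (R + 1))\<^sup>2 / l * (weight_int t - weight_int s)"
proof -
  obtain p where p: "\<And>n. p n \<in> solenoidal_tests \<Omega>" "(\<lambda>n. H1_norm \<Omega> (\<lambda>x. z x - p n x)) \<longlonglongrightarrow> 0"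
    using V_space_seq[OF z] by blast
  note H = V_H1[OF z] test_H1(1)[OF sol_test[OF p(1)]]
  have d: "sqi M (\<lambda>x. w t x - w s x)" by (intro sqi_diff w_sqi) (use st in auto)
  have "(\<lambda>n. nrm M (\<lambda>x. p n x - z x)) \<longlonglongrightarrow> 0"
    by (rule Lim_null_comparison[OF always_eventually p(2)])
       (use nrm_le_H1_norm in \<open>simp add: nrm_minus_commute[of _ _ z]\<close>)
  then have l1: "(\<lambda>n. ip M (\<lambda>x. w t x - w s x) (p n)) \<longlonglongrightarrow> ip M (\<lambda>x. w t x - w s x) z"
    by (intro ip_tendsto[where I = UNIV]) (use d H1_sqi H in \<open>auto simp: nrm_def[of M "\<lambda>x. 0"]\<close>)
  have l2: "(\<lambda>n. H1_norm \<Omega> (p n)) \<longlonglongrightarrow> H1_norm \<Omega> z"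
    by (rule LIM_zero_cancel, rule Lim_null_comparison[OF always_eventually p(2)])
       (use H1_norm_diff_abs[OF H] in \<open>simp add: abs_minus_commute\<close>)
  show ?thesis
  proof (rule LIMSEQ_le)
    show "(\<lambda>n. \<bar>ip M (\<lambda>x. w t x - w s x) (p n)\<bar>) \<longlonglongrightarrow> \<bar>ip M (\<lambda>x. w t x - w s x) z\<bar>" by (rule tendsto_rabs[OF l1])
    show "(\<lambda>n. l * (t - s) * (H1_norm \<Omega> (p n))\<^sup>2 + (dual_const (R + 1))\<^sup>2 / l * (weight_int t - weight_int s)) \<longlonglongrightarrow>
      l * (t - s) * (H1_norm \<Omega> z)\<^sup>2 + (dual_const (R + 1))\<^sup>2 / l * (weight_int t - weight_int s)"
      by (intro tendsto_intros l2)
    show "\<exists>N. \<forall>n\<ge>N. \<bar>ip M (\<lambda>x. w t x - w s x) (p n)\<bar> \<le> l * (t - s) * (H1_norm \<Omega> (p n))\<^sup>2 + (dual_const (R + 1))\<^sup>2 / l * (weight_int t - weight_int s)"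
      using increment_bound_sol[OF p(1) st l R] by blast
  qed
qed

text \<open>The increment of the energy over a backward time step is at most twice the pairing of the
  increment of the difference with its final value. Replacing that value by a simple
  function leaves a scalar average, which converges, and an error controlled by
  \<open>increment_bound\<close>; then the step size tends to zero.\<close>

lemma energy_step:
  assumes ab: "0 < a" "a < b" and l: "0 < l"
    and R: "\<And>t. t \<in> {0..b} \<Longrightarrow> nrm M (W1 t) \<le> R \<and> nrm M (W2 t) \<le> R"
    and s: "simple_fun s" "range s \<subseteq> solenoidal_tests \<Omega>"
    and D: "integrable lebesgue D" "\<And>t. 0 \<le> D t" "integral\<^sup>L lebesgue D \<le> \<epsilon>"
    and sD: "AE t in lebesgue. t \<in> {0..b} \<longrightarrow> W1 t \<in> V_space \<Omega> \<and> W2 t \<in> V_space \<Omega> \<and>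
        (H1_norm \<Omega> (\<lambda>x. w t x - s t x))\<^sup>2 \<le> D t"
  shows "energy b - energy a \<le> integral {a..b} (\<lambda>t. 2 * growth_const * weight t * energy t) + 4 * l * \<epsilon> + 4 * (dual_const (R + 1))\<^sup>2 / l * (weight_int b - weight_int a)"
proof -
  let ?c = "(dual_const (R + 1))\<^sup>2 / l"
  have s_sol: "s t \<in> solenoidal_tests \<Omega>" for t using s(2) by auto
  \<comment> \<open>The step \<open>a / (n + 2)\<close> is strictly smaller than \<open>a\<close>,
    so \<open>t - h n\<close> is positive for every \<open>t\<close> in
    \<open>[a, b]\<close>.\<close>
  define h where "h n = a * inverse (real (Suc (Suc n)))" for n
  have h: "0 < h n" "h n < a" for n
    using ab(1) by (auto simp: h_def field_simps simp del: of_nat_Suc)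
  have h0: "h \<longlonglongrightarrow> 0"
    unfolding h_def using tendsto_mult[OF tendsto_const[of a] LIMSEQ_Suc[OF LIMSEQ_inverse_real_of_nat]] by simp
  define P where "P f t = integral {0..max 0 t} (\<lambda>r. At r f)" for f t
  have Pc: "continuous_on UNIV (P f)" if "f \<in> solenoidal_tests \<Omega>" for f
    unfolding P_def
  proof (rule continuous_on_max0, rule continuous_on_Ici)
    fix T :: real assume "T > 0"
    show "continuous_on {0..T} (\<lambda>t. integral {0..t} (\<lambda>r. At r f))"
      by (intro indefinite_integral_continuous_1 integrable_continuous_interval continuous_on_subset[OF At_continuous[OF that]]) auto
  qed
  have Pdiff: "P f t - P f r = integral {r..t} (\<lambda>r. At r f)" if "f \<in> solenoidal_tests \<Omega>" "0 \<le> r" "r \<le> t" for f r t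
    using Henstock_Kurzweil_Integration.integral_combine[of 0 r t "\<lambda>r. At r f"]
      integrable_continuous_interval[OF continuous_on_subset[OF At_continuous[OF that(1)]], of 0 t] that
    by (simp add: P_def max_def)
  \<comment> \<open>A bound uniform in \<open>t\<close> exists because \<open>s\<close> takes
    finitely many values and each of them gives a continuous scalar function on
    \<open>[0, b]\<close>.\<close>
  obtain B where B: "B \<ge> 0" "\<And>t r. r \<in> {0..b} \<Longrightarrow> \<bar>At r (s t)\<bar> \<le> B"
  proof -
    have "\<exists>C\<ge>0. \<forall>r\<in>{0..b}. \<bar>At r f\<bar> \<le> C" if "f \<in> solenoidal_tests \<Omega>" for f
    proof -
      have "bounded ((\<lambda>r. At r f) ` {0..b})"
        by (intro compact_imp_bounded compact_continuous_image continuous_on_subset[OF At_continuous[OF that]]) auto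
      then obtain C where "\<forall>r\<in>{0..b}. \<bar>At r f\<bar> \<le> C" unfolding bounded_iff by auto
      then show ?thesis by (intro exI[of _ "max 0 C"]) (auto simp: le_max_iff_disj)
    qed
    then obtain C where C: "\<And>f. f \<in> solenoidal_tests \<Omega> \<Longrightarrow> C f \<ge> 0 \<and> (\<forall>r\<in>{0..b}. \<bar>At r f\<bar> \<le> C f)" by metis
    have fin: "finite (range s)" using s(1) by (simp add: simple_fun_def)
    show ?thesis
    proof (rule that[of "sum C (range s)"])
      show "0 \<le> sum C (range s)" using C s(2) by (intro sum_nonneg) auto
      fix t r assume r: "r \<in> {0..b}"
      have "\<bar>At r (s t)\<bar> \<le> C (s t)" using C[OF s_sol] r by auto
      also have "\<dots> \<le> sum C (range s)" by (rule member_le_sum[OF _ _ fin]) (use C s(2) in auto)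
      finally show "\<bar>At r (s t)\<bar> \<le> sum C (range s)" .
    qed
  qed
  \<comment> \<open>The value \<open>s t\<close> is frozen in both primitives: this is the mean over
    \<open>[t - h n, t]\<close> of the form in its solution arguments, with one fixed test
    field.\<close>
  define J where "J n t = (P (s t) t - P (s t) (t - h n)) / h n" for n t
  have Jb: "\<bar>J n t\<bar> \<le> B" if t: "t \<in> {a..b}" for n t
  proof -
    have "norm (integral {t - h n..t} (\<lambda>r. At r (s t))) \<le> B * (t - (t - h n))"
      by (rule integral_bound) (use t h[of n] B(2)[of _ t] in \<open>auto intro: continuous_on_subset[OF At_continuous[OF s_sol]]\<close>)
    moreover have "P (s t) t - P (s t) (t - h n) = integral {t - h n..t} (\<lambda>r. At r (s t))"
      by (rule Pdiff[OF s_sol]) (use t h[of n] in auto)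
    ultimately show ?thesis using h[of n] by (simp add: J_def field_simps)
  qed
  have Ji: "J n absolutely_integrable_on {a..b}" for n
  proof (rule measurable_bounded_by_integrable_imp_absolutely_integrable[where g = "\<lambda>_. B"])
    have "J n \<in> borel_measurable lebesgue"
      unfolding J_def
    proof (rule simple_fun_measurable[OF s(1), where F = "\<lambda>f t. (P f t - P f (t - h n)) / h n"])
      fix f assume "f \<in> range s"
      then have f: "f \<in> solenoidal_tests \<Omega>" using s(2) by auto
      have "continuous_on UNIV (\<lambda>t. (P f t - P f (t - h n)) / h n)"
        by (intro continuous_intros Pc[OF f] continuous_on_compose2[OF Pc[OF f]]) (use h[of n] in auto)
      then show "(\<lambda>t. (P f t - P f (t - h n)) / h n) \<in> borel_measurable lebesgue"
        using borel_measurable_continuous_onI by (intro measurable_completion) simp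
    qed
    then show "J n \<in> borel_measurable (lebesgue_on {a..b})" by (rule measurable_restrict_space1)
  qed (use Jb in auto)
  have Jlim: "(\<lambda>n. J n t) \<longlonglongrightarrow> At t (s t)" if t: "t \<in> {a..b}" for t
  proof -
    have "(\<lambda>n. (integral {0..t} (\<lambda>r. At r (s t)) - integral {0..t - h n} (\<lambda>r. At r (s t))) / h n) \<longlonglongrightarrow> At t (s t)"
      by (rule primitive_backward_quotient[OF At_continuous[OF s_sol] _ h(1) h0]) (use t ab in auto)
    moreover have "J n t = (integral {0..t} (\<lambda>r. At r (s t)) - integral {0..t - h n} (\<lambda>r. At r (s t))) / h n" for n
      using t ab h(2)[of n] by (simp add: J_def P_def max_def)
    ultimately show ?thesis by simp
  qed
  have Jint: "(\<lambda>t. At t (s t)) integrable_on {a..b}" "(\<lambda>n. integral {a..b} (J n)) \<longlonglongrightarrow> integral {a..b} (\<lambda>t. At t (s t))"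
  proof -
    have 1: "\<And>n. J n integrable_on {a..b}" by (rule set_lebesgue_integral_eq_integral(1)[OF Ji])
    have 2: "(\<lambda>_. B) integrable_on {a..b}" by (rule integrable_const_ivl)
    show "(\<lambda>t. At t (s t)) integrable_on {a..b}" "(\<lambda>n. integral {a..b} (J n)) \<longlonglongrightarrow> integral {a..b} (\<lambda>t. At t (s t))"
      by (rule dominated_convergence[where f = J, OF 1 2]; use Jb Jlim in simp)+
  qed
  have Di: "D absolutely_integrable_on {c..d}" for c d
    unfolding set_integrable_def by (rule integrable_mult_indicator[OF _ D(1)]) simp
  have Dle: "integral {a..b} D \<le> \<epsilon>"
  proof -
    have "integral {a..b} D = (LINT t|lebesgue. indicator {a..b} t *\<^sub>R D t)"
      using set_lebesgue_integral_eq_integral(2)[OF Di] by (simp add: set_lebesgue_integral_def)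
    also have "\<dots> \<le> integral\<^sup>L lebesgue D"
      by (rule integral_mono) (use Di[of a b] D in \<open>auto simp: set_integrable_def indicator_def\<close>)
    finally show ?thesis using D(3) by simp
  qed
  \<comment> \<open>In the pairing of the increment with \<open>w t\<close>, the part along
    \<open>s t\<close> is exactly \<open>h n * J n t\<close>, and the part along
    \<open>w t - s t\<close> is bounded by \<open>increment_bound\<close>. Its first term contains
    the factor \<open>h n\<close>, which the quotient cancels.\<close>
  have pw: "AE t in lebesgue. t \<in> {a..b} \<longrightarrow> (energy t - energy (t - h n)) / h n \<le> 2 * J n t + 2 * l * D t + 2 * ?c * ((weight_int t - weight_int (t - h n)) / h n)" for n
    using sD
  proof eventually_elim
    case (elim t)
    show ?case
    proof
      assume t: "t \<in> {a..b}"
      have t0: "0 < t - h n" "t - h n < t" "t \<le> b" using t h[of n] by auto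
      have V: "W1 t \<in> V_space \<Omega>" "W2 t \<in> V_space \<Omega>" "(H1_norm \<Omega> (\<lambda>x. w t x - s t x))\<^sup>2 \<le> D t" using elim t ab by auto
      let ?d = "\<lambda>x. w t x - w (t - h n) x"
      note q = w_sqi[of t] w_sqi[of "t - h n"] sqi_test[OF sol_test[OF s_sol[of t]]]
      have zV: "(\<lambda>x. w t x - s t x) \<in> V_space \<Omega>" unfolding w_def by (intro V_diff V sol_V s_sol)
      have "\<bar>ip M ?d (\<lambda>x. w t x - s t x)\<bar> \<le> l * (t - (t - h n)) * (H1_norm \<Omega> (\<lambda>x. w t x - s t x))\<^sup>2 + ?c * (weight_int t - weight_int (t - h n))"
        by (rule increment_bound[OF zV t0 l R])
      also have "\<dots> \<le> l * h n * D t + ?c * (weight_int t - weight_int (t - h n))"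
        using V(3) l h[of n] by (simp add: mult_left_mono)
      finally have 1: "ip M ?d (\<lambda>x. w t x - s t x) \<le> l * h n * D t + ?c * (weight_int t - weight_int (t - h n))" by (simp add: abs_le_iff)
      have 2: "ip M ?d (s t) = h n * J n t"
        using identity[OF s_sol t0(1,2), of t] Pdiff[OF s_sol, of "t - h n" t t] t0 h[of n] by (simp add: w_def J_def)
      have "energy t - energy (t - h n) \<le> 2 * ip M ?d (w t)" unfolding energy_def by (rule nrm_diff_lower) (use q t0 in auto)
      also have "ip M ?d (w t) = ip M ?d (s t) + ip M ?d (\<lambda>x. w t x - s t x)"
        using q t0 by (simp add: ip_diff_right sqi_diff)
      finally have "energy t - energy (t - h n) \<le> 2 * (h n * J n t) + 2 * (l * h n * D t + ?c * (weight_int t - weight_int (t - h n)))" using 1 2 by simp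
      then have "(energy t - energy (t - h n)) / h n \<le> (2 * (h n * J n t) + 2 * (l * h n * D t + ?c * (weight_int t - weight_int (t - h n)))) / h n"
        using h[of n] by (intro divide_right_mono) auto
      also have "\<dots> = 2 * J n t + 2 * l * D t + 2 * ?c * ((weight_int t - weight_int (t - h n)) / h n)"
        using h[of n] by (simp add: add_divide_distrib distrib_left)
      finally show "(energy t - energy (t - h n)) / h n \<le> 2 * J n t + 2 * l * D t + 2 * ?c * ((weight_int t - weight_int (t - h n)) / h n)" .
    qed
  qed
  have ci: "(\<lambda>t. (f t - f (t - h n)) / h n) absolutely_integrable_on {a..b}" if f: "continuous_on {0..} f" for f :: "real \<Rightarrow> real" and n
  proof (intro absolutely_integrable_continuous_real continuous_intros)
    show "continuous_on {a..b} f" by (rule continuous_on_subset[OF f]) (use ab in auto)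
    show "continuous_on {a..b} (\<lambda>t. f (t - h n))"
      by (rule continuous_on_compose2[OF f]) (use ab h(2)[of n] in \<open>auto intro!: continuous_intros\<close>)
  qed (use h[of n] in auto)
  have ineq: "integral {a..b} (\<lambda>t. (energy t - energy (t - h n)) / h n) \<le> 2 * integral {a..b} (J n) + 2 * l * \<epsilon>
      + 2 * ?c * integral {a..b} (\<lambda>t. (weight_int t - weight_int (t - h n)) / h n)" for n
  proof -
    note i = set_integrable_mult_right[OF Ji[of n], of 2] set_integrable_mult_right[OF Di[of a b], of "2 * l"]
      set_integrable_mult_right[OF ci[OF weight_int_continuous, of n], of "2 * ?c"]
    note i' = i[THEN set_lebesgue_integral_eq_integral(1)]
    have "integral {a..b} (\<lambda>t. (energy t - energy (t - h n)) / h n) \<le> integral {a..b} (\<lambda>t. 2 * J n t + 2 * l * D t + 2 * ?c * ((weight_int t - weight_int (t - h n)) / h n))"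
      by (rule hk_mono_AE[OF ci[OF energy_continuous] _ pw]) (intro set_integral_add i)
    also have "\<dots> = integral {a..b} (\<lambda>t. 2 * J n t) + integral {a..b} (\<lambda>t. 2 * l * D t) + integral {a..b} (\<lambda>t. 2 * ?c * ((weight_int t - weight_int (t - h n)) / h n))"
      using Henstock_Kurzweil_Integration.integral_add[OF Henstock_Kurzweil_Integration.integrable_add[OF i'(1,2)] i'(3)]
        Henstock_Kurzweil_Integration.integral_add[OF i'(1,2)] by simp
    also have "\<dots> = 2 * integral {a..b} (J n) + 2 * l * integral {a..b} D + 2 * ?c * integral {a..b} (\<lambda>t. (weight_int t - weight_int (t - h n)) / h n)"
      by (simp only: integral_mult_right)
    also have "2 * l * integral {a..b} D \<le> 2 * l * \<epsilon>" using Dle l by simp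
    finally show ?thesis by simp
  qed
  have lim: "energy b - energy a \<le> 2 * integral {a..b} (\<lambda>t. At t (s t)) + 2 * l * \<epsilon> + 2 * ?c * (weight_int b - weight_int a)"
  proof (rule LIMSEQ_le)
    show "(\<lambda>n. integral {a..b} (\<lambda>t. (energy t - energy (t - h n)) / h n)) \<longlonglongrightarrow> energy b - energy a"
      by (rule average_difference[OF energy_continuous ab h h0])
    show "(\<lambda>n. 2 * integral {a..b} (J n) + 2 * l * \<epsilon> + 2 * ?c * integral {a..b} (\<lambda>t. (weight_int t - weight_int (t - h n)) / h n))
       \<longlonglongrightarrow> 2 * integral {a..b} (\<lambda>t. At t (s t)) + 2 * l * \<epsilon> + 2 * ?c * (weight_int b - weight_int a)"
      by (intro tendsto_intros Jint(2) average_difference[OF weight_int_continuous ab h h0])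
  qed (use ineq in blast)
  have Asi: "(\<lambda>t. At t (s t)) absolutely_integrable_on {a..b}"
  proof (rule measurable_bounded_by_integrable_imp_absolutely_integrable[where g = "\<lambda>_. B"])
    have "(\<lambda>t. indicator {a..b} t * At t (s t)) \<in> borel_measurable lebesgue"
    proof (rule simple_fun_measurable[OF s(1), where F = "\<lambda>f t. indicator {a..b} t * At t f"])
      fix f assume "f \<in> range s"
      then have f: "f \<in> solenoidal_tests \<Omega>" using s(2) by auto
      have "(\<lambda>t. At t f) absolutely_integrable_on {a..b}"
        by (intro absolutely_integrable_continuous_real continuous_on_subset[OF At_continuous[OF f]]) (use ab in auto)
      then show "(\<lambda>t. indicator {a..b} t * At t f) \<in> borel_measurable lebesgue"
        unfolding set_integrable_def by (simp add: borel_measurable_integrable)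
    qed
    then show "(\<lambda>t. At t (s t)) \<in> borel_measurable (lebesgue_on {a..b})"
      by (subst borel_measurable_restrict_space_iff) simp_all
  qed (use B ab in auto)
  have QEi: "(\<lambda>t. growth_const * (weight t * energy t)) absolutely_integrable_on {a..b}"
    by (intro set_integrable_mult_right abs_integrable_mult_continuous weight_integrable_sub continuous_on_subset[OF energy_continuous]) (use ab in auto)
  \<comment> \<open>The approximation is paid for a second time when the form at \<open>s t\<close>
    is compared with the form at \<open>w t\<close>. Two payments of the same size explain the
    factors 4 in the conclusion.\<close>
  have "integral {a..b} (\<lambda>t. At t (s t)) \<le> integral {a..b} (\<lambda>t. growth_const * (weight t * energy t) + l * D t + ?c * weight t)"
  proof (rule hk_mono_AE[OF Asi])
    show "(\<lambda>t. growth_const * (weight t * energy t) + l * D t + ?c * weight t) absolutely_integrable_on {a..b}"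
      by (intro set_integral_add QEi set_integrable_mult_right Di weight_integrable_sub) (use ab in auto)
    show "AE t in lebesgue. t \<in> {a..b} \<longrightarrow> At t (s t) \<le> growth_const * (weight t * energy t) + l * D t + ?c * weight t"
      using sD
    proof eventually_elim
      case (elim t)
      show ?case
      proof
        assume t: "t \<in> {a..b}"
        have V: "W1 t \<in> V_space \<Omega>" "W2 t \<in> V_space \<Omega>" "(H1_norm \<Omega> (\<lambda>x. w t x - s t x))\<^sup>2 \<le> D t" using elim t ab by auto
        have "At t (s t) \<le> growth_const * h1_weight (W1 t) (W2 t) * (nrm M (\<lambda>x. W1 t x - W2 t x))\<^sup>2
            + l * (H1_norm \<Omega> (\<lambda>x. s t x - (W1 t x - W2 t x)))\<^sup>2 + (dual_const (R + 1))\<^sup>2 * h1_weight (W1 t) (W2 t) / l"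
          by (rule ns_form_V(2)[OF V(1,2) s_sol _ _ l]) (use R[of t] t ab in auto)
        moreover have "H1_norm \<Omega> (\<lambda>x. s t x - (W1 t x - W2 t x)) = H1_norm \<Omega> (\<lambda>x. w t x - s t x)"
          unfolding w_def by (intro H1_norm_commute H1_diff V_H1 V test_H1 sol_test s_sol)
        moreover have "l * (H1_norm \<Omega> (\<lambda>x. w t x - s t x))\<^sup>2 \<le> l * D t" using V(3) l by simp
        ultimately show "At t (s t) \<le> growth_const * (weight t * energy t) + l * D t + ?c * weight t"
          by (simp add: weight_def energy_def w_def)
      qed
    qed
  qed
  also have "\<dots> = integral {a..b} (\<lambda>t. growth_const * (weight t * energy t)) + l * integral {a..b} D + ?c * integral {a..b} weight"
  proof -
    note i = QEi set_integrable_mult_right[OF Di[of a b], of l] set_integrable_mult_right[OF weight_integrable_sub[of a b], of ?c]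
    have i': "(\<lambda>t. growth_const * (weight t * energy t)) integrable_on {a..b}" "(\<lambda>t. l * D t) integrable_on {a..b}" "(\<lambda>t. ?c * weight t) integrable_on {a..b}"
      using i ab by (auto intro: set_lebesgue_integral_eq_integral(1))
    show ?thesis
      using Henstock_Kurzweil_Integration.integral_add[OF Henstock_Kurzweil_Integration.integrable_add[OF i'(1,2)] i'(3)]
        Henstock_Kurzweil_Integration.integral_add[OF i'(1,2)] by (simp only: integral_mult_right)
  qed
  also have "\<dots> \<le> integral {a..b} (\<lambda>t. growth_const * (weight t * energy t)) + l * \<epsilon> + ?c * (weight_int b - weight_int a)"
    using Dle l weight_int_diff[of a b] ab by simp
  finally have "2 * integral {a..b} (\<lambda>t. At t (s t)) \<le> 2 * integral {a..b} (\<lambda>t. growth_const * (weight t * energy t)) + 2 * l * \<epsilon> + 2 * ?c * (weight_int b - weight_int a)"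
    by simp
  moreover have "2 * integral {a..b} (\<lambda>t. growth_const * (weight t * energy t)) = integral {a..b} (\<lambda>t. 2 * growth_const * weight t * energy t)"
    by (simp only: integral_mult_right[symmetric]) (simp add: mult_ac)
  moreover define X where "X = ?c * (weight_int b - weight_int a)"
  then have "2 * ?c * (weight_int b - weight_int a) = 2 * X" "4 * (dual_const (R + 1))\<^sup>2 / l * (weight_int b - weight_int a) = 4 * X" by simp_all
  ultimately show ?thesis using lim by linarith
qed

text \<open>\<open>energy_step\<close> holds for each weight \<open>l\<close> separately, and the
  approximation may depend on \<open>l\<close>; choosing it accordingly and letting \<open>l\<close>
  grow removes both error terms.\<close>

lemma energy_inequality:
  assumes ab: "0 < a" "a < b"
  shows "energy b - energy a \<le> integral {a..b} (\<lambda>t. 2 * growth_const * weight t * energy t)"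
proof -
  obtain R where R: "R \<ge> 0" "\<And>t. t \<in> {0..b} \<Longrightarrow> nrm M (W1 t) \<le> R \<and> nrm M (W2 t) \<le> R" using bound_R by blast
  define I where "I = integral {a..b} (\<lambda>t. 2 * growth_const * weight t * energy t)"
  define K where "K = 4 * (dual_const (R + 1))\<^sup>2 * (weight_int b - weight_int a)"
  have b0: "0 < b" using ab by simp
  have step: "energy b - energy a \<le> I + (16 + K) / l" if l: "0 < l" for l
  proof -
    \<comment> \<open>Each solution is approximated with squared error \<open>1/l^2\<close>.
      Combining the two with \<open>(x + y)^2 \<le> 2 x^2 + 2 y^2\<close> gives total error
      \<open>4/l^2\<close>, so that \<open>4 * l * (4/l^2) = 16/l\<close>.\<close>
    have e: "0 < 1 / l\<^sup>2" using l by simp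
    obtain s1 D1 where 1: "simple_fun s1" "range s1 \<subseteq> solenoidal_tests \<Omega>"
      "integrable lebesgue D1" "\<And>t. 0 \<le> D1 t" "integral\<^sup>L lebesgue D1 < 1 / l\<^sup>2"
      "AE t in lebesgue. t \<in> {0..b} \<longrightarrow> W1 t \<in> V_space \<Omega> \<and> (H1_norm \<Omega> (\<lambda>x. W1 t x - s1 t x))\<^sup>2 \<le> D1 t"
      using bochner_approx[OF L1V b0 e] by blast
    obtain s2 D2 where 2: "simple_fun s2" "range s2 \<subseteq> solenoidal_tests \<Omega>"
      "integrable lebesgue D2" "\<And>t. 0 \<le> D2 t" "integral\<^sup>L lebesgue D2 < 1 / l\<^sup>2"
      "AE t in lebesgue. t \<in> {0..b} \<longrightarrow> W2 t \<in> V_space \<Omega> \<and> (H1_norm \<Omega> (\<lambda>x. W2 t x - s2 t x))\<^sup>2 \<le> D2 t"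
      using bochner_approx[OF L2V b0 e] by blast
    define s where "s t = (\<lambda>x. s1 t x - s2 t x)" for t
    have "energy b - energy a \<le> I + 4 * l * (4 / l\<^sup>2) + 4 * (dual_const (R + 1))\<^sup>2 / l * (weight_int b - weight_int a)"
      unfolding I_def
    proof (rule energy_step[OF ab l R(2), where s = s and D = "\<lambda>t. 2 * D1 t + 2 * D2 t"])
      show "simple_fun s" unfolding s_def by (rule simple_fun_map2[OF 1(1) 2(1)])
      show "range s \<subseteq> solenoidal_tests \<Omega>" using 1(2) 2(2) by (auto simp: s_def intro!: sol_diff)
      show "integrable lebesgue (\<lambda>t. 2 * D1 t + 2 * D2 t)" using 1(3) 2(3) by simp
      show "0 \<le> 2 * D1 t + 2 * D2 t" for t using 1(4) 2(4) by simp
      show "(LINT t|lebesgue. 2 * D1 t + 2 * D2 t) \<le> 4 / l\<^sup>2" using 1(3,5) 2(3,5) by simp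
      show "AE t in lebesgue. t \<in> {0..b} \<longrightarrow> W1 t \<in> V_space \<Omega> \<and> W2 t \<in> V_space \<Omega> \<and>
        (H1_norm \<Omega> (\<lambda>x. w t x - s t x))\<^sup>2 \<le> 2 * D1 t + 2 * D2 t"
        using 1(6) 2(6)
      proof eventually_elim
        case (elim t)
        show ?case
        proof
          assume t: "t \<in> {0..b}"
          let ?x = "H1_norm \<Omega> (\<lambda>x. W1 t x - s1 t x)" and ?y = "H1_norm \<Omega> (\<lambda>x. W2 t x - s2 t x)"
          have V: "W1 t \<in> V_space \<Omega>" "W2 t \<in> V_space \<Omega>" "?x\<^sup>2 \<le> D1 t" "?y\<^sup>2 \<le> D2 t" using elim t by auto
          have sol: "s1 t \<in> solenoidal_tests \<Omega>" "s2 t \<in> solenoidal_tests \<Omega>" using 1(2) 2(2) by auto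
          have "H1_norm \<Omega> (\<lambda>x. w t x - s t x) \<le> ?x + ?y" unfolding w_def s_def
            by (intro H1_norm_diff_diff V_H1 V test_H1 sol_test sol)
          then have "(H1_norm \<Omega> (\<lambda>x. w t x - s t x))\<^sup>2 \<le> (?x + ?y)\<^sup>2" by (rule power_mono) (rule H1_norm_nonneg)
          also have "\<dots> \<le> 2 * ?x\<^sup>2 + 2 * ?y\<^sup>2" using sum_squares_bound[of ?x ?y] by (simp add: power2_sum)
          also have "\<dots> \<le> 2 * D1 t + 2 * D2 t" using V by simp
          finally show "W1 t \<in> V_space \<Omega> \<and> W2 t \<in> V_space \<Omega> \<and> (H1_norm \<Omega> (\<lambda>x. w t x - s t x))\<^sup>2 \<le> 2 * D1 t + 2 * D2 t"
            using V by simp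
        qed
      qed
    qed
    also have "\<dots> = I + (16 + K) / l" using l by (simp add: K_def power2_eq_square field_simps)
    finally show ?thesis .
  qed
  have "(\<lambda>n. I + (16 + K) * inverse (real (Suc n))) \<longlonglongrightarrow> I + (16 + K) * 0"
    by (intro tendsto_intros LIMSEQ_inverse_real_of_nat)
  then have "energy b - energy a \<le> I + (16 + K) * 0"
    by (rule LIMSEQ_le_const) (use step[of "real (Suc _)"] in \<open>auto simp: divide_inverse\<close>)
  then show ?thesis by (simp add: I_def)
qed

lemma solutions_coincide:
  assumes "energy 0 = 0" "0 \<le> t"
  shows "energy t = 0"
proof (rule gronwall_zero[OF energy_continuous energy_nonneg assms(1) _ _ _ assms(2)])
  show "0 \<le> 2 * growth_const * weight t" for t using growth_const_nonneg weight_ge[of t] by simp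
  show "(\<lambda>t. 2 * growth_const * weight t) absolutely_integrable_on {0..T}" if "T > 0" for T
    by (rule set_integrable_mult_right[OF weight_integrable[OF that]])
qed (rule energy_inequality)

end

section \<open>Uniqueness for bounded backgrounds, and the bounds for the field
  \<open>v\<close>\<close>

section \<open>Uniqueness\<close>

lemma (in step_domain) weak_solution_unique:
  assumes v: "v \<in> borel_measurable M" "\<And>x. x \<in> \<Omega> \<Longrightarrow> norm (v x) \<le> Mv" "0 \<le> Mv" and \<nu>: "0 < \<nu>"
    and u1: "weak_solution \<nu> \<Omega> v u0 u1" and u2: "weak_solution \<nu> \<Omega> v u0 u2" and t: "0 \<le> t"
  shows "AE x in lebesgue. x \<in> \<Omega> \<longrightarrow> u1 t x = u2 t x"
proof -
  interpret ns_setting S \<Omega> v Mv \<nu>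
  proof
    \<comment> \<open>The first solution serves as the witness that \<open>v\<close> is weakly free
      of divergence.\<close>
    show "(LINT x|M. v x \<bullet> gradient f x) = 0" if "f \<in> test_functions \<Omega>" for f :: "complex \<Rightarrow> real"
      by (rule weak_div_imp_div_v[OF v(1,2) _ _ that, where u = u1])
         (use u1 in \<open>auto simp: weak_solution_def C_H_def\<close>)
  qed (use v \<nu> in auto)
  interpret two_solutions S \<Omega> v Mv \<nu> "\<lambda>t x. u1 t x - v x" "\<lambda>t x. u2 t x - v x"
  proof
    show "ip M (\<lambda>x. u1 t x - v x - (u2 t x - v x) - (u1 s x - v x - (u2 s x - v x))) \<phi> =
        integral {s..t} (\<lambda>r. ns_form (\<lambda>x. u1 r x - v x) (\<lambda>x. u2 r x - v x) \<phi>)"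
      if "\<phi> \<in> solenoidal_tests \<Omega>" "0 < s" "s < t" for \<phi> s t
      by (rule weak_solution_diff_identity[OF u1 u2 that])
  qed (use u1 u2 in \<open>auto simp: weak_solution_def\<close>)
  have "energy 0 = 0" using weak_solution_initial[OF u1 u2] by (simp add: energy_def w_def)
  then have "energy t = 0" using t by (rule solutions_coincide)
  then have "AE x in M. w t x = 0" using nrm_eq_0[OF w_sqi[OF t]] by (simp add: energy_def)
  then show ?thesis using sets_\<Omega> by (simp add: AE_restrict_space_iff w_def)
qed

lemma perp_eq: "perp z = \<i> * z"
  by (simp add: perp_def complex_eq_iff)

text \<open>The real derivative of a holomorphic map is multiplication by \<open>deriv T x\<close>,
  and the adjoint of a complex multiplication is multiplication by the conjugate.\<close>

lemma DT_transpose_holomorphic: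
  assumes "T holomorphic_on \<Omega>" "open \<Omega>" "x \<in> \<Omega>"
  shows "DT_transpose T x y = cnj (deriv T x) * y"
proof -
  have "(T has_field_derivative deriv T x) (at x)" by (rule holomorphic_derivI[OF assms])
  then have "frechet_derivative T (at x) = (*) (deriv T x)"
    unfolding has_field_derivative_def by (rule frechet_derivative_at[symmetric])
  moreover have "adjoint ((*) (deriv T x)) = (*) (cnj (deriv T x))"
    by (rule adjoint_unique) (simp add: inner_complex_def algebra_simps)
  ultimately show ?thesis by (simp add: DT_transpose_def)
qed

lemma v_field_eq:
  assumes "T holomorphic_on \<Omega>" "open \<Omega>" "x \<in> \<Omega>"
  shows "v_field \<alpha> \<Phi> lam T x = (\<alpha> * \<Phi> ((norm (T x) - 1) / lam)) *\<^sub>R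
    ((1 / (2 * pi)) *\<^sub>R (cnj (deriv T x) * ((\<i> * T x) /\<^sub>R (norm (T x))\<^sup>2)))"
  by (simp add: v_field_def cutoff_def H_field_def DT_transpose_holomorphic[OF assms] perp_eq)

lemma v_field_measurable:
  assumes T: "T holomorphic_on \<Omega>" "open \<Omega>" and nz: "\<And>x. x \<in> \<Omega> \<Longrightarrow> T x \<noteq> 0" and \<Phi>: "continuous_on UNIV \<Phi>" and lam: "lam \<noteq> 0"
  shows "v_field \<alpha> \<Phi> lam T \<in> borel_measurable (lebesgue_on \<Omega>)"
proof (rule continuous_imp_measurable_on_sets_lebesgue)
  have "continuous_on \<Omega> (\<lambda>x. (\<alpha> * \<Phi> ((norm (T x) - 1) / lam)) *\<^sub>R
    ((1 / (2 * pi)) *\<^sub>R (cnj (deriv T x) * ((\<i> * T x) /\<^sub>R (norm (T x))\<^sup>2))))"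
    by (intro continuous_intros continuous_on_compose2[OF \<Phi>] holomorphic_on_imp_continuous_on[OF T(1)]
      holomorphic_on_imp_continuous_on[OF holomorphic_deriv[OF T]]) (use nz lam in auto)
  then show "continuous_on \<Omega> (v_field \<alpha> \<Phi> lam T)"
    by (rule continuous_on_eq) (simp add: v_field_eq[OF T])
qed (use T in simp)

text \<open>As \<open>|T x| \<ge> 1\<close>, the factor \<open>T x / |T x|^2\<close> has norm at
  most one, and \<open>deriv T\<close> has to be bounded only where the cutoff is nonzero, that is,
  away from its singularities at the ends of the arc.\<close>

lemma v_field_bound:
  assumes T: "T holomorphic_on \<Omega>" "open \<Omega>" "x \<in> \<Omega>" and T1: "1 \<le> norm (T x)" and \<Phi>: "\<And>s. 0 \<le> \<Phi> s \<and> \<Phi> s \<le> 1"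
    and B: "\<Phi> ((norm (T x) - 1) / lam) \<noteq> 0 \<Longrightarrow> norm (deriv T x) \<le> B" "0 \<le> B"
  shows "norm (v_field \<alpha> \<Phi> lam T x) \<le> \<bar>\<alpha>\<bar> * B"
proof (cases "\<Phi> ((norm (T x) - 1) / lam) = 0")
  case True
  then show ?thesis using B by (simp add: v_field_eq[OF T])
next
  case False
  let ?c = "\<Phi> ((norm (T x) - 1) / lam)"
  have d: "norm (deriv T x) \<le> B" by (rule B(1)[OF False])
  have "norm (\<i> * T x /\<^sub>R (norm (T x))\<^sup>2) = 1 / norm (T x)" using T1 by (simp add: norm_mult power2_eq_square divide_simps)
  also have "\<dots> \<le> 1" by (rule divide_le_eq_1_pos[THEN iffD2]) (use T1 in linarith)+
  finally have q: "norm (\<i> * T x /\<^sub>R (norm (T x))\<^sup>2) \<le> 1" .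
  have p: "1 / (2 * pi) \<le> 1" using pi_gt3 by simp
  have "norm (v_field \<alpha> \<Phi> lam T x) = (\<bar>\<alpha>\<bar> * \<bar>?c\<bar>) * ((1 / (2 * pi)) * (norm (deriv T x) * norm (\<i> * T x /\<^sub>R (norm (T x))\<^sup>2)))"
    unfolding v_field_eq[OF T] norm_scaleR norm_mult complex_mod_cnj by (simp add: abs_mult)
  also have "\<dots> \<le> (\<bar>\<alpha>\<bar> * 1) * (1 * (B * 1))"
    using \<Phi>[of "(norm (T x) - 1) / lam"] B(2) by (intro mult_mono d p q mult_nonneg_nonneg) auto
  finally show ?thesis by simp
qed

text \<open>"Sufficiently large" is encoded by its consequence: the cutoff vanishes on the part of
  some ball around the arc that lies in \<open>\<Omega>\<close>. Equality is asserted at every time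
  because solutions are continuous in time with values in L^2.\<close>

theorem proposition5p1:
  fixes g :: "real \<Rightarrow> complex" and T :: "complex \<Rightarrow> complex"
    and \<nu> \<gamma> \<alpha> lam :: real and \<omega>0 :: "complex \<Rightarrow> real" and \<Phi> :: "real \<Rightarrow> real"
    and \<Omega> :: "complex set" and v u0 :: "complex \<Rightarrow> complex"
    and u1 u2 :: "real \<Rightarrow> complex \<Rightarrow> complex"
  assumes arc: "C2_arc g" "pathstart g = -1" "pathfinish g = 1"
    and segments: "finite_union_of_segments (path_image g \<inter> closed_segment (-1) 1)"
    and Omega: "\<Omega> = - path_image g"
    and T: "exterior_map g T"
    and \<nu>: "\<nu> > 0"
    and \<omega>0: "\<omega>0 \<in> test_functions \<Omega>"
    and \<alpha>: "\<alpha> = \<gamma> + (LINT x|lebesgue. \<omega>0 x)"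
    and Phi: "smooth \<Phi>" "mono \<Phi>" "\<And>s. 0 \<le> \<Phi> s \<and> \<Phi> s \<le> 1"
             "\<And>s. s \<ge> 2 \<Longrightarrow> \<Phi> s = 1" "\<And>s. s \<le> 1 \<Longrightarrow> \<Phi> s = 0"
    and lambda: "lam \<ge> 2"
                "\<exists>R. path_image g \<subseteq> ball 0 R \<and> (\<forall>x\<in>\<Omega> \<inter> ball 0 R. cutoff \<Phi> lam T x = 0)"
    and v: "v = v_field \<alpha> \<Phi> lam T"
    and u0: "u0 = (\<lambda>x. K_op \<Omega> T \<omega>0 x + \<alpha> *\<^sub>R H_field T x)"
    and u1: "weak_solution \<nu> \<Omega> v u0 u1"
    and u2: "weak_solution \<nu> \<Omega> v u0 u2"
  shows "\<forall>t\<ge>0. AE x in lebesgue. x \<in> \<Omega> \<longrightarrow> u1 t x = u2 t x"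
proof -
  have op: "open \<Omega>"
    using arc(1) unfolding Omega C2_arc_def by (intro open_Compl closed_arc_image) blast
  have hol: "T holomorphic_on \<Omega>" and bij: "bij_betw T \<Omega> unit_exterior"
    and bdd: "\<And>R. path_image g \<subseteq> ball 0 R \<Longrightarrow> bounded (deriv T ` (- ball 0 R))"
    using T unfolding exterior_map_def Let_def Omega by blast+
  have T1: "1 \<le> norm (T x)" if "x \<in> \<Omega>" for x
  proof -
    have "T x \<in> unit_exterior" using bij that by (auto simp: bij_betw_def)
    then have "T x \<in> - ball 0 1" using interior_subset by blast
    then show ?thesis by simp
  qed
  \<comment> \<open>One radius does both jobs: inside the ball the cutoff kills \<open>v\<close>,
    and outside it \<open>deriv T\<close> is bounded.\<close>
  obtain R where R: "path_image g \<subseteq> ball 0 R" "\<And>x. x \<in> \<Omega> \<Longrightarrow> x \<in> ball 0 R \<Longrightarrow> cutoff \<Phi> lam T x = 0"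
    using lambda(2) by auto
  obtain B where B: "B > 0" "\<And>x. x \<notin> ball 0 R \<Longrightarrow> norm (deriv T x) \<le> B"
    using bdd[OF R(1)] unfolding bounded_pos by auto
  \<comment> \<open>The shift moves the transition interval of \<open>\<Phi>\<close> from
    \<open>[1, 2]\<close> to \<open>[0, 1]\<close>.\<close>
  interpret smooth_step "\<lambda>s. \<Phi> (s + 1)"
  proof
    show "smooth (\<lambda>s. \<Phi> (s + 1))" by (rule smooth_affine[OF bounded_linear_ident Phi(1)])
  qed (use Phi in auto)
  interpret step_domain "\<lambda>s. \<Phi> (s + 1)" \<Omega> by unfold_locales (rule op)
  have "v \<in> borel_measurable M" unfolding v
    by (rule v_field_measurable[OF hol op _ smooth_continuous[OF Phi(1)]]) (use T1 lambda(1) in fastforce)+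
  moreover have "norm (v x) \<le> \<bar>\<alpha>\<bar> * B" if x: "x \<in> \<Omega>" for x
    unfolding v
  proof (rule v_field_bound[OF hol op x T1[OF x] Phi(3)])
    show "norm (deriv T x) \<le> B" if "\<Phi> ((norm (T x) - 1) / lam) \<noteq> 0"
      using that R(2)[OF x] B(2)[of x] unfolding cutoff_def by blast
  qed (use B in simp)
  moreover have "0 \<le> \<bar>\<alpha>\<bar> * B" using B by simp
  ultimately show ?thesis using weak_solution_unique[OF _ _ _ \<nu> u1 u2] by blast
qed

end
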